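(* Let $E_0=C^\infty(S^1)$, let $E_1$ be the topological linear subspace of $C^\infty([0,\infty)\times S^1\times\mathbf R)$ consisting of those $\varphi$ such that for every $T\ge0$ there is $M<\infty$ with $\varphi(t,\eta,\xi)=0$ whenever $t\le T$ and $|\xi|\ge M$, and put $E=E_0\times E_1$ and $F=C^\infty([0,\infty)\times S^1)$. Let $\Sigma$ be the set of all $((y_0,\varphi),y)$ with $(y_0,\varphi)\in E$, $y\in C^1([0,\infty)\times S^1)$ and $$y(t,\eta)=y_0(\eta-t)+\int_0^t\varphi\bigl(\tau,\eta-t+\tau,y(\tau,\eta-t+\tau)\bigr)\,d\tau\qquad\text{for all }t\ge0,\ \eta\in\mathbf R$$ (equivalently, $\partial_1y+\partial_2y=\varphi(t,\eta,y(t,\eta))$ with $y(0,\cdot)=y_0$). Then $\Sigma$ is (the graph of) a function with domain all of $E$ and values in $F$, and $(E,F,\Sigma)\in C^\infty_\pi$.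
   Context: All spaces are real and functions real-valued. A function "on $\cdots\times S^1\times\cdots$" means a function on $\cdots\times\mathbf R\times\cdots$ that is $1$-periodic in the corresponding variable. For $i\in\{0,1,\dots\}\cup\{\infty\}$, $C^i$ on sets such as $\mathbf R$, $[0,\infty)\times\mathbf R$, $[0,\infty)\times\mathbf R\times\mathbf R$ denotes the functions that are continuous, $C^i$ in the interior, with all partial derivatives of order $<i+1$ extending continuously to the whole set, with the topology of uniform convergence of these derivatives on compact sets; the spaces with $S^1$ are the subspaces of periodic functions with the induced topology. Class $C^\infty_\pi$ (Keller): for locally convex $E,F$ and a function $f$ with $\operatorname{dom}f\subseteq E$ and values in $F$, put $d_uf(x)=\lim_{t\to0}t^{-1}(f(x+tu)-f(x))$ and $d(u_1,\dots,u_l)f=d_{u_l}\cdots d_{u_1}f$. $(E,F,f)\in C^\infty_\pi$ means: $\operatorname{dom}f$ is open in $E$ and for every integer $l\ge0$ and $x\in\operatorname{dom}f$, the map $d^lf(x):(u_1,\dots,u_l)\mapsto d(u_1,\dots,u_l)f(x)$ is everywhere defined, $l$-linear and continuous $E^l\to F$, and for every zero neighbourhood $W$ in $F$ there is a zero neighbourhood $U$ in $E$ such that for every $\varepsilon>0$ there is a zero neighbourhood $V$ in $E$ with $(d^lf(x+v)-d^lf(x))[U^l]\subseteq\varepsilon W$ for all $v\in V$. *)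

theory Defs
  imports "HOL-Analysis.Analysis" "HOL-Library.Function_Algebras"
begin

section \<open>Function types as real vector spaces\<close>

instantiation "fun" :: (type, scaleR) scaleR
begin

definition scaleR_fun :: "real \<Rightarrow> ('a \<Rightarrow> 'b) \<Rightarrow> 'a \<Rightarrow> 'b"
  where "scaleR_fun c f = (\<lambda>x. c *\<^sub>R f x)"

instance ..

end

lemma scaleR_fun_apply [simp]: "(c *\<^sub>R f) x = c *\<^sub>R f x"
  by (simp add: scaleR_fun_def)

instance "fun" :: (type, real_vector) real_vector
  by standard (simp_all add: fun_eq_iff scaleR_add_right scaleR_add_left)


section \<open>Locally convex spaces and Keller's class \<open>C\<^sup>\<infinity>\<^sub>\<pi>\<close>\<close>

text \<open>
  A topological vector space is represented by its topology \<open>E\<close>, whose underlying set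
  \<^term>\<open>topspace E\<close> is a linear subspace of an ambient type of class \<open>real_vector\<close>.
\<close>

definition zero_nbhd :: "'a::real_vector topology \<Rightarrow> 'a set \<Rightarrow> bool"
  where "zero_nbhd E U \<longleftrightarrow> U \<subseteq> topspace E \<and> (\<exists>V. openin E V \<and> 0 \<in> V \<and> V \<subseteq> U)"

text \<open>
  Hausdorffness is part of the notion: it makes the limits defining derivatives unique.
\<close>

definition locally_convex_space :: "'a::real_vector topology \<Rightarrow> bool"
  where "locally_convex_space E \<longleftrightarrow>
    subspace (topspace E) \<and>
    continuous_map (prod_topology E E) E (\<lambda>(x, y). x + y) \<and>
    continuous_map (prod_topology euclideanreal E) E (\<lambda>(c, x). c *\<^sub>R x) \<and>
    Hausdorff_space E \<and>
    (\<forall>U. zero_nbhd E U \<longrightarrow> (\<exists>V. zero_nbhd E V \<and> convex V \<and> V \<subseteq> U))"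

text \<open>
  Partial functions are represented by their graphs. The value \<^term>\<open>graph_app f x\<close> is
  meaningful only for \<open>f\<close> single valued and \<^prop>\<open>x \<in> Domain f\<close>.
\<close>

definition graph_app :: "('a \<times> 'b) set \<Rightarrow> 'a \<Rightarrow> 'b"
  where "graph_app f x = (THE y. (x, y) \<in> f)"

text \<open>
  The partial function \<open>d\<^sub>u f\<close>, for \<open>f\<close> with values in \<open>F\<close>: its domain consists of those points of
  \<^term>\<open>Domain f\<close> at which the difference quotient is defined for all small \<open>t \<noteq> 0\<close> and
  converges in \<open>F\<close> as \<open>t \<rightarrow> 0\<close>.
\<close>

definition dir_deriv ::
    "'b::real_vector topology \<Rightarrow> 'a::real_vector \<Rightarrow> ('a \<times> 'b) set \<Rightarrow> ('a \<times> 'b) set"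
  where "dir_deriv F u f =
    {(x, y). x \<in> Domain f \<and>
       (\<forall>\<^sub>F t in at (0::real). x + t *\<^sub>R u \<in> Domain f) \<and>
       limitin F (\<lambda>t. inverse t *\<^sub>R (graph_app f (x + t *\<^sub>R u) - graph_app f x)) y (at 0)}"

text \<open>
  \<open>d(u\<^sub>1, \<dots>, u\<^sub>l) f = d\<^bsub>u\<^sub>l\<^esub> \<dots> d\<^bsub>u\<^sub>1\<^esub> f\<close>; the first vector of the list is
  differentiated along first.
\<close>

definition dir_derivs ::
    "'b::real_vector topology \<Rightarrow> 'a::real_vector list \<Rightarrow> ('a \<times> 'b) set \<Rightarrow> ('a \<times> 'b) set"
  where "dir_derivs F us f = fold (dir_deriv F) us f"

text \<open>
  Elements of \<open>U\<^sup>l\<close> are extensional functions \<open>u\<close> on \<open>{..<l}\<close>, so that the topology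
  of \<open>E\<^sup>l\<close> is the library's product topology.
\<close>

abbreviation tuples :: "nat \<Rightarrow> 'a set \<Rightarrow> (nat \<Rightarrow> 'a) set"
  where "tuples l U \<equiv> (\<Pi>\<^sub>E i\<in>{..<l}. U)"

definition dl_defined ::
    "'a::real_vector topology \<Rightarrow> 'b::real_vector topology \<Rightarrow> nat \<Rightarrow> ('a \<times> 'b) set \<Rightarrow> 'a \<Rightarrow> bool"
  where "dl_defined E F l f x \<longleftrightarrow>
    (\<forall>u\<in>tuples l (topspace E). x \<in> Domain (dir_derivs F (map u [0..<l]) f))"

definition dl ::
    "'b::real_vector topology \<Rightarrow> nat \<Rightarrow> ('a::real_vector \<times> 'b) set \<Rightarrow> 'a \<Rightarrow> (nat \<Rightarrow> 'a) \<Rightarrow> 'b"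
  where "dl F l f x u = graph_app (dir_derivs F (map u [0..<l]) f) x"

definition multilinear_on ::
    "nat \<Rightarrow> 'a::real_vector set \<Rightarrow> ((nat \<Rightarrow> 'a) \<Rightarrow> 'b::real_vector) \<Rightarrow> bool"
  where "multilinear_on l X g \<longleftrightarrow>
    (\<forall>i<l. \<forall>u\<in>tuples l X. \<forall>v\<in>X. \<forall>w\<in>X. \<forall>a b.
       g (u(i := a *\<^sub>R v + b *\<^sub>R w)) = a *\<^sub>R g (u(i := v)) + b *\<^sub>R g (u(i := w)))"

text \<open>
  The requirement \<^prop>\<open>x + v \<in> Domain f\<close> below only makes explicit that \<open>d\<^sup>l f (x + v)\<close>
  has to be defined.
\<close>

definition C_inf_pi ::
    "('a::real_vector topology \<times> 'b::real_vector topology \<times> ('a \<times> 'b) set) set"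
  where "C_inf_pi =
    {(E, F, f).
      locally_convex_space E \<and> locally_convex_space F \<and>
      single_valued f \<and> Domain f \<subseteq> topspace E \<and> Range f \<subseteq> topspace F \<and>
      openin E (Domain f) \<and>
      (\<forall>l. \<forall>x\<in>Domain f.
        dl_defined E F l f x \<and>
        multilinear_on l (topspace E) (dl F l f x) \<and>
        continuous_map (product_topology (\<lambda>_. E) {..<l}) F (dl F l f x) \<and>
        (\<forall>W. zero_nbhd F W \<longrightarrow>
          (\<exists>U. zero_nbhd E U \<and>
            (\<forall>\<epsilon>>0. \<exists>V. zero_nbhd E V \<and>
              (\<forall>v\<in>V. x + v \<in> Domain f \<and>
                (\<lambda>u. dl F l f (x + v) u - dl F l f x u) ` tuples l U
                  \<subseteq> (\<lambda>w. \<epsilon> *\<^sub>R w) ` W)))))}"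


section \<open>The spaces \<open>C\<^sup>i\<close>\<close>

definition partial :: "'a::euclidean_space \<Rightarrow> ('a \<Rightarrow> real) \<Rightarrow> 'a \<Rightarrow> real"
  where "partial b f x = deriv (\<lambda>t. f (x + t *\<^sub>R b)) 0"

definition partials :: "'a::euclidean_space list \<Rightarrow> ('a \<Rightarrow> real) \<Rightarrow> 'a \<Rightarrow> real"
  where "partials bs f = foldr partial bs f"

definition extends_continuously :: "'a::euclidean_space set \<Rightarrow> ('a \<Rightarrow> real) \<Rightarrow> ('a \<Rightarrow> real) \<Rightarrow> bool"
  where "extends_continuously S g h \<longleftrightarrow> continuous_on S h \<and> (\<forall>x\<in>interior S. h x = g x)"

text \<open>
  \<^term>\<open>C_fun i S\<close> is \<open>C\<^sup>i(S)\<close> for a set \<open>S\<close> contained in the closure of its interior. Lists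
  of basis vectors index the iterated partial derivatives, in all orders of differentiation.
  Elements are normalized to vanish outside \<open>S\<close>, so that equality in the function
  type is equality on \<open>S\<close>.
\<close>

definition C_fun :: "enat \<Rightarrow> 'a::euclidean_space set \<Rightarrow> ('a \<Rightarrow> real) set"
  where "C_fun i S =
    {f. (\<forall>x. x \<notin> S \<longrightarrow> f x = 0) \<and>
        continuous_on S f \<and>
        (\<forall>bs. set bs \<subseteq> Basis \<and> enat (length bs) < i \<longrightarrow>
          (\<forall>b\<in>Basis. \<forall>x\<in>interior S.
            (\<lambda>t. partials bs f (x + t *\<^sub>R b)) differentiable (at (0::real)))) \<and>
        (\<forall>bs. set bs \<subseteq> Basis \<and> enat (length bs) < i + 1 \<longrightarrow>
          continuous_on (interior S) (partials bs f) \<and>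
          (\<exists>h. extends_continuously S (partials bs f) h))}"

text \<open>
  The continuous extension of a partial derivative to all of \<open>S\<close>; its values on \<open>S\<close> are unique
  when \<open>S\<close> is contained in the closure of its interior.
\<close>

definition ext_partials :: "'a::euclidean_space set \<Rightarrow> 'a list \<Rightarrow> ('a \<Rightarrow> real) \<Rightarrow> 'a \<Rightarrow> real"
  where "ext_partials S bs f = (SOME h. extends_continuously S (partials bs f) h)"

definition C_ball ::
    "enat \<Rightarrow> 'a::euclidean_space set \<Rightarrow> 'a set \<Rightarrow> 'a list \<Rightarrow> real \<Rightarrow> ('a \<Rightarrow> real) \<Rightarrow> ('a \<Rightarrow> real) set"
  where "C_ball i S K bs \<epsilon> f =
    {g \<in> C_fun i S. \<forall>x\<in>K. \<bar>ext_partials S bs g x - ext_partials S bs f x\<bar> < \<epsilon>}"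

text \<open>
  Uniform convergence on compact subsets of \<open>S\<close> of the derivatives of order \<open>< i + 1\<close>.
\<close>

definition C_top :: "enat \<Rightarrow> 'a::euclidean_space set \<Rightarrow> ('a \<Rightarrow> real) topology"
  where "C_top i S = topology_generated_by
    {C_ball i S K bs \<epsilon> f | K bs \<epsilon> f.
       compact K \<and> K \<subseteq> S \<and> set bs \<subseteq> Basis \<and> enat (length bs) < i + 1 \<and> \<epsilon> > 0 \<and> f \<in> C_fun i S}"

lemma topspace_C_top [simp]: "topspace (C_top i S) = C_fun i S"
proof -
  have order0: "enat (length []) < i + 1"
    by (simp add: zero_enat_def[symmetric] add_pos_nonneg plus_1_eSuc)
  have "f \<in> topspace (C_top i S)" if f: "f \<in> C_fun i S" for f
  proof -
    have "f \<in> C_ball i S {} [] 1 f"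
      using f by (simp add: C_ball_def)
    moreover have "\<exists>K bs \<epsilon> g. C_ball i S {} [] 1 f = C_ball i S K bs \<epsilon> g \<and>
        compact K \<and> K \<subseteq> S \<and> set bs \<subseteq> Basis \<and> enat (length bs) < i + 1 \<and> \<epsilon> > 0 \<and> g \<in> C_fun i S"
      by (rule exI[of _ "{}"], rule exI[of _ "[]"], rule exI[of _ 1], rule exI[of _ f])
        (use f order0 in simp)
    ultimately show ?thesis
      unfolding C_top_def topology_generated_by_topspace by blast
  qed
  moreover have "topspace (C_top i S) \<subseteq> C_fun i S"
    unfolding C_top_def topology_generated_by_topspace by (auto simp: C_ball_def)
  ultimately show ?thesis by blast
qed


section \<open>The concrete spaces and the solution relation\<close>

definition E\<^sub>0 :: "(real \<Rightarrow> real) topology"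
  where "E\<^sub>0 = subtopology (C_top \<infinity> UNIV) {y. \<forall>\<eta>. y (\<eta> + 1) = y \<eta>}"

definition C_half_S1 :: "enat \<Rightarrow> (real \<times> real \<Rightarrow> real) topology"
  where "C_half_S1 i =
    subtopology (C_top i ({0..} \<times> UNIV)) {y. \<forall>t\<ge>0. \<forall>\<eta>. y (t, \<eta> + 1) = y (t, \<eta>)}"

definition C_half_S1_R :: "enat \<Rightarrow> (real \<times> real \<times> real \<Rightarrow> real) topology"
  where "C_half_S1_R i =
    subtopology (C_top i ({0..} \<times> UNIV \<times> UNIV))
      {\<phi>. \<forall>t\<ge>0. \<forall>\<eta> \<xi>. \<phi> (t, \<eta> + 1, \<xi>) = \<phi> (t, \<eta>, \<xi>)}"

definition E\<^sub>1 :: "(real \<times> real \<times> real \<Rightarrow> real) topology"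
  where "E\<^sub>1 =
    subtopology (C_half_S1_R \<infinity>)
      {\<phi>. \<forall>T\<ge>0. \<exists>M. \<forall>t \<eta> \<xi>. 0 \<le> t \<and> t \<le> T \<and> \<bar>\<xi>\<bar> \<ge> M \<longrightarrow> \<phi> (t, \<eta>, \<xi>) = 0}"

definition E_space :: "((real \<Rightarrow> real) \<times> (real \<times> real \<times> real \<Rightarrow> real)) topology"
  where "E_space = prod_topology E\<^sub>0 E\<^sub>1"

definition F_space :: "(real \<times> real \<Rightarrow> real) topology"
  where "F_space = C_half_S1 \<infinity>"

definition Sol ::
    "(((real \<Rightarrow> real) \<times> (real \<times> real \<times> real \<Rightarrow> real)) \<times> (real \<times> real \<Rightarrow> real)) set"
  where "Sol =
    {((y\<^sub>0, \<phi>), y). (y\<^sub>0, \<phi>) \<in> topspace E_space \<and> y \<in> topspace (C_half_S1 1) \<and>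
      (\<forall>t\<ge>0. \<forall>\<eta>.
        y (t, \<eta>) = y\<^sub>0 (\<eta> - t) +
          integral {0..t} (\<lambda>\<tau>. \<phi> (\<tau>, \<eta> - t + \<tau>, y (\<tau>, \<eta> - t + \<tau>))))}"

end

theory Submission
  imports Defs
begin

text \<open>
  Along a characteristic the equation is a scalar ordinary differential equation whose parameters
  are the starting point and the Cauchy data. Instead of estimating the solution map in the
  seminorms of \<open>F\<close>, all functions are regarded as functions of
  \<open>(x, u\<^sub>0, u\<^sub>1, \<dots>, t, \<eta>)\<close> with \<open>x\<close> and the \<open>u\<^sub>i\<close> ranging over the topological space \<open>E\<close>, and
  are differentiated in \<open>t\<close>, in \<open>\<eta>\<close> and along the flows \<open>x \<mapsto> x + h u\<^sub>i\<close>. A difference quotient of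
  the solution solves a linear equation whose coefficients depend continuously on the step
  \<open>h\<close>, also at \<open>h = 0\<close>; the explicit solution of that equation expresses each derivative of the
  solution through the solution itself, so that continuity bootstraps to smoothness. Moreover,
  joint continuity on \<open>P \<times> [0,\<infinity>) \<times> \<real>\<close> of all derivatives in \<open>t\<close> and \<open>\<eta>\<close> amounts to
  continuity of the map from \<open>P\<close> into \<open>C\<^sup>\<infinity>\<close>, so the derivatives \<open>d\<^sup>l f(x)(u)\<close> exist and are jointly
  continuous in \<open>(x, u)\<close>. This implies Keller's condition: by the mean value theorem, applied
  after composition with the functionals defining the topology of \<open>F\<close>,
  \<open>d\<^sup>l f(x + v)(u) - d\<^sup>l f(x)(u)\<close> is controlled by \<open>d\<^bsup>l+1\<^esup> f(x + s v)(u, v)\<close>, and the factor \<open>\<epsilon>\<close>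
  comes from linearity in the last slot.
\<close>

section \<open>Locally convex topologies given by families of functionals\<close>

text \<open>The topology of \<open>E\<^sub>1\<close> does not control supports: every neighbourhood
  of \<phi> contains functions that are arbitrarily steep at arbitrarily large \<xi>. Existence and
  uniqueness are therefore proved for one parameter at a time. There the vanishing for large \<xi>
  makes the equation Lipschitz on every [0,T], so that solutions are global and the domain is all of
  E. Continuity in the parameter uses the Lipschitz constant of the reference equation alone,
  together with closeness of the right-hand sides on one compact box. Time is exceptional among the
  variables: the domain ends at t = 0, and t is both a coordinate and a bound of integration. Its
  derivative is taken from the integral equation once the x-derivative is known. The tangent vectors
  form an infinite sequence, so that one parameter space serves the derivatives of all
  orders.\<close>

definition functional_on :: "'a::real_vector set \<Rightarrow> ('a \<Rightarrow> real) \<Rightarrow> bool"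
  where "functional_on V \<mu> \<longleftrightarrow> (\<forall>x\<in>V. \<forall>y\<in>V. \<forall>a b. \<mu> (a *\<^sub>R x + b *\<^sub>R y) = a * \<mu> x + b * \<mu> y)"

text \<open>A set \<open>\<Lambda>\<close> stands for the seminorm given by the supremum of |\<mu>|
  over its members; asking the inequality of each \<open>\<mu>\<close> separately avoids forming the
  supremum.\<close>

definition polar_ball :: "'a topology \<Rightarrow> ('a \<Rightarrow> real) set \<Rightarrow> real \<Rightarrow> 'a \<Rightarrow> 'a set"
  where "polar_ball T \<Lambda> r x = {y \<in> topspace T. \<forall>\<mu>\<in>\<Lambda>. \<bar>\<mu> y - \<mu> x\<bar> < r}"

text \<open>The topology \<open>T\<close> is given and \<open>\<L>\<close> merely describes it, so
  the spaces keep their original definitions. A single \<open>\<Lambda>\<close> in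
  \<open>ball_subset\<close> means that the family is directed; \<open>bounded\<close> says that
  each seminorm is finite. Functionals are kept instead of seminorms because \<open>\<mu>\<close>
  composed with a curve is a real function, to which the mean value theorem applies.\<close>

locale functional_topology =
  fixes T :: "'a::real_vector topology" and \<L> :: "('a \<Rightarrow> real) set set"
  assumes subspace: "subspace (topspace T)"
    and functional: "\<Lambda> \<in> \<L> \<Longrightarrow> \<mu> \<in> \<Lambda> \<Longrightarrow> functional_on (topspace T) \<mu>"
    and bounded: "\<Lambda> \<in> \<L> \<Longrightarrow> x \<in> topspace T \<Longrightarrow> \<exists>B. \<forall>\<mu>\<in>\<Lambda>. \<bar>\<mu> x\<bar> \<le> B"
    and open_ball: "\<Lambda> \<in> \<L> \<Longrightarrow> x \<in> topspace T \<Longrightarrow> r > 0 \<Longrightarrow> openin T (polar_ball T \<Lambda> r x)"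
    and ball_subset: "openin T U \<Longrightarrow> x \<in> U \<Longrightarrow> \<exists>\<Lambda>\<in>\<L>. \<exists>r>0. polar_ball T \<Lambda> r x \<subseteq> U"
    and separating: "x \<in> topspace T \<Longrightarrow> (\<And>\<Lambda> \<mu>. \<Lambda> \<in> \<L> \<Longrightarrow> \<mu> \<in> \<Lambda> \<Longrightarrow> \<mu> x = 0) \<Longrightarrow> x = 0"
begin

lemma lin:
  assumes "\<Lambda> \<in> \<L>" "\<mu> \<in> \<Lambda>"
  shows "x \<in> topspace T \<Longrightarrow> y \<in> topspace T \<Longrightarrow> \<mu> (x + y) = \<mu> x + \<mu> y"
    and "x \<in> topspace T \<Longrightarrow> y \<in> topspace T \<Longrightarrow> \<mu> (x - y) = \<mu> x - \<mu> y"
    and "x \<in> topspace T \<Longrightarrow> \<mu> (c *\<^sub>R x) = c * \<mu> x"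
    and "\<mu> 0 = 0"
proof -
  have L: "\<mu> (a *\<^sub>R x + b *\<^sub>R y) = a * \<mu> x + b * \<mu> y"
    if "x \<in> topspace T" "y \<in> topspace T" for x y a b
    using functional[OF assms] that unfolding functional_on_def by blast
  have 0: "0 \<in> topspace T" using subspace by (simp add: subspace_0)
  show "\<mu> (x + y) = \<mu> x + \<mu> y" if "x \<in> topspace T" "y \<in> topspace T"
    using L[OF that, of 1 1] by simp
  show "\<mu> (x - y) = \<mu> x - \<mu> y" if "x \<in> topspace T" "y \<in> topspace T"
    using L[OF that, of 1 "-1"] by simp
  show "\<mu> (c *\<^sub>R x) = c * \<mu> x" if "x \<in> topspace T"
    using L[OF that that, of c 0] by simp
  show "\<mu> 0 = 0"
    using L[OF 0 0, of 0 0] by simp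
qed

lemma polar_ball_self: "x \<in> topspace T \<Longrightarrow> r > 0 \<Longrightarrow> x \<in> polar_ball T \<Lambda> r x"
  by (simp add: polar_ball_def)

lemma continuous_add: "continuous_map (prod_topology T T) T (\<lambda>(x, y). x + y)"
  unfolding continuous_map_def
proof (intro conjI allI impI)
  show "(\<lambda>(x, y). x + y) \<in> topspace (prod_topology T T) \<rightarrow> topspace T"
    using subspace by (auto simp: subspace_add)
  fix U assume U: "openin T U"
  show "openin (prod_topology T T) {x \<in> topspace (prod_topology T T). (case x of (x, y) \<Rightarrow> x + y) \<in> U}"
    unfolding openin_prod_topology_alt
  proof (intro allI impI)
    fix x y assume "(x, y) \<in> {x \<in> topspace (prod_topology T T). (case x of (x, y) \<Rightarrow> x + y) \<in> U}"
    then have xy: "x \<in> topspace T" "y \<in> topspace T" "x + y \<in> U" by auto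
    from ball_subset[OF U xy(3)] obtain \<Lambda> r where L: "\<Lambda> \<in> \<L>" "r > 0" "polar_ball T \<Lambda> r (x + y) \<subseteq> U" by blast
    have sub: "x' + y' \<in> U" if "x' \<in> polar_ball T \<Lambda> (r/2) x" "y' \<in> polar_ball T \<Lambda> (r/2) y" for x' y'
    proof -
      have x': "x' \<in> topspace T" "y' \<in> topspace T" using that by (auto simp: polar_ball_def)
      have "\<bar>\<mu> (x' + y') - \<mu> (x + y)\<bar> < r" if l: "\<mu> \<in> \<Lambda>" for \<mu>
      proof -
        have "\<bar>\<mu> x' - \<mu> x\<bar> < r/2" "\<bar>\<mu> y' - \<mu> y\<bar> < r/2"
          using l \<open>x' \<in> polar_ball T \<Lambda> (r/2) x\<close> \<open>y' \<in> polar_ball T \<Lambda> (r/2) y\<close> by (auto simp: polar_ball_def)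
        then show ?thesis using lin(1)[OF L(1) l] x' xy by (simp add: abs_if split: if_splits)
      qed
      with x' subspace have "x' + y' \<in> polar_ball T \<Lambda> r (x + y)"
        by (simp add: polar_ball_def subspace_add)
      with L show ?thesis by blast
    qed
    show "\<exists>V W. openin T V \<and> openin T W \<and> x \<in> V \<and> y \<in> W \<and>
        V \<times> W \<subseteq> {x \<in> topspace (prod_topology T T). (case x of (x, y) \<Rightarrow> x + y) \<in> U}"
    proof (intro exI conjI)
      show "openin T (polar_ball T \<Lambda> (r/2) x)" "openin T (polar_ball T \<Lambda> (r/2) y)"
        using L xy by (auto intro!: open_ball)
      show "x \<in> polar_ball T \<Lambda> (r/2) x" "y \<in> polar_ball T \<Lambda> (r/2) y"
        using L xy by (auto intro!: polar_ball_self)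
      show "polar_ball T \<Lambda> (r/2) x \<times> polar_ball T \<Lambda> (r/2) y
        \<subseteq> {x \<in> topspace (prod_topology T T). (case x of (x, y) \<Rightarrow> x + y) \<in> U}"
        using sub by (auto simp: polar_ball_def)
    qed
  qed
qed

lemma continuous_scaleR: "continuous_map (prod_topology euclideanreal T) T (\<lambda>(c, x). c *\<^sub>R x)"
  unfolding continuous_map_def
proof (intro conjI allI impI)
  show "(\<lambda>(c, x). c *\<^sub>R x) \<in> topspace (prod_topology euclideanreal T) \<rightarrow> topspace T"
    using subspace by (auto simp: subspace_scale)
  fix U assume U: "openin T U"
  show "openin (prod_topology euclideanreal T) {x \<in> topspace (prod_topology euclideanreal T). (case x of (c, x) \<Rightarrow> c *\<^sub>R x) \<in> U}"
    unfolding openin_prod_topology_alt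
  proof (intro allI impI)
    fix c x assume "(c, x) \<in> {x \<in> topspace (prod_topology euclideanreal T). (case x of (c, x) \<Rightarrow> c *\<^sub>R x) \<in> U}"
    then have x: "x \<in> topspace T" "c *\<^sub>R x \<in> U" by auto
    from ball_subset[OF U x(2)] obtain \<Lambda> r where L: "\<Lambda> \<in> \<L>" "r > 0" "polar_ball T \<Lambda> r (c *\<^sub>R x) \<subseteq> U" by blast
    from bounded[OF L(1) x(1)] obtain B0 where B0: "\<forall>\<mu>\<in>\<Lambda>. \<bar>\<mu> x\<bar> \<le> B0" by blast
    define B where "B = \<bar>B0\<bar> + 1"
    have B: "B > 0" "\<forall>\<mu>\<in>\<Lambda>. \<bar>\<mu> x\<bar> \<le> B" using B0 by (fastforce simp: B_def)+
    \<comment> \<open>In \<open>c' x' - c x = c' (x' - x) + (c' - c) x\<close> each summand gets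
      r/2. The cap 1 on \<open>e\<close> bounds |c'| by |c| + 1, whence the denominator of
      \<open>s\<close>.\<close>
    define e where "e = min 1 (r / (2 * B))"
    define s where "s = r / (2 * (\<bar>c\<bar> + 1))"
    have e: "e > 0" "e \<le> 1" "e * B \<le> r / 2" using B L by (auto simp: e_def min_def field_simps)
    have s: "s > 0" "s * (\<bar>c\<bar> + 1) = r / 2" using L by (auto simp: s_def field_simps)
    have sub: "c' *\<^sub>R x' \<in> U" if c': "c' \<in> ball c e" and x': "x' \<in> polar_ball T \<Lambda> s x" for c' x'
    proof -
      have x'T: "x' \<in> topspace T" using x' by (auto simp: polar_ball_def)
      have "\<bar>\<mu> (c' *\<^sub>R x') - \<mu> (c *\<^sub>R x)\<bar> < r" if l: "\<mu> \<in> \<Lambda>" for \<mu>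
      proof -
        have 1: "\<bar>\<mu> x' - \<mu> x\<bar> < s" using x' l by (auto simp: polar_ball_def)
        have 2: "\<bar>c' - c\<bar> < e" using c' by (simp add: dist_real_def abs_minus_commute)
        have "\<mu> (c' *\<^sub>R x') - \<mu> (c *\<^sub>R x) = c' * (\<mu> x' - \<mu> x) + (c' - c) * \<mu> x"
          using lin(3)[OF L(1) l] x'T x by (simp add: algebra_simps)
        also have "\<bar>\<dots>\<bar> \<le> \<bar>c'\<bar> * \<bar>\<mu> x' - \<mu> x\<bar> + \<bar>c' - c\<bar> * \<bar>\<mu> x\<bar>"
          by (metis abs_mult abs_triangle_ineq)
        also have "\<bar>c'\<bar> * \<bar>\<mu> x' - \<mu> x\<bar> \<le> (\<bar>c\<bar> + 1) * \<bar>\<mu> x' - \<mu> x\<bar>"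
          using 2 e by (intro mult_right_mono) auto
        also have "\<dots> < (\<bar>c\<bar> + 1) * s" using 1 by (intro mult_strict_left_mono) auto
        also have "\<dots> = r / 2" using s by (simp add: mult.commute)
        also have "\<bar>c' - c\<bar> * \<bar>\<mu> x\<bar> \<le> e * B" using 2 B l by (intro mult_mono) auto
        also have "\<dots> \<le> r / 2" using e by simp
        finally show ?thesis by simp
      qed
      with x'T subspace have "c' *\<^sub>R x' \<in> polar_ball T \<Lambda> r (c *\<^sub>R x)"
        by (simp add: polar_ball_def subspace_scale)
      with L show ?thesis by blast
    qed
    show "\<exists>V W. openin euclideanreal V \<and> openin T W \<and> c \<in> V \<and> x \<in> W \<and>
        V \<times> W \<subseteq> {x \<in> topspace (prod_topology euclideanreal T). (case x of (c, x) \<Rightarrow> c *\<^sub>R x) \<in> U}"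
    proof (intro exI conjI)
      show "openin euclideanreal (ball c e)" "openin T (polar_ball T \<Lambda> s x)"
        using L x s by (auto intro!: open_ball)
      show "c \<in> ball c e" "x \<in> polar_ball T \<Lambda> s x"
        using e s x by (auto intro!: polar_ball_self)
      show "ball c e \<times> polar_ball T \<Lambda> s x
        \<subseteq> {x \<in> topspace (prod_topology euclideanreal T). (case x of (c, x) \<Rightarrow> c *\<^sub>R x) \<in> U}"
        using sub by (auto simp: polar_ball_def)
    qed
  qed
qed

lemma Hausdorff: "Hausdorff_space T"
  unfolding Hausdorff_space_def
proof (intro allI impI)
  fix x y assume xy: "x \<in> topspace T \<and> y \<in> topspace T \<and> x \<noteq> y"
  then have "x - y \<in> topspace T" using subspace by (simp add: subspace_diff)
  then obtain \<Lambda> \<mu> where L: "\<Lambda> \<in> \<L>" "\<mu> \<in> \<Lambda>" "\<mu> (x - y) \<noteq> 0"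
    using separating[of "x - y"] xy by force
  define r where "r = \<bar>\<mu> x - \<mu> y\<bar> / 2"
  have r: "r > 0" using L xy lin(2)[OF L(1,2), of x y] by (simp add: r_def)
  show "\<exists>U V. openin T U \<and> openin T V \<and> x \<in> U \<and> y \<in> V \<and> disjnt U V"
  proof (intro exI conjI)
    show "openin T (polar_ball T \<Lambda> r x)" "openin T (polar_ball T \<Lambda> r y)"
      "x \<in> polar_ball T \<Lambda> r x" "y \<in> polar_ball T \<Lambda> r y"
      using r L xy by (auto intro!: open_ball polar_ball_self)
    have False if "z \<in> polar_ball T \<Lambda> r x" "z \<in> polar_ball T \<Lambda> r y" for z
    proof -
      have "\<bar>\<mu> z - \<mu> x\<bar> < r" "\<bar>\<mu> z - \<mu> y\<bar> < r" using that L by (auto simp: polar_ball_def)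
      moreover have False if "\<bar>a - b\<bar> < \<bar>b - c\<bar> / 2" "\<bar>a - c\<bar> < \<bar>b - c\<bar> / 2" for a b c :: real
        using that by (simp add: abs_if split: if_splits)
      ultimately show False by (auto simp: r_def)
    qed
    then show "disjnt (polar_ball T \<Lambda> r x) (polar_ball T \<Lambda> r y)"
      by (auto simp: disjnt_def)
  qed
qed

lemma convex_polar_ball:
  assumes "\<Lambda> \<in> \<L>" "x \<in> topspace T"
  shows "convex (polar_ball T \<Lambda> r x)"
proof (rule convexI)
  fix y z u v assume yz: "y \<in> polar_ball T \<Lambda> r x" "z \<in> polar_ball T \<Lambda> r x" and uv: "0 \<le> u" "0 \<le> v" "u + v = (1::real)"
  have T: "y \<in> topspace T" "z \<in> topspace T" using yz by (auto simp: polar_ball_def)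
  have uvT: "u *\<^sub>R y + v *\<^sub>R z \<in> topspace T"
    using T subspace by (simp add: subspace_add subspace_scale)
  have "\<bar>\<mu> (u *\<^sub>R y + v *\<^sub>R z) - \<mu> x\<bar> < r" if l: "\<mu> \<in> \<Lambda>" for \<mu>
  proof -
    have d: "\<bar>\<mu> y - \<mu> x\<bar> < r" "\<bar>\<mu> z - \<mu> x\<bar> < r" using yz l by (auto simp: polar_ball_def)
    have "\<mu> (u *\<^sub>R y + v *\<^sub>R z) = u * \<mu> y + v * \<mu> z"
      using functional[OF assms(1) l] T unfolding functional_on_def by blast
    moreover have "\<mu> x = u * \<mu> x + v * \<mu> x" using uv by (metis distrib_right mult_1)
    ultimately have "\<mu> (u *\<^sub>R y + v *\<^sub>R z) - \<mu> x = u * (\<mu> y - \<mu> x) + v * (\<mu> z - \<mu> x)"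
      by (simp add: algebra_simps)
    moreover have "\<bar>u * (\<mu> y - \<mu> x) + v * (\<mu> z - \<mu> x)\<bar> < r"
      using convex_bound_lt[of "\<mu> y - \<mu> x" r "\<mu> z - \<mu> x" u v] convex_bound_lt[of "\<mu> x - \<mu> y" r "\<mu> x - \<mu> z" u v] d uv
      by (simp add: abs_less_iff algebra_simps)
    ultimately show ?thesis by simp
  qed
  with uvT show "u *\<^sub>R y + v *\<^sub>R z \<in> polar_ball T \<Lambda> r x"
    by (simp add: polar_ball_def)
qed

lemma eq_if_functionals_eq:
  assumes "x \<in> topspace T" "y \<in> topspace T" "\<And>\<Lambda> \<mu>. \<Lambda> \<in> \<L> \<Longrightarrow> \<mu> \<in> \<Lambda> \<Longrightarrow> \<mu> x = \<mu> y"
  shows "x = y"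
  using separating[of "x - y"] assms by (simp add: subspace_diff[OF subspace] lin)

theorem locally_convex: "locally_convex_space T"
  unfolding locally_convex_space_def
proof (intro conjI allI impI subspace continuous_add continuous_scaleR Hausdorff)
  fix U assume "zero_nbhd T U"
  then obtain V where V: "openin T V" "0 \<in> V" "V \<subseteq> U" by (auto simp: zero_nbhd_def)
  then obtain \<Lambda> r where L: "\<Lambda> \<in> \<L>" "r > 0" "polar_ball T \<Lambda> r 0 \<subseteq> V" using ball_subset by blast
  have 0: "0 \<in> topspace T" using subspace by (simp add: subspace_0)
  have "zero_nbhd T (polar_ball T \<Lambda> r 0)"
    unfolding zero_nbhd_def using L open_ball[OF L(1) 0 L(2)] polar_ball_self[OF 0 L(2)]
    by (auto simp: polar_ball_def)
  with L V convex_polar_ball[OF L(1) 0, of r]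
  show "\<exists>V. zero_nbhd T V \<and> convex V \<and> V \<subseteq> U" by blast
qed

lemma continuous_functional:
  assumes "\<Lambda> \<in> \<L>" "\<mu> \<in> \<Lambda>" "limitin T g L F"
  shows "((\<lambda>h. \<mu> (g h)) \<longlongrightarrow> \<mu> L) F"
proof (rule tendstoI)
  fix e :: real assume e: "e > 0"
  have L: "L \<in> topspace T" using assms by (simp add: limitin_def)
  have "\<forall>\<^sub>F h in F. g h \<in> polar_ball T \<Lambda> e L"
    using limitinD[OF assms(3) open_ball[OF assms(1) L e] polar_ball_self[OF L e]] .
  then show "\<forall>\<^sub>F h in F. dist (\<mu> (g h)) (\<mu> L) < e"
    by eventually_elim (use assms in \<open>auto simp: polar_ball_def dist_real_def\<close>)
qed

end

section \<open>Subspaces and products\<close>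

lemma functional_topology_subtopology:
  assumes "functional_topology T \<L>" "subspace V"
  shows "functional_topology (subtopology T V) \<L>"
proof -
  interpret functional_topology T \<L> by fact
  have ball: "polar_ball (subtopology T V) \<Lambda> r x = polar_ball T \<Lambda> r x \<inter> V" for \<Lambda> r x
    by (auto simp: polar_ball_def)
  show ?thesis
  proof
    show "subspace (topspace (subtopology T V))"
      using subspace assms(2) by (simp add: subspace_inter)
    show "\<exists>\<Lambda>\<in>\<L>. \<exists>r>0. polar_ball (subtopology T V) \<Lambda> r x \<subseteq> U" if "openin (subtopology T V) U" "x \<in> U" for U x
    proof -
      from that obtain U' where "openin T U'" "U = U' \<inter> V" by (auto simp: openin_subtopology)
      with ball_subset[of U' x] that show ?thesis unfolding ball by blast
    qed
    show "openin (subtopology T V) (polar_ball (subtopology T V) \<Lambda> r x)"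
      if "\<Lambda> \<in> \<L>" "x \<in> topspace (subtopology T V)" "r > 0" for \<Lambda> x r
      using that open_ball[of \<Lambda> x r] by (auto simp: ball openin_subtopology)
  qed (use functional bounded separating in \<open>auto simp: functional_on_def\<close>)
qed

definition product_functionals :: "('a \<Rightarrow> real) set \<Rightarrow> ('b \<Rightarrow> real) set \<Rightarrow> ('a \<times> 'b \<Rightarrow> real) set"
  where "product_functionals \<Theta> \<Lambda> = (\<lambda>\<kappa>. \<kappa> \<circ> fst) ` \<Theta> \<union> (\<lambda>\<mu>. \<mu> \<circ> snd) ` \<Lambda>"

lemma functional_topology_prod:
  assumes "functional_topology S \<K>" "functional_topology T \<L>"
  shows "functional_topology (prod_topology S T) (case_prod product_functionals ` (\<K> \<times> \<L>))"
proof -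
  interpret S: functional_topology S \<K> by fact
  interpret T: functional_topology T \<L> by fact
  have ball: "polar_ball (prod_topology S T) (product_functionals \<Theta> \<Lambda>) r (x, y)
      = polar_ball S \<Theta> r x \<times> polar_ball T \<Lambda> r y" for \<Theta> \<Lambda> r x y
    by (auto simp: polar_ball_def product_functionals_def ball_Un)
  show ?thesis
  proof
    show "subspace (topspace (prod_topology S T))"
      using S.subspace T.subspace by (simp add: subspace_Times)
    show "functional_on (topspace (prod_topology S T)) \<mu>"
      if "\<Lambda> \<in> case_prod product_functionals ` (\<K> \<times> \<L>)" "\<mu> \<in> \<Lambda>" for \<Lambda> \<mu>
      using that S.functional T.functional by (fastforce simp: functional_on_def product_functionals_def)
    show "\<exists>B. \<forall>\<mu>\<in>\<Lambda>. \<bar>\<mu> x\<bar> \<le> B"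
      if L: "\<Lambda> \<in> case_prod product_functionals ` (\<K> \<times> \<L>)"
        and x: "x \<in> topspace (prod_topology S T)" for \<Lambda> x
    proof -
      from L obtain K L where KL: "K \<in> \<K>" "L \<in> \<L>" "\<Lambda> = product_functionals K L" by auto
      obtain B B' where "\<forall>\<mu>\<in>K. \<bar>\<mu> (fst x)\<bar> \<le> B" "\<forall>\<mu>\<in>L. \<bar>\<mu> (snd x)\<bar> \<le> B'"
        using S.bounded[OF KL(1), of "fst x"] T.bounded[OF KL(2), of "snd x"] x by auto
      then show ?thesis unfolding KL(3) product_functionals_def by (intro exI[of _ "max B B'"]) auto
    qed
    show "openin (prod_topology S T) (polar_ball (prod_topology S T) \<Lambda> r x)"
      if "\<Lambda> \<in> case_prod product_functionals ` (\<K> \<times> \<L>)"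
        "x \<in> topspace (prod_topology S T)" "r > 0" for \<Lambda> x r
      using that by (cases x) (auto simp: ball openin_prod_Times_iff S.open_ball T.open_ball)
    show "\<exists>\<Lambda>\<in>case_prod product_functionals ` (\<K> \<times> \<L>).
         \<exists>r>0. polar_ball (prod_topology S T) \<Lambda> r x \<subseteq> U"
      if U: "openin (prod_topology S T) U" "x \<in> U" for U x
    proof -
      obtain a b where x: "x = (a, b)" by force
      then obtain V W where VW: "openin S V" "openin T W" "a \<in> V" "b \<in> W" "V \<times> W \<subseteq> U"
        using U unfolding openin_prod_topology_alt by meson
      obtain K r where K: "K \<in> \<K>" "r > 0" "polar_ball S K r a \<subseteq> V" using S.ball_subset VW by metis
      obtain L s where L: "L \<in> \<L>" "s > 0" "polar_ball T L s b \<subseteq> W" using T.ball_subset VW by metis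
      have "polar_ball (prod_topology S T) (product_functionals K L) (min r s) x
          \<subseteq> polar_ball S K r a \<times> polar_ball T L s b"
        unfolding x ball by (auto simp: polar_ball_def)
      also have "\<dots> \<subseteq> U" using K L VW by blast
      finally show ?thesis
        using K L by (intro bexI[of _ "product_functionals K L"] exI[of _ "min r s"]) auto
    qed
    show "x = 0" if x: "x \<in> topspace (prod_topology S T)"
      and 0: "\<And>\<Lambda> \<mu>. \<Lambda> \<in> case_prod product_functionals ` (\<K> \<times> \<L>) \<Longrightarrow> \<mu> \<in> \<Lambda> \<Longrightarrow> \<mu> x = 0" for x
    proof -
      \<comment> \<open>Sets of functionals on the product come in pairs, so testing one factor
        takes some set for the other. Both families are nonempty because \<open>ball_subset\<close>
        applies to the whole space.\<close>
      obtain K0 L0 where ne: "K0 \<in> \<K>" "L0 \<in> \<L>"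
        using S.ball_subset[OF openin_topspace, of 0] T.ball_subset[OF openin_topspace, of 0]
          S.subspace T.subspace by (auto simp: subspace_0)
      have "fst x = 0"
      proof (rule S.separating)
        show "fst x \<in> topspace S" using x by auto
        fix \<Lambda> \<mu> assume l: "\<Lambda> \<in> \<K>" "\<mu> \<in> \<Lambda>"
        have "product_functionals \<Lambda> L0 \<in> case_prod product_functionals ` (\<K> \<times> \<L>)"
          using l ne by (intro image_eqI[of _ _ "(\<Lambda>, L0)"]) auto
        from 0[OF this, of "\<mu> \<circ> fst"] show "\<mu> (fst x) = 0"
          using l by (simp add: product_functionals_def)
      qed
      moreover have "snd x = 0"
      proof (rule T.separating)
        show "snd x \<in> topspace T" using x by auto
        fix \<Lambda> \<mu> assume l: "\<Lambda> \<in> \<L>" "\<mu> \<in> \<Lambda>"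
        have "product_functionals K0 \<Lambda> \<in> case_prod product_functionals ` (\<K> \<times> \<L>)"
          using l ne by (intro image_eqI[of _ _ "(K0, \<Lambda>)"]) auto
        from 0[OF this, of "\<mu> \<circ> snd"] show "\<mu> (snd x) = 0"
          using l by (simp add: product_functionals_def)
      qed
      ultimately show "x = 0" by (simp add: prod_eq_iff)
    qed
  qed
qed

section \<open>From jointly continuous derivatives to Keller's class\<close>

text \<open>Chain rule along the curve (h, y h) in which the h-derivative of \<open>H\<close> is
  known only at the fixed second argument \<open>y 0\<close>. The increment is split at
  \<open>H h (y 0)\<close>, and by the mean value theorem the remaining part is \<open>H'\<close> at
  an intermediate point times the increment of \<open>y\<close>.\<close>

lemma has_real_derivative_compose2:
  fixes H H' :: "real \<Rightarrow> real \<Rightarrow> real"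
  assumes H0: "((\<lambda>h. H h (y 0)) has_real_derivative a) (at 0)"
    and y: "(y has_real_derivative y') (at 0)"
    and H': "\<forall>\<^sub>F (h, \<xi>) in at 0 \<times>\<^sub>F nhds (y 0). (H h has_real_derivative H' h \<xi>) (at \<xi>)"
    and cont: "isCont (\<lambda>(h, \<xi>). H' h \<xi>) (0, y 0)"
  shows "((\<lambda>h. H h (y h)) has_real_derivative a + H' 0 (y 0) * y') (at 0)"
proof -
  \<comment> \<open>The slope of \<open>H h\<close> between \<open>y 0\<close> and
    \<open>y h\<close>. The value for \<open>y h = y 0\<close> is chosen so that \<open>N\<close>
    still has the limit \<open>H' 0 (y 0)\<close> when \<open>y\<close> returns to
    \<open>y 0\<close> infinitely often.\<close>
  define N where "N h = (if y h = y 0 then H' h (y 0) else (H h (y h) - H h (y 0)) / (y h - y 0))" for h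
  have N: "\<exists>\<theta>. \<bar>\<theta> - y 0\<bar> \<le> \<bar>y h - y 0\<bar> \<and> N h = H' h \<theta>"
    if d: "\<And>\<xi>. \<bar>\<xi> - y 0\<bar> \<le> \<bar>y h - y 0\<bar> \<Longrightarrow> (H h has_real_derivative H' h \<xi>) (at \<xi>)" for h
  proof -
    consider "y h = y 0" | "y h < y 0" | "y 0 < y h" by linarith
    then show ?thesis
    proof cases
      case 1
      then show ?thesis by (intro exI[of _ "y 0"]) (auto simp: N_def)
    next
      case 2
      then obtain z where "y h < z" "z < y 0" "H h (y 0) - H h (y h) = (y 0 - y h) * H' h z"
        using MVT2[of "y h" "y 0" "H h" "H' h"] d by auto
      with 2 show ?thesis by (intro exI[of _ z]) (auto simp: N_def field_simps)
    next
      case 3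
      then obtain z where "y 0 < z" "z < y h" "H h (y h) - H h (y 0) = (y h - y 0) * H' h z"
        using MVT2[of "y 0" "y h" "H h" "H' h"] d by auto
      with 3 show ?thesis by (intro exI[of _ z]) (auto simp: N_def field_simps)
    qed
  qed
  have ycont: "(y \<longlongrightarrow> y 0) (at 0)"
    using DERIV_isCont[OF y] by (simp add: isCont_def)
  have "((\<lambda>(h, \<xi>). H' h \<xi>) \<longlongrightarrow> H' 0 (y 0)) (nhds (0, y 0))"
    using cont tendsto_at_iff_tendsto_nhds[of "\<lambda>(h, \<xi>). H' h \<xi>" "(0, y 0)"] by (simp add: isCont_def)
  then have H'lim: "((\<lambda>(h, \<xi>). H' h \<xi>) \<longlongrightarrow> H' 0 (y 0)) (at 0 \<times>\<^sub>F nhds (y 0))"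
    unfolding nhds_prod
    by (rule tendsto_mono[rotated]) (intro prod_filter_mono, auto simp: at_within_def)
  have Nlim: "(N \<longlongrightarrow> H' 0 (y 0)) (at 0)"
  proof (rule tendstoI)
    fix e :: real assume "e > 0"
    from eventually_conj[OF tendstoD[OF H'lim this] H'] obtain P Q where PQ: "eventually P (at 0)" "eventually Q (nhds (y 0))"
      "\<And>h \<xi>. P h \<Longrightarrow> Q \<xi> \<Longrightarrow> dist (H' h \<xi>) (H' 0 (y 0)) < e \<and> (H h has_real_derivative H' h \<xi>) (at \<xi>)"
      unfolding eventually_prod_filter by fastforce
    then obtain d where d: "d > 0" "\<And>\<xi>. dist \<xi> (y 0) < d \<Longrightarrow> Q \<xi>"
      by (auto simp: eventually_nhds_metric)
    show "\<forall>\<^sub>F h in at 0. dist (N h) (H' 0 (y 0)) < e"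
      using PQ(1) tendstoD[OF ycont d(1)]
    proof eventually_elim
      case (elim h)
      have Q: "Q \<xi>" if "\<bar>\<xi> - y 0\<bar> \<le> \<bar>y h - y 0\<bar>" for \<xi>
        using that elim(2) by (intro d(2)) (simp add: dist_real_def)
      from N[of h] PQ(3)[OF elim(1) Q] obtain \<theta> where th: "\<bar>\<theta> - y 0\<bar> \<le> \<bar>y h - y 0\<bar>" "N h = H' h \<theta>" by blast
      with PQ(3)[OF elim(1) Q[OF th(1)]] show ?case by simp
    qed
  qed
  have "((\<lambda>h. (H h (y 0) - H 0 (y 0)) / (h - 0) + N h * ((y h - y 0) / (h - 0))) \<longlongrightarrow> a + H' 0 (y 0) * y') (at 0)"
    using H0 y unfolding has_field_derivative_iff by (intro tendsto_intros Nlim) auto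
  moreover have "(H h (y 0) - H 0 (y 0)) / (h - 0) + N h * ((y h - y 0) / (h - 0))
     = (H h (y h) - H 0 (y 0)) / (h - 0)" for h
  proof -
    have "N h * (y h - y 0) = H h (y h) - H h (y 0)"
      by (auto simp: N_def)
    then show ?thesis by (simp add: add_divide_distrib[symmetric])
  qed
  ultimately show ?thesis
    unfolding has_field_derivative_iff by simp
qed

text \<open>Since limits in \<open>F\<close> are unique, the relation \<open>dir_deriv\<close>
  yields a graph over the same domain again, and iterated derivatives can be computed one after the
  other.\<close>

lemma dir_deriv_graph:
  fixes g g' :: "'a::real_vector \<Rightarrow> 'b::real_vector"
  assumes F: "Hausdorff_space F" and X: "subspace X" "v \<in> X"
    and lim: "\<And>x. x \<in> X \<Longrightarrow> limitin F (\<lambda>h. inverse h *\<^sub>R (g (x + h *\<^sub>R v) - g x)) (g' x) (at 0)"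
  shows "dir_deriv F v ((\<lambda>x. (x, g x)) ` X) = (\<lambda>x. (x, g' x)) ` X"
proof -
  have app: "graph_app ((\<lambda>x. (x, g x)) ` X) x = g x" if "x \<in> X" for x
    using that unfolding graph_app_def by (intro the_equality) auto
  have dom: "Domain ((\<lambda>x. (x, g x)) ` X) = X" by force
  have mem: "x + t *\<^sub>R v \<in> X" if "x \<in> X" for x t
    using that X by (simp add: subspace_add subspace_scale)
  have lim_iff: "limitin F (\<lambda>t. inverse t *\<^sub>R (graph_app ((\<lambda>x. (x, g x)) ` X) (x + t *\<^sub>R v)
      - graph_app ((\<lambda>x. (x, g x)) ` X) x)) y (at 0) \<longleftrightarrow> y = g' x" if x: "x \<in> X" for x y
  proof -
    have eq: "(\<lambda>t. inverse t *\<^sub>R (graph_app ((\<lambda>x. (x, g x)) ` X) (x + t *\<^sub>R v) - graph_app ((\<lambda>x. (x, g x)) ` X) x))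
        = (\<lambda>h. inverse h *\<^sub>R (g (x + h *\<^sub>R v) - g x))"
      using x by (simp add: app mem)
    show ?thesis
      unfolding eq using limitin_Hausdorff_unique[OF _ lim[OF x] _ F, of y] lim[OF x] by auto
  qed
  show ?thesis
  proof (rule set_eqI)
    fix p :: "'a \<times> 'b"
    obtain x y where p: "p = (x, y)" by force
    show "p \<in> dir_deriv F v ((\<lambda>x. (x, g x)) ` X) \<longleftrightarrow> p \<in> (\<lambda>x. (x, g' x)) ` X"
    proof (cases "x \<in> X")
      case True
      have "p \<in> dir_deriv F v ((\<lambda>x. (x, g x)) ` X) \<longleftrightarrow> y = g' x"
        unfolding p dir_deriv_def dom mem_Collect_eq case_prod_conv using True
        by (simp only: mem lim_iff[OF True] eventually_True simp_thms)
      then show ?thesis using True by (auto simp: p)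
    qed (auto simp: p dir_deriv_def dom)
  qed
qed

section \<open>Keller's conditions for a tower of directional derivatives\<close>

lemma continuous_line:
  assumes E: "locally_convex_space E" and "x \<in> topspace E" "v \<in> topspace E"
  shows "continuous_map euclideanreal E (\<lambda>h. x + h *\<^sub>R v)"
proof -
  have c: "continuous_map (prod_topology euclideanreal E) E (\<lambda>(c, x). c *\<^sub>R x)"
    and a: "continuous_map (prod_topology E E) E (\<lambda>(x, y). x + y)"
    using E by (auto simp: locally_convex_space_def)
  have "continuous_map euclideanreal (prod_topology euclideanreal E) (\<lambda>h. (h, v))"
    using assms by (simp add: continuous_map_pairedI)
  from continuous_map_compose[OF this c] have "continuous_map euclideanreal E (\<lambda>h. h *\<^sub>R v)"
    by (simp add: o_def)
  then have "continuous_map euclideanreal (prod_topology E E) (\<lambda>h. (x, h *\<^sub>R v))"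
    using assms by (simp add: continuous_map_pairedI)
  from continuous_map_compose[OF this a] show ?thesis by (simp add: o_def)
qed

text \<open>\<open>D l x u\<close> stands for d^l f(x)(u 0, ..., u (l-1)), with f given by
  \<open>D 0\<close>. Sequences \<open>u\<close> give all orders the same domain; by
  \<open>cong\<close> the slots from \<open>l\<close> on are ignored, and by \<open>lim\<close> slot
  \<open>l\<close> holds the direction of the next derivative.\<close>

context
  fixes E :: "'a::real_vector topology" and F :: "'b::real_vector topology" and \<L>
    and D :: "nat \<Rightarrow> 'a \<Rightarrow> (nat \<Rightarrow> 'a) \<Rightarrow> 'b"
  assumes E: "locally_convex_space E" and F: "functional_topology F \<L>"
    and cong: "\<And>l x u v. x \<in> topspace E \<Longrightarrow> range u \<subseteq> topspace E \<Longrightarrow> range v \<subseteq> topspace E \<Longrightarrow>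
      (\<And>i. i < l \<Longrightarrow> u i = v i) \<Longrightarrow> D l x u = D l x v"
    and lim: "\<And>l x u. x \<in> topspace E \<Longrightarrow> range u \<subseteq> topspace E \<Longrightarrow>
      limitin F (\<lambda>h. inverse h *\<^sub>R (D l (x + h *\<^sub>R u l) u - D l x u)) (D (Suc l) x u) (at 0)"
    and cont: "\<And>l. continuous_map (prod_topology E (product_topology (\<lambda>_. E) UNIV)) F (\<lambda>(x, u). D l x u)"
begin

interpretation F: functional_topology F \<L> by (rule F)

lemma sub_E: "subspace (topspace E)"
  using E by (simp add: locally_convex_space_def)

lemma add_E: "x \<in> topspace E \<Longrightarrow> y \<in> topspace E \<Longrightarrow> x + y \<in> topspace E"
  and scale_E: "x \<in> topspace E \<Longrightarrow> c *\<^sub>R x \<in> topspace E"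
  and zero_E: "0 \<in> topspace E"
  using sub_E by (auto simp: subspace_add subspace_scale subspace_0)

lemma upd_E: "range u \<subseteq> topspace E \<Longrightarrow> v \<in> topspace E \<Longrightarrow> range (u(i := v)) \<subseteq> topspace E"
  by auto

lemma D_mem:
  assumes "x \<in> topspace E" "range u \<subseteq> topspace E"
  shows "D l x u \<in> topspace F"
proof -
  have "(x, u) \<in> topspace (prod_topology E (product_topology (\<lambda>_. E) UNIV))"
    using assms by (simp add: PiE_UNIV_domain image_subset_iff)
  then have "(\<lambda>(x, u). D l x u) (x, u) \<in> topspace F"
    using continuous_map_image_subset_topspace[OF cont[of l]] by blast
  then show ?thesis by simp
qed

text \<open>\<open>D l\<close> does not read slot \<open>l\<close>, so this slot may be overwritten
  by any direction \<open>v\<close>; applying \<open>lim\<close> at the base point x + s v gives the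
  derivative at every \<open>s\<close>.\<close>

lemma functional_deriv:
  assumes L: "\<Lambda> \<in> \<L>" "\<mu> \<in> \<Lambda>" and x: "x \<in> topspace E" and u: "range u \<subseteq> topspace E" and v: "v \<in> topspace E"
  shows "((\<lambda>s. \<mu> (D l (x + s *\<^sub>R v) u)) has_real_derivative \<mu> (D (Suc l) (x + s *\<^sub>R v) (u(l := v)))) (at s)"
proof -
  let ?x = "x + s *\<^sub>R v"
  have x': "x + t *\<^sub>R v \<in> topspace E" for t using x v by (simp add: add_E scale_E)
  have "((\<lambda>h. \<mu> (inverse h *\<^sub>R (D l (?x + h *\<^sub>R (u(l := v)) l) (u(l := v)) - D l ?x (u(l := v)))))
      \<longlongrightarrow> \<mu> (D (Suc l) ?x (u(l := v)))) (at 0)"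
    by (rule F.continuous_functional[OF L lim]) (use x' upd_E[OF u v] in auto)
  moreover have "\<mu> (inverse h *\<^sub>R (D l (?x + h *\<^sub>R (u(l := v)) l) (u(l := v)) - D l ?x (u(l := v))))
     = (\<mu> (D l (x + (s + h) *\<^sub>R v) u) - \<mu> (D l (x + s *\<^sub>R v) u)) / h" for h
  proof -
    have e: "D l y (u(l := v)) = D l y u" if "y \<in> topspace E" for y
      by (rule cong) (use that u upd_E[OF u v] in auto)
    have m: "D l (x + t *\<^sub>R v) u \<in> topspace F" for t by (rule D_mem[OF x' u])
    have s: "?x + h *\<^sub>R v = x + (s + h) *\<^sub>R v" by (simp add: algebra_simps)
    have "\<mu> (inverse h *\<^sub>R (D l (x + (s + h) *\<^sub>R v) u - D l ?x u)) = inverse h * (\<mu> (D l (x + (s + h) *\<^sub>R v) u) - \<mu> (D l ?x u))"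
      by (simp add: F.lin[OF L] m subspace_diff[OF F.subspace])
    then show ?thesis
      unfolding fun_upd_same s e[OF x'] by (simp add: divide_inverse mult.commute)
  qed
  ultimately show ?thesis
    unfolding DERIV_def by simp
qed

lemma functional_cont:
  assumes L: "\<Lambda> \<in> \<L>" "\<mu> \<in> \<Lambda>" and x: "continuous_map T E x" and u: "range u \<subseteq> topspace E"
  shows "continuous_map T euclideanreal (\<lambda>s. \<mu> (D l (x s) u))"
proof -
  have "continuous_map T (prod_topology E (product_topology (\<lambda>_. E) UNIV)) (\<lambda>s. (x s, u))"
    using x u by (intro continuous_map_pairedI) (auto simp: PiE_UNIV_domain)
  from continuous_map_compose[OF this cont[of l]]
  have *: "continuous_map T F (\<lambda>s. D l (x s) u)" by (simp add: o_def)
  show ?thesis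
    unfolding continuous_map_atin limitin_canonical_iff
  proof
    fix s assume "s \<in> topspace T"
    then show "((\<lambda>s. \<mu> (D l (x s) u)) \<longlongrightarrow> \<mu> (D l (x s) u)) (atin T s)"
      using * by (intro F.continuous_functional[OF L]) (auto simp: continuous_map_atin)
  qed
qed

text \<open>Homogeneity is a rescaling of the line. Additivity compares the line in direction v + w
  with the two-parameter family x + h v + \<xi> w on its diagonal; the chain rule there uses the
  joint continuity of \<open>D (Suc l)\<close>.\<close>

lemma functional_D_linear_last:
  assumes L: "\<Lambda> \<in> \<L>" "\<mu> \<in> \<Lambda>" and x: "x \<in> topspace E" and u: "range u \<subseteq> topspace E"
    and v: "v \<in> topspace E" and w: "w \<in> topspace E"
  shows "\<mu> (D (Suc l) x (u(l := a *\<^sub>R v))) = a * \<mu> (D (Suc l) x (u(l := v)))"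
    and "\<mu> (D (Suc l) x (u(l := v + w))) = \<mu> (D (Suc l) x (u(l := v))) + \<mu> (D (Suc l) x (u(l := w)))"
proof -
  note d = functional_deriv[OF L _ u]
  have 1: "((\<lambda>s. \<mu> (D l (x + (s * a) *\<^sub>R v) u)) has_real_derivative \<mu> (D (Suc l) (x + (0 * a) *\<^sub>R v) (u(l := v))) * a) (at 0)"
    by (rule DERIV_chain2[OF d[OF x v]]) (auto intro!: derivative_eq_intros)
  have 2: "((\<lambda>s. \<mu> (D l (x + (s * a) *\<^sub>R v) u)) has_real_derivative \<mu> (D (Suc l) x (u(l := a *\<^sub>R v)))) (at 0)"
    using d[OF x scale_E[OF v, of a], of l 0] by simp
  show "\<mu> (D (Suc l) x (u(l := a *\<^sub>R v))) = a * \<mu> (D (Suc l) x (u(l := v)))"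
    using DERIV_unique[OF 1 2] by (simp add: mult.commute)
next
  note d = functional_deriv[OF L _ u]
  let ?H = "\<lambda>h \<xi>. \<mu> (D l ((x + h *\<^sub>R v) + \<xi> *\<^sub>R w) u)"
  let ?H' = "\<lambda>h \<xi>. \<mu> (D (Suc l) ((x + h *\<^sub>R v) + \<xi> *\<^sub>R w) (u(l := w)))"
  have xh: "x + h *\<^sub>R v \<in> topspace E" for h using x v by (simp add: add_E scale_E)
  have 1: "((\<lambda>h. ?H h h) has_real_derivative \<mu> (D (Suc l) x (u(l := v))) + ?H' 0 0 * 1) (at 0)"
  proof (rule has_real_derivative_compose2[where H = ?H and H' = ?H' and y = "\<lambda>h. h"])
    show "((\<lambda>h. ?H h 0) has_real_derivative \<mu> (D (Suc l) x (u(l := v)))) (at 0)"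
      using d[OF x v, of l 0] by simp
    show "\<forall>\<^sub>F (h, \<xi>) in at 0 \<times>\<^sub>F nhds 0. (?H h has_real_derivative ?H' h \<xi>) (at \<xi>)"
      using d[OF xh w] by (simp add: case_prod_unfold)
    have a: "continuous_map (prod_topology E E) E (\<lambda>(x, y). x + y)"
      using E by (auto simp: locally_convex_space_def)
    have c1: "continuous_map euclidean E (\<lambda>p::real \<times> real. x + fst p *\<^sub>R v)"
      using continuous_map_compose[OF _ continuous_line[OF E x v], of euclidean fst] 
      by (simp add: o_def continuous_map_iff_continuous2 continuous_on_fst continuous_on_id del: continuous_map_iff_continuous)
    have c2: "continuous_map euclidean E (\<lambda>p::real \<times> real. 0 + snd p *\<^sub>R w)"
      using continuous_map_compose[OF _ continuous_line[OF E zero_E w], of euclidean snd] 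
      by (simp add: o_def continuous_on_snd continuous_on_id)
    have "continuous_map euclidean (prod_topology E E) (\<lambda>p::real \<times> real. (x + fst p *\<^sub>R v, snd p *\<^sub>R w))"
      using c1 c2 by (simp add: continuous_map_pairedI)
    from continuous_map_compose[OF this a]
    have "continuous_map euclidean E (\<lambda>p::real \<times> real. (x + fst p *\<^sub>R v) + snd p *\<^sub>R w)"
      by (simp add: o_def)
    from functional_cont[OF L this upd_E[OF u w]]
    have "continuous_on UNIV (\<lambda>p. ?H' (fst p) (snd p))"
      by simp
    then show "isCont (\<lambda>(h, \<xi>). ?H' h \<xi>) (0, 0)"
      by (simp add: continuous_on_eq_continuous_at case_prod_unfold)
  qed auto
  have 2: "((\<lambda>h. ?H h h) has_real_derivative \<mu> (D (Suc l) x (u(l := v + w)))) (at 0)"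
    using d[OF x add_E[OF v w], of l 0] by (simp add: algebra_simps)
  show "\<mu> (D (Suc l) x (u(l := v + w))) = \<mu> (D (Suc l) x (u(l := v))) + \<mu> (D (Suc l) x (u(l := w)))"
    using DERIV_unique[OF 1 2] by simp
qed

lemma D_linear_last:
  assumes x: "x \<in> topspace E" and u: "range u \<subseteq> topspace E"
    and v: "v \<in> topspace E" and w: "w \<in> topspace E"
  shows "D (Suc l) x (u(l := a *\<^sub>R v + b *\<^sub>R w)) = a *\<^sub>R D (Suc l) x (u(l := v)) + b *\<^sub>R D (Suc l) x (u(l := w))"
proof -
  note m = D_mem[OF x upd_E[OF u]]
  note FI = subspace_add[OF F.subspace] subspace_diff[OF F.subspace] subspace_scale[OF F.subspace]
  show ?thesis
  proof (rule F.eq_if_functionals_eq)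
    fix \<Lambda> \<mu> assume L: "\<Lambda> \<in> \<L>" "\<mu> \<in> \<Lambda>"
    show "\<mu> (D (Suc l) x (u(l := a *\<^sub>R v + b *\<^sub>R w))) = \<mu> (a *\<^sub>R D (Suc l) x (u(l := v)) + b *\<^sub>R D (Suc l) x (u(l := w)))"
      by (simp add: F.lin[OF L] m FI add_E scale_E v w functional_D_linear_last(2)[OF L x u scale_E[OF v] scale_E[OF w]]
        functional_D_linear_last(1)[OF L x u v v] functional_D_linear_last(1)[OF L x u w w])
  qed (intro FI m add_E scale_E v w)+
qed

text \<open>In an older slot linearity passes to difference quotients by induction and then to their
  limit, which is compared after applying the separating functionals.\<close>

lemma D_linear:
  assumes x: "x \<in> topspace E" and u: "range u \<subseteq> topspace E"
    and v: "v \<in> topspace E" and w: "w \<in> topspace E" and i: "i < l"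
  shows "D l x (u(i := a *\<^sub>R v + b *\<^sub>R w)) = a *\<^sub>R D l x (u(i := v)) + b *\<^sub>R D l x (u(i := w))"
  using i x
proof (induction l arbitrary: x)
  case 0
  then show ?case by simp
next
  case (Suc l)
  show ?case
  proof (cases "i = l")
    case True
    show ?thesis unfolding True by (rule D_linear_last[OF Suc.prems(2) u v w])
  next
    case False
    then have i: "i < l" using Suc by simp
    have xh: "x + h *\<^sub>R u l \<in> topspace E" for h
      using Suc.prems u by (auto intro!: add_E scale_E)
    let ?q = "\<lambda>z h. inverse h *\<^sub>R (D l (x + h *\<^sub>R u l) (u(i := z)) - D l x (u(i := z)))"
    have lim': "limitin F (?q z) (D (Suc l) x (u(i := z))) (at 0)" if "z \<in> topspace E" for z
      using lim[OF Suc.prems(2) upd_E[OF u that], of l i] False by simp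
    let ?z = "a *\<^sub>R v + b *\<^sub>R w"
    have zE: "?z \<in> topspace E" using v w by (intro add_E scale_E)
    have q: "?q ?z h = a *\<^sub>R ?q v h + b *\<^sub>R ?q w h" for h
      unfolding Suc.IH[OF i xh] Suc.IH[OF i Suc.prems(2)] by (simp add: algebra_simps)
    note m = D_mem[OF Suc.prems(2) upd_E[OF u]]
    note m' = D_mem[OF xh upd_E[OF u]]
    note FI = subspace_add[OF F.subspace] subspace_diff[OF F.subspace] subspace_scale[OF F.subspace]
    show ?thesis
    proof (rule F.eq_if_functionals_eq)
      fix \<Lambda> \<mu> assume L: "\<Lambda> \<in> \<L>" "\<mu> \<in> \<Lambda>"
      have "((\<lambda>h. \<mu> (?q ?z h)) \<longlongrightarrow> \<mu> (D (Suc l) x (u(i := ?z)))) (at 0)"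
        by (rule F.continuous_functional[OF L lim'[OF zE]])
      moreover have "((\<lambda>h. a * \<mu> (?q v h) + b * \<mu> (?q w h)) \<longlongrightarrow> a * \<mu> (D (Suc l) x (u(i := v))) + b * \<mu> (D (Suc l) x (u(i := w)))) (at 0)"
        by (intro tendsto_intros F.continuous_functional[OF L lim'] v w)
      moreover have "\<mu> (?q ?z h) = a * \<mu> (?q v h) + b * \<mu> (?q w h)" for h
        unfolding q using FI(3)[OF FI(2)[OF m' m]] v w by (simp only: F.lin(1)[OF L] F.lin(3)[OF L] FI(3))
      ultimately have "\<mu> (D (Suc l) x (u(i := ?z))) = a * \<mu> (D (Suc l) x (u(i := v))) + b * \<mu> (D (Suc l) x (u(i := w)))"
        using tendsto_unique[of "at (0::real)"] by simp
      then show "\<mu> (D (Suc l) x (u(i := ?z))) = \<mu> (a *\<^sub>R D (Suc l) x (u(i := v)) + b *\<^sub>R D (Suc l) x (u(i := w)))"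
        by (simp add: F.lin[OF L] m FI add_E scale_E v w)
    qed (intro FI m add_E scale_E v w)+
  qed
qed

lemma D_equicontinuous:
  assumes x: "x \<in> topspace E" and W: "zero_nbhd F W"
  obtains U where "zero_nbhd E U" and "\<And>\<epsilon>. \<epsilon> > 0 \<Longrightarrow> \<exists>V. zero_nbhd E V \<and>
    (\<forall>v\<in>V. x + v \<in> topspace E \<and> (\<forall>u. range u \<subseteq> topspace E \<longrightarrow> u ` {..<l} \<subseteq> U \<longrightarrow> D l (x + v) u - D l x u \<in> (\<lambda>w. \<epsilon> *\<^sub>R w) ` W))"
proof -
  from W obtain V where V: "openin F V" "0 \<in> V" "V \<subseteq> W" by (auto simp: zero_nbhd_def)
  then obtain \<Lambda> r where L: "\<Lambda> \<in> \<L>" "r > 0" "polar_ball F \<Lambda> r 0 \<subseteq> V" using F.ball_subset by blast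
  have 0: "0 \<in> topspace F" using F.subspace by (simp add: subspace_0)
  let ?P = "prod_topology E (product_topology (\<lambda>_. E) UNIV)"
  define O' where "O' = {p \<in> topspace ?P. (case p of (x, u) \<Rightarrow> D (Suc l) x u) \<in> polar_ball F \<Lambda> r 0}"
  have O': "openin ?P O'"
    unfolding O'_def by (rule openin_continuous_map_preimage[OF cont F.open_ball[OF L(1) 0 L(2)]])
  have zu: "range (\<lambda>_::nat. 0::'a) \<subseteq> topspace E" using zero_E by auto
  have "(\<lambda>_. 0::'a)(l := 0) = (\<lambda>_. 0)" by auto
  \<comment> \<open>Linearity in slot \<open>l\<close> with both coefficients 0. It puts (x, 0) into
    \<open>O'\<close>, so that \<open>U\<close> can be found before \<epsilon> is known.\<close>
  then have "D (Suc l) x (\<lambda>_. 0) = 0"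
    using D_linear_last[OF x zu zero_E zero_E, of l 0 0] by simp
  then have "(x, \<lambda>_. 0) \<in> O'"
    using x zu 0 L by (auto simp: O'_def PiE_UNIV_domain polar_ball_def)
  then obtain A B where AB: "openin E A" "openin (product_topology (\<lambda>_. E) UNIV) B" "x \<in> A" "(\<lambda>_. 0) \<in> B" "A \<times> B \<subseteq> O'"
    using O' unfolding openin_prod_topology_alt by meson
  obtain X where X: "(\<lambda>_. 0) \<in> (\<Pi>\<^sub>E i\<in>UNIV. X i)" "\<And>i. openin E (X i)" "(\<Pi>\<^sub>E i\<in>UNIV. X i) \<subseteq> B"
    using product_topology_open_contains_basis[OF AB(2,4)] by blast
  \<comment> \<open>The index \<open>l\<close> is included: the last slot of
    \<open>D (Suc l)\<close> will receive v/\<epsilon>, which has to lie in the same neighbourhood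
    as the other arguments.\<close>
  define U where "U = (\<Inter>i\<in>{..l}. X i)"
  have Uo: "openin E U" unfolding U_def by (intro openin_INT2) (use X in auto)
  have U0: "0 \<in> U" using X by (auto simp: U_def PiE_UNIV_domain)
  have UE: "U \<subseteq> topspace E" using openin_subset[OF Uo] .
  show thesis
  proof (rule that)
    show "zero_nbhd E U" using Uo U0 UE by (auto simp: zero_nbhd_def)
    fix \<epsilon> :: real assume e: "\<epsilon> > 0"
    have "openin E {v \<in> topspace E. x + 1 *\<^sub>R v \<in> A}"
    proof -
      have a: "continuous_map (prod_topology E E) E (\<lambda>(x, y). x + y)"
        using E by (auto simp: locally_convex_space_def)
      have "continuous_map E (prod_topology E E) (\<lambda>v. (x, v))"
        using x by (simp add: continuous_map_pairedI)
      from continuous_map_compose[OF this a] have "continuous_map E E (\<lambda>v. x + v)" by (simp add: o_def)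
      from openin_continuous_map_preimage[OF this AB(1)] show ?thesis by simp
    qed
    then have "zero_nbhd E {v \<in> topspace E. x + v \<in> A}"
      unfolding zero_nbhd_def using zero_E AB by auto
    \<comment> \<open>Convexity keeps the segment from x to x + v inside \<open>A\<close>, as the
      mean value theorem requires.\<close>
    then obtain C where C: "zero_nbhd E C" "convex C" "C \<subseteq> {v \<in> topspace E. x + v \<in> A}"
      using E unfolding locally_convex_space_def by blast
    \<comment> \<open>The only place where \<epsilon> enters: v is so small that v/\<epsilon> is
      still admissible in slot \<open>l\<close>.\<close>
    define V where "V = C \<inter> {v \<in> topspace E. inverse \<epsilon> *\<^sub>R v \<in> U}"
    have "openin E {v \<in> topspace E. inverse \<epsilon> *\<^sub>R v \<in> U}"
    proof -
      have c: "continuous_map (prod_topology euclideanreal E) E (\<lambda>(c, x). c *\<^sub>R x)"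
        using E by (auto simp: locally_convex_space_def)
      have "continuous_map E (prod_topology euclideanreal E) (\<lambda>v. (inverse \<epsilon>, v))"
        by (simp add: continuous_map_pairedI)
      from continuous_map_compose[OF this c] have "continuous_map E E (\<lambda>v. inverse \<epsilon> *\<^sub>R v)" by (simp add: o_def)
      from openin_continuous_map_preimage[OF this Uo] show ?thesis .
    qed
    moreover obtain C' where C': "openin E C'" "0 \<in> C'" "C' \<subseteq> C" using C(1) by (auto simp: zero_nbhd_def)
    ultimately have "openin E (C' \<inter> {v \<in> topspace E. inverse \<epsilon> *\<^sub>R v \<in> U})" by (simp add: openin_Int)
    then have V0: "zero_nbhd E V"
      unfolding zero_nbhd_def V_def using C' U0 zero_E
      by (intro conjI exI[of _ "C' \<inter> {v \<in> topspace E. inverse \<epsilon> *\<^sub>R v \<in> U}"]) auto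
    have "x + v \<in> topspace E \<and> (\<forall>u. range u \<subseteq> topspace E \<longrightarrow> u ` {..<l} \<subseteq> U \<longrightarrow> D l (x + v) u - D l x u \<in> (\<lambda>w. \<epsilon> *\<^sub>R w) ` W)"
      if v: "v \<in> V" for v
    proof (intro conjI allI impI)
      have vE: "v \<in> topspace E" using v by (auto simp: V_def)
      show xv: "x + v \<in> topspace E" using x vE by (rule add_E)
      fix u :: "nat \<Rightarrow> 'a" assume u: "range u \<subseteq> topspace E" "u ` {..<l} \<subseteq> U"
      define w where "w = inverse \<epsilon> *\<^sub>R (D l (x + v) u - D l x u)"
      have m: "D l (x + v) u \<in> topspace F" "D l x u \<in> topspace F"
        using D_mem xv x u by auto
      have wF: "w \<in> topspace F"
        unfolding w_def using m F.subspace by (simp add: subspace_diff subspace_scale)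
      have "\<bar>\<mu> w - \<mu> 0\<bar> < r" if l: "\<mu> \<in> \<Lambda>" for \<mu>
      proof -
        obtain s where s: "0 < s" "s < 1" "\<mu> (D l (x + 1 *\<^sub>R v) u) - \<mu> (D l (x + 0 *\<^sub>R v) u) = (1 - 0) * \<mu> (D (Suc l) (x + s *\<^sub>R v) (u(l := v)))"
          using MVT2[of 0 1 "\<lambda>s. \<mu> (D l (x + s *\<^sub>R v) u)" "\<lambda>s. \<mu> (D (Suc l) (x + s *\<^sub>R v) (u(l := v)))"]
            functional_deriv[OF L(1) l x u(1) vE] by auto
        have "s *\<^sub>R v + (1 - s) *\<^sub>R 0 \<in> C"
          using C(2) v C' s by (intro convexD) (auto simp: V_def)
        then have xs: "x + s *\<^sub>R v \<in> A" using C by auto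
        then have xsE: "x + s *\<^sub>R v \<in> topspace E" using openin_subset[OF AB(1)] by auto
        have viE: "inverse \<epsilon> *\<^sub>R v \<in> topspace E" using scale_E[OF vE] .
        have viU: "inverse \<epsilon> *\<^sub>R v \<in> U" using v by (auto simp: V_def)
        \<comment> \<open>The slots after \<open>l\<close> of the given \<open>u\<close> need not
          lie in the sets \<open>X i\<close>; they are replaced by 0, which does, and
          \<open>cong\<close> makes the change invisible.\<close>
        let ?u = "\<lambda>i. if i < l then u i else if i = l then inverse \<epsilon> *\<^sub>R v else 0"
        have uE: "range ?u \<subseteq> topspace E" using u viE zero_E by auto
        have "?u i \<in> X i" for i
          using u(2) viU X(1) by (auto simp: U_def PiE_UNIV_domain image_subset_iff)
        then have "?u \<in> B" using X(3) by (auto simp: PiE_UNIV_domain)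
        then have "(x + s *\<^sub>R v, ?u) \<in> O'" using xs AB by blast
        then have "\<bar>\<mu> (D (Suc l) (x + s *\<^sub>R v) ?u) - \<mu> 0\<bar> < r"
          using l by (auto simp: O'_def polar_ball_def)
        moreover have "D (Suc l) (x + s *\<^sub>R v) ?u = D (Suc l) (x + s *\<^sub>R v) (u(l := inverse \<epsilon> *\<^sub>R v))"
          by (rule cong[OF xsE uE upd_E[OF u(1) viE]]) auto
        moreover have "\<mu> w = inverse \<epsilon> * \<mu> (D (Suc l) (x + s *\<^sub>R v) (u(l := v)))"
          using s(3) unfolding w_def by (simp add: F.lin[OF L(1) l] m subspace_diff[OF F.subspace])
        ultimately show ?thesis
          using functional_D_linear_last(1)[OF L(1) l xsE u(1) vE vE] by simp
      qed
      then have "w \<in> W" using wF L V by (auto simp: polar_ball_def)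
      moreover have "D l (x + v) u - D l x u = \<epsilon> *\<^sub>R w" using e by (simp add: w_def)
      ultimately show "D l (x + v) u - D l x u \<in> (\<lambda>w. \<epsilon> *\<^sub>R w) ` W" by blast
    qed
    with V0 show "\<exists>V. zero_nbhd E V \<and>
      (\<forall>v\<in>V. x + v \<in> topspace E \<and> (\<forall>u. range u \<subseteq> topspace E \<longrightarrow> u ` {..<l} \<subseteq> U \<longrightarrow> D l (x + v) u - D l x u \<in> (\<lambda>w. \<epsilon> *\<^sub>R w) ` W))"
      by blast
  qed
qed

theorem C_inf_piI:
  shows "(E, F, (\<lambda>x. (x, D 0 x (\<lambda>_. 0))) ` topspace E) \<in> C_inf_pi"
proof -
  define f where "f = (\<lambda>x. (x, D 0 x (\<lambda>_. 0))) ` topspace E"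
  \<comment> \<open>Class \<open>C_inf_pi\<close> takes extensional tuples of length
    \<open>l\<close>, the tower takes sequences; padding with 0 keeps the entries in the space and
    is continuous.\<close>
  define ext :: "nat \<Rightarrow> (nat \<Rightarrow> 'a) \<Rightarrow> nat \<Rightarrow> 'a" where "ext l u i = (if i < l then u i else 0)" for l u i
  have zu: "range (\<lambda>_::nat. 0::'a) \<subseteq> topspace E" using zero_E by auto
  have dirs: "dir_derivs F (map u [0..<l]) f = (\<lambda>x. (x, D l x u)) ` topspace E" if u: "range u \<subseteq> topspace E" for u l
  proof (induction l)
    case 0
    have "D 0 x u = D 0 x (\<lambda>_. 0)" if "x \<in> topspace E" for x
      by (rule cong[OF that u zu]) auto
    then show ?case by (simp add: dir_derivs_def f_def)
  next
    case (Suc l)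
    have "dir_derivs F (map u [0..<Suc l]) f = dir_deriv F (u l) ((\<lambda>x. (x, D l x u)) ` topspace E)"
      using Suc by (simp add: dir_derivs_def)
    also have "\<dots> = (\<lambda>x. (x, D (Suc l) x u)) ` topspace E"
      by (rule dir_deriv_graph[OF F.Hausdorff sub_E _ lim]) (use u in auto)
    finally show ?case .
  qed
  have extE: "range (ext l u) \<subseteq> topspace E" if "u \<in> tuples l (topspace E)" for l u
    using that zero_E by (auto simp: ext_def)
  have ext_map: "map u [0..<l] = map (ext l u) [0..<l]" for l u
    by (simp add: ext_def)
  have dirs': "dir_derivs F (map u [0..<l]) f = (\<lambda>x. (x, D l x (ext l u))) ` topspace E" if "u \<in> tuples l (topspace E)" for u l
    using dirs[OF extE[OF that], of l] by (simp add: ext_map[symmetric])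
  have dl: "dl F l f x u = D l x (ext l u)" if "x \<in> topspace E" "u \<in> tuples l (topspace E)" for l x u
    unfolding dl_def dirs'[OF that(2)] graph_app_def using that(1) by (intro the_equality) auto
  have dom: "Domain f = topspace E" by (force simp: f_def)
  have ext_upd: "ext l (u(i := z)) = (ext l u)(i := z)" if "i < l" for l u i z
    using that by (auto simp: ext_def)
  have upd_tuple: "u(i := z) \<in> tuples l (topspace E)" if "u \<in> tuples l (topspace E)" "z \<in> topspace E" "i < l" for u i z l
    using that by (auto simp: PiE_def extensional_def)
  have "(E, F, f) \<in> C_inf_pi"
    unfolding C_inf_pi_def
  proof (simp only: mem_Collect_eq case_prod_conv dom, intro conjI allI ballI impI)
    show "locally_convex_space E" "locally_convex_space F" by (rule E F.locally_convex)+
    show "single_valued f" by (auto simp: f_def single_valued_def)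
    show "topspace E \<subseteq> topspace E" "openin E (topspace E)" by auto
    show "Range f \<subseteq> topspace F" using D_mem[OF _ zu] by (auto simp: f_def)
    fix l x assume x: "x \<in> topspace E"
    show "dl_defined E F l f x"
      unfolding dl_defined_def using dirs' x by force
    show "multilinear_on l (topspace E) (dl F l f x)"
      unfolding multilinear_on_def
    proof (intro allI impI ballI)
      fix i u v w a b assume i: "i < l" and u: "u \<in> tuples l (topspace E)" and vw: "v \<in> topspace E" "w \<in> topspace E"
      then show "dl F l f x (u(i := a *\<^sub>R v + b *\<^sub>R w)) = a *\<^sub>R dl F l f x (u(i := v)) + b *\<^sub>R dl F l f x (u(i := w))"
        using D_linear[OF x extE[OF u] vw i]
        by (simp add: dl x upd_tuple add_E scale_E ext_upd)
    qed
    show "continuous_map (product_topology (\<lambda>_. E) {..<l}) F (dl F l f x)"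
    proof (rule continuous_map_eq)
      have "continuous_map (product_topology (\<lambda>_. E) {..<l}) (product_topology (\<lambda>_. E) UNIV) (ext l)"
        unfolding continuous_map_componentwise_UNIV
      proof
        fix k
        show "continuous_map (product_topology (\<lambda>_. E) {..<l}) E (\<lambda>u. ext l u k)"
          using zero_E continuous_map_product_projection[of k "{..<l}" "\<lambda>_. E"]
          by (cases "k < l") (auto simp: ext_def)
      qed
      then have "continuous_map (product_topology (\<lambda>_. E) {..<l}) (prod_topology E (product_topology (\<lambda>_. E) UNIV)) (\<lambda>u. (x, ext l u))"
        using x by (simp add: continuous_map_pairedI)
      from continuous_map_compose[OF this cont[of l]]
      show "continuous_map (product_topology (\<lambda>_. E) {..<l}) F (\<lambda>u. D l x (ext l u))"
        by (simp add: o_def)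
    qed (simp add: dl x)
    fix W assume W: "zero_nbhd F W"
    obtain U where U: "zero_nbhd E U" and UV: "\<And>\<epsilon>. \<epsilon> > 0 \<Longrightarrow> \<exists>V. zero_nbhd E V \<and>
      (\<forall>v\<in>V. x + v \<in> topspace E \<and> (\<forall>u. range u \<subseteq> topspace E \<longrightarrow> u ` {..<l} \<subseteq> U \<longrightarrow> D l (x + v) u - D l x u \<in> (\<lambda>w. \<epsilon> *\<^sub>R w) ` W))"
      using D_equicontinuous[OF x W, of l] by metis
    show "\<exists>U. zero_nbhd E U \<and> (\<forall>\<epsilon>>0. \<exists>V. zero_nbhd E V \<and> (\<forall>v\<in>V. x + v \<in> topspace E \<and>
        (\<lambda>u. dl F l f (x + v) u - dl F l f x u) ` tuples l U \<subseteq> (*\<^sub>R) \<epsilon> ` W))"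
    proof (rule exI[of _ U], intro conjI allI impI U)
      fix \<epsilon> :: real assume "\<epsilon> > 0"
      from UV[OF this] obtain V where V: "zero_nbhd E V" "\<And>v u. v \<in> V \<Longrightarrow> x + v \<in> topspace E"
        "\<And>v u. v \<in> V \<Longrightarrow> range u \<subseteq> topspace E \<Longrightarrow> u ` {..<l} \<subseteq> U \<Longrightarrow> D l (x + v) u - D l x u \<in> (\<lambda>w. \<epsilon> *\<^sub>R w) ` W"
        by blast
      have UE: "U \<subseteq> topspace E" using U by (simp add: zero_nbhd_def)
      have "dl F l f (x + v) u - dl F l f x u \<in> (\<lambda>w. \<epsilon> *\<^sub>R w) ` W" if v: "v \<in> V" and u: "u \<in> tuples l U" for u v
      proof -
        have u': "u \<in> tuples l (topspace E)" using u UE by (auto simp: PiE_iff)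
        have "ext l u ` {..<l} \<subseteq> U" using u by (auto simp: ext_def)
        from V(3)[OF v extE[OF u'] this] show ?thesis by (simp add: dl u' x V(2)[OF v])
      qed
      with V show "\<exists>V. zero_nbhd E V \<and> (\<forall>v\<in>V. x + v \<in> topspace E \<and>
        (\<lambda>u. dl F l f (x + v) u - dl F l f x u) ` tuples l U \<subseteq> (*\<^sub>R) \<epsilon> ` W)" by blast
    qed
  qed
  then show ?thesis by (simp add: f_def)
qed

end

section \<open>Scalar ordinary differential equations with parameters\<close>

lemma continuous_on_Pair_right [continuous_intros]: "continuous_on S (Pair x)"
  using continuous_on_Pair[OF continuous_on_const continuous_on_id] by simp

lemma continuous_on_curried2:
  assumes "continuous_on (S \<times> T) (\<lambda>(x, y). F x y)" "continuous_on A f" "continuous_on A g"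
    and "\<And>x. x \<in> A \<Longrightarrow> f x \<in> S" "\<And>x. x \<in> A \<Longrightarrow> g x \<in> T"
  shows "continuous_on A (\<lambda>x. F (f x) (g x))"
  using continuous_on_compose2[OF assms(1) continuous_on_Pair[OF assms(2,3)]] assms(4,5) by auto

lemma continuous_on_curried3:
  assumes "continuous_on (S \<times> T \<times> U) (\<lambda>(x, y, z). F x y z)" "continuous_on A f" "continuous_on A g" "continuous_on A h"
    and "\<And>x. x \<in> A \<Longrightarrow> f x \<in> S" "\<And>x. x \<in> A \<Longrightarrow> g x \<in> T" "\<And>x. x \<in> A \<Longrightarrow> h x \<in> U"
  shows "continuous_on A (\<lambda>x. F (f x) (g x) (h x))"
  using continuous_on_compose2[OF assms(1) continuous_on_Pair[OF assms(2) continuous_on_Pair[OF assms(3,4)]]] assms(5-) by auto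

text \<open>The factor \<open>b - a\<close> is split off without a division, so the remaining factor
  has a meaning at \<open>b = a\<close> and varies continuously with further parameters as soon as
  \<open>f'\<close> does.\<close>

lemma hadamard:
  fixes f f' :: "real \<Rightarrow> real"
  assumes d: "\<And>s. s \<in> closed_segment a b \<Longrightarrow> (f has_real_derivative f' s) (at s)"
  shows "f b - f a = (b - a) * integral {0..1} (\<lambda>r. f' (a + r * (b - a)))"
proof -
  have seg: "a + r * (b - a) \<in> closed_segment a b" if "r \<in> {0..1}" for r
    using that by (auto simp: in_segment algebra_simps intro!: exI[of _ r])
  have "((\<lambda>r. f' (a + r * (b - a)) * (b - a)) has_integral f (a + 1 * (b - a)) - f (a + 0 * (b - a))) {0..1}"
  proof (rule fundamental_theorem_of_calculus)
    fix r :: real assume "r \<in> {0..1}"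
    then have "((\<lambda>r. f (a + r * (b - a))) has_real_derivative f' (a + r * (b - a)) * (b - a)) (at r)"
      by (intro DERIV_chain2[where f = f and g = "\<lambda>r. a + r * (b - a)"] d seg) (auto intro!: derivative_eq_intros)
    then show "((\<lambda>r. f (a + r * (b - a))) has_vector_derivative f' (a + r * (b - a)) * (b - a)) (at r within {0..1})"
      by (simp add: has_real_derivative_iff_has_vector_derivative has_vector_derivative_at_within)
  qed simp
  then have "integral {0..1} (\<lambda>r. f' (a + r * (b - a)) * (b - a)) = f b - f a"
    by (rule integral_unique[THEN trans]) simp
  then show ?thesis by (simp add: mult.commute)
qed

lemma continuous_on_integral_param:
  fixes f :: "'a::topological_space \<Rightarrow> real \<Rightarrow> real"
  assumes "continuous_on (U \<times> {a..b}) (\<lambda>(x, r). f x r)"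
  shows "continuous_on U (\<lambda>x. integral {a..b} (f x))"
  using integral_continuous_on_param[of U a b f] assms by simp

lemma integral_upto_scaled:
  fixes f :: "real \<Rightarrow> real"
  assumes "0 \<le> t" "continuous_on {0..t} f"
  shows "integral {0..t} f = t * integral {0..1} (\<lambda>r. f (t * r))"
proof (cases "t = 0")
  case False
  with assms have t: "t > 0" by simp
  have "(f has_integral integral {0..t} f) (cbox 0 t)"
    using integrable_continuous_real[OF assms(2)] by (simp add: integrable_integral)
  from has_integral_affinity[OF this, of t 0] t
  have "((\<lambda>x. f (t * x)) has_integral integral {0..t} f / t) {0..1}"
    by (simp add: image_mult_atLeastAtMost)
  from integral_unique[OF this] show ?thesis using t by simp
qed simp

text \<open>Rescaling {0..\<tau> x} to {0..1} turns the moving domain into a fixed one. Continuity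
  of \<open>f\<close> is asked only on the region below the graph of \<open>\<tau>\<close>, which
  suits functions known for nonnegative times.\<close>

lemma continuous_on_integral_upto:
  fixes f :: "'a::topological_space \<Rightarrow> real \<Rightarrow> real"
  assumes \<tau>: "continuous_on S \<tau>" "\<And>x. x \<in> S \<Longrightarrow> 0 \<le> \<tau> x"
    and f: "continuous_on {(x, s). x \<in> S \<and> s \<in> {0..\<tau> x}} (\<lambda>(x, s). f x s)"
  shows "continuous_on S (\<lambda>x. integral {0..\<tau> x} (f x))"
proof -
  have f1: "continuous_on {0..\<tau> x} (f x)" if "x \<in> S" for x
    by (rule continuous_on_compose2[OF f, of "{0..\<tau> x}" "\<lambda>s. (x, s)", unfolded case_prod_conv])
      (use that in \<open>auto intro!: continuous_intros\<close>)
  have "continuous_on (S \<times> {0..1}) (\<lambda>(x, r). \<tau> x * r)"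
    unfolding case_prod_unfold
    by (intro continuous_intros continuous_on_compose2[OF \<tau>(1)]) auto
  then have "continuous_on (S \<times> {0..1}) (\<lambda>p. (fst p, \<tau> (fst p) * snd p))"
    by (auto intro!: continuous_intros simp: case_prod_unfold)
  from continuous_on_compose2[OF f this]
  have "continuous_on (S \<times> {0..1}) (\<lambda>(x, r). f x (\<tau> x * r))"
    using \<tau>(2) by (simp add: case_prod_unfold mult_left_le image_subset_iff)
  from continuous_on_integral_param[OF this]
  have "continuous_on S (\<lambda>x. \<tau> x * integral {0..1} (\<lambda>r. f x (\<tau> x * r)))"
    by (intro continuous_intros \<tau>)
  then show ?thesis
    by (rule continuous_on_eq) (simp add: integral_upto_scaled \<tau> f1)
qed

lemma has_real_derivative_factor:
  fixes f Q :: "real \<Rightarrow> real"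
  assumes "\<And>h. f h - f a = (h - a) * Q h" "isCont Q a"
  shows "(f has_real_derivative Q a) (at a)"
  unfolding CARAT_DERIV using assms by (intro exI[of _ Q]) (simp add: mult.commute)

text \<open>The mean value formula of \<open>hadamard\<close> is an identity between continuous
  functions of \<open>t\<close>, so it persists in the limit t = 0, and there it gives back the
  derivative.\<close>

lemma has_real_derivative_boundary:
  fixes F F' :: "real \<Rightarrow> real \<Rightarrow> real"
  assumes d: "\<And>t \<xi>. t > 0 \<Longrightarrow> (F t has_real_derivative F' t \<xi>) (at \<xi>)"
    and F: "continuous_on ({0..} \<times> UNIV) (\<lambda>(t, \<xi>). F t \<xi>)"
    and F': "continuous_on ({0..} \<times> UNIV) (\<lambda>(t, \<xi>). F' t \<xi>)"
    and t: "t \<ge> 0"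
  shows "(F t has_real_derivative F' t \<xi>) (at \<xi>)"
proof -
  note cF = continuous_on_curried2[OF F]
  note cF' = continuous_on_curried2[OF F']
  define Q where "Q t \<zeta> = integral {0..1} (\<lambda>r. F' t (\<xi> + r * (\<zeta> - \<xi>)))" for t \<zeta>
  have eq: "F t \<zeta> - F t \<xi> - (\<zeta> - \<xi>) * Q t \<zeta> = 0" if "t > 0" for t \<zeta>
    using hadamard[of \<xi> \<zeta>, OF d[OF that]] by (simp add: Q_def)
  have eq0: "F t \<zeta> - F t \<xi> - (\<zeta> - \<xi>) * Q t \<zeta> = 0" for \<zeta>
  proof (rule continuous_constant_on_closure[of "{0<..}" "\<lambda>t. F t \<zeta> - F t \<xi> - (\<zeta> - \<xi>) * Q t \<zeta>" 0 t])
    have "continuous_on {0..} (\<lambda>t. Q t \<zeta>)"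
      unfolding Q_def case_prod_unfold
      by (intro continuous_on_integral_param, unfold case_prod_unfold) (auto intro!: continuous_intros cF')
    moreover have "continuous_on {0..} (\<lambda>t. F t c)" for c
      by (rule cF) (auto intro!: continuous_intros)
    ultimately show "continuous_on (closure {0<..}) (\<lambda>t. F t \<zeta> - F t \<xi> - (\<zeta> - \<xi>) * Q t \<zeta>)"
      by (auto intro!: continuous_intros)
  qed (use eq t in auto)
  have "continuous_on UNIV (Q t)"
    unfolding Q_def
    by (intro continuous_on_integral_param, unfold case_prod_unfold) (use t in \<open>auto intro!: continuous_intros cF'\<close>)
  then have "isCont (Q t) \<xi>" by (simp add: continuous_on_eq_continuous_at)
  then have "(F t has_real_derivative Q t \<xi>) (at \<xi>)"
    using eq0 by (intro has_real_derivative_factor) (auto simp: algebra_simps)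
  then show ?thesis by (simp add: Q_def)
qed

section \<open>Gronwall estimates, uniqueness and global existence\<close>

lemma gronwall:
  fixes e :: "real \<Rightarrow> real"
  assumes e: "continuous_on {0..T} e" and L: "0 \<le> L"
    and le: "\<And>t. t \<in> {0..T} \<Longrightarrow> e t \<le> C + L * integral {0..t} e"
    and t: "t \<in> {0..T}"
  shows "e t \<le> C * exp (L * t)"
proof -
  \<comment> \<open>The majorant of \<open>e\<close>, unlike \<open>e\<close>, is differentiable;
    with this weight the hypothesis says exactly that its derivative is nonpositive.\<close>
  define G where "G t = (C + L * integral {0..t} e) * exp (- L * t)" for t
  have I: "((\<lambda>x. integral {0..x} e) has_real_derivative e s) (at s within {0..T})" if "s \<in> {0..T}" for s
    using integral_has_real_derivative[OF e that] .
  have "G t \<le> G 0"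
  proof (cases "t = 0")
    case False
    show ?thesis
    proof (rule DERIV_nonpos_imp_decreasing_open[of 0 t G])
    show "0 \<le> t" using t by simp
    have "continuous_on {0..T} (\<lambda>x. integral {0..x} e)"
      using DERIV_continuous_on[OF I] by simp
    then have "continuous_on {0..t} (\<lambda>x. integral {0..x} e)"
      using t by (auto elim: continuous_on_subset)
    then show "continuous_on {0..t} G" unfolding G_def by (intro continuous_intros)
    fix s assume s: "0 < s" "s < t"
    then have s': "s \<in> {0..T}" using t by auto
    have "((\<lambda>x. integral {0..x} e) has_real_derivative e s) (at s)"
      using I[OF s'] s t at_within_Icc_at[of 0 s T] by simp
    then have "(G has_real_derivative ((L * e s) * exp (- L * s) + (C + L * integral {0..s} e) * (exp (- L * s) * (- L)))) (at s)"
      unfolding G_def by (auto intro!: derivative_eq_intros)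
    moreover have "(L * e s) * exp (- L * s) + (C + L * integral {0..s} e) * (exp (- L * s) * (- L))
       = (L * exp (- L * s)) * (e s - (C + L * integral {0..s} e))"
      by (simp add: algebra_simps)
    moreover have "\<dots> \<le> 0"
      using le[OF s'] L by (intro mult_nonneg_nonpos) auto
    ultimately show "\<exists>y. (G has_real_derivative y) (at s) \<and> y \<le> 0" by metis
    qed
  qed simp
  then have "(C + L * integral {0..t} e) * exp (- L * t) \<le> C" by (simp add: G_def)
  then have "C + L * integral {0..t} e \<le> C * exp (L * t)"
    by (simp add: exp_minus field_simps)
  with le[OF t] show ?thesis by linarith
qed

text \<open>Variation of constants with the integrating factor \<open>exp (- A s)\<close>. The
  explicit formula shows continuity and smoothness in parameters hidden in \<open>a\<close>,
  \<open>b\<close> and \<open>c\<close>.\<close>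

lemma linear_ode_solution:
  fixes D a b :: "real \<Rightarrow> real"
  assumes t: "0 \<le> t" and a: "continuous_on {0..t} a" and b: "continuous_on {0..t} b" and D: "continuous_on {0..t} D"
    and eq: "\<And>s. s \<in> {0..t} \<Longrightarrow> D s = c + integral {0..s} (\<lambda>r. a r * D r + b r)"
  shows "D t = exp (integral {0..t} a) * (c + integral {0..t} (\<lambda>s. exp (- integral {0..s} a) * b s))"
proof -
  define A where "A s = integral {0..s} a" for s
  have A: "(A has_real_derivative a s) (at s within {0..t})" if "s \<in> {0..t}" for s
    using integral_has_real_derivative[OF a that] by (simp add: A_def[abs_def])
  have "((\<lambda>s. c + integral {0..s} (\<lambda>r. a r * D r + b r)) has_real_derivative a s * D s + b s) (at s within {0..t})"
    if "s \<in> {0..t}" for s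
  proof -
    have "continuous_on {0..t} (\<lambda>r. a r * D r + b r)" by (intro continuous_intros a b D)
    from DERIV_add[OF DERIV_const integral_has_real_derivative[OF this that], of c]
    show ?thesis by simp
  qed
  then have D': "(D has_real_derivative a s * D s + b s) (at s within {0..t})" if "s \<in> {0..t}" for s
    using has_field_derivative_cong_eventually[of D "\<lambda>s. c + integral {0..s} (\<lambda>r. a r * D r + b r)" s "{0..t}"]
      eq that by (auto simp: eventually_at_filter)
  have "((\<lambda>s. exp (- A s) * b s) has_integral exp (- A t) * D t - exp (- A 0) * D 0) {0..t}"
  proof (rule fundamental_theorem_of_calculus[OF t])
    fix s assume s: "s \<in> {0..t}"
    have "((\<lambda>s. exp (- A s) * D s) has_real_derivative exp (- A s) * (- a s) * D s + (a s * D s + b s) * exp (- A s)) (at s within {0..t})"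
      by (rule derivative_eq_intros A[OF s] D'[OF s] refl)+
    then show "((\<lambda>s. exp (- A s) * D s) has_vector_derivative exp (- A s) * b s) (at s within {0..t})"
      by (simp add: has_real_derivative_iff_has_vector_derivative algebra_simps)
  qed
  moreover have "D 0 = c" using eq[of 0] t by simp
  ultimately have "integral {0..t} (\<lambda>s. exp (- A s) * b s) = exp (- A t) * D t - c"
    by (simp add: integral_unique A_def)
  then show ?thesis by (simp add: A_def exp_minus field_simps)
qed

text \<open>The two equations play different roles: closeness of \<open>g\<close> to
  \<open>f\<close> is asked along \<open>v\<close> only, and the Lipschitz bound concerns
  \<open>f\<close>, so \<open>f\<close> can be a fixed reference equation. In the constant, \<delta>
  comes from the initial values and \<delta> T from the integrated defect.\<close>

lemma ode_difference_bound:
  fixes v w :: "real \<Rightarrow> real"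
  assumes v: "continuous_on {0..T} v" and w: "continuous_on {0..T} w" and C: "\<delta> \<ge> 0" and L: "L \<ge> 0"
    and g: "continuous_on {0..T} (\<lambda>t. g t (v t))" and f: "continuous_on {0..T} (\<lambda>t. f t (w t))"
    and veq: "\<And>t. t \<in> {0..T} \<Longrightarrow> v t = v0 + integral {0..t} (\<lambda>s. g s (v s))"
    and weq: "\<And>t. t \<in> {0..T} \<Longrightarrow> w t = w0 + integral {0..t} (\<lambda>s. f s (w s))"
    and close: "\<bar>v0 - w0\<bar> \<le> \<delta>" "\<And>t. t \<in> {0..T} \<Longrightarrow> \<bar>g t (v t) - f t (v t)\<bar> \<le> \<delta>"
    and lip: "\<And>t. t \<in> {0..T} \<Longrightarrow> \<bar>f t (v t) - f t (w t)\<bar> \<le> L * \<bar>v t - w t\<bar>"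
    and t: "t \<in> {0..T}"
  shows "\<bar>v t - w t\<bar> \<le> \<delta> * (1 + T) * exp (L * t)"
proof (rule gronwall[OF _ L _ t, of "\<lambda>t. \<bar>v t - w t\<bar>" "\<delta> * (1 + T)"])
  show "continuous_on {0..T} (\<lambda>t. \<bar>v t - w t\<bar>)" by (intro continuous_intros v w)
  fix t assume t: "t \<in> {0..T}"
  then have sub: "{0..t} \<subseteq> {0..T}" by auto
  note c = continuous_on_subset[OF _ sub]
  have "v t - w t = (v0 - w0) + integral {0..t} (\<lambda>s. g s (v s) - f s (w s))"
    using veq[OF t] weq[OF t] integrable_continuous_real[OF c[OF g]] integrable_continuous_real[OF c[OF f]]
    by (simp add: integral_diff)
  then have "\<bar>v t - w t\<bar> \<le> \<bar>v0 - w0\<bar> + norm (integral {0..t} (\<lambda>s. g s (v s) - f s (w s)))"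
    by (simp add: abs_triangle_ineq)
  also have "norm (integral {0..t} (\<lambda>s. g s (v s) - f s (w s))) \<le> integral {0..t} (\<lambda>s. \<delta> + L * \<bar>v s - w s\<bar>)"
  proof (rule integral_norm_bound_integral)
    show "(\<lambda>s. g s (v s) - f s (w s)) integrable_on {0..t}"
      by (intro integrable_continuous_real continuous_intros c[OF f] c[OF g])
    show "(\<lambda>s. \<delta> + L * \<bar>v s - w s\<bar>) integrable_on {0..t}"
      by (intro integrable_continuous_real continuous_intros c[OF v] c[OF w])
    fix s assume "s \<in> {0..t}"
    then have s: "s \<in> {0..T}" using sub by blast
    show "norm (g s (v s) - f s (w s)) \<le> \<delta> + L * \<bar>v s - w s\<bar>"
      using close(2)[OF s] lip[OF s] unfolding real_norm_def by linarith
  qed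
  also have "\<dots> = \<delta> * t + L * integral {0..t} (\<lambda>s. \<bar>v s - w s\<bar>)"
  proof -
    have "(\<lambda>s. L * \<bar>v s - w s\<bar>) integrable_on {0..t}"
      by (intro integrable_continuous_real continuous_intros c[OF v] c[OF w])
    then have "integral {0..t} (\<lambda>s. \<delta> + L * \<bar>v s - w s\<bar>) = integral {0..t} (\<lambda>s. \<delta>) + integral {0..t} (\<lambda>s. L * \<bar>v s - w s\<bar>)"
      by (intro integral_add) auto
    then show ?thesis using t by simp
  qed
  also have "\<delta> * t \<le> \<delta> * T" using t C by (intro mult_left_mono) auto
  finally show "\<bar>v t - w t\<bar> \<le> \<delta> * (1 + T) + L * integral {0..t} (\<lambda>t. \<bar>v t - w t\<bar>)"
    using close(1) by (simp add: algebra_simps)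
qed

lemma ode_unique:
  fixes v w :: "real \<Rightarrow> real"
  assumes v: "continuous_on {0..} v" and w: "continuous_on {0..} w"
    and g: "continuous_on ({0..} \<times> UNIV) (\<lambda>(t, \<xi>). g t \<xi>)"
    and lip: "\<And>T. \<exists>L. \<forall>t\<in>{0..T}. \<forall>\<xi> \<xi>'. \<bar>g t \<xi> - g t \<xi>'\<bar> \<le> L * \<bar>\<xi> - \<xi>'\<bar>"
    and veq: "\<And>t. t \<ge> 0 \<Longrightarrow> v t = w0 + integral {0..t} (\<lambda>s. g s (v s))"
    and weq: "\<And>t. t \<ge> 0 \<Longrightarrow> w t = w0 + integral {0..t} (\<lambda>s. g s (w s))"
    and t: "t \<ge> 0"
  shows "v t = w t"
proof -
  from lip[of t] obtain L where L: "\<And>s \<xi> \<xi>'. s \<in> {0..t} \<Longrightarrow> \<bar>g s \<xi> - g s \<xi>'\<bar> \<le> L * \<bar>\<xi> - \<xi>'\<bar>" by blast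
  note c = continuous_on_compose2[OF g, of _ "\<lambda>s. (s, y s)" for y, simplified]
  have "\<bar>v t - w t\<bar> \<le> 0 * (1 + t) * exp (max L 0 * t)"
  proof (rule ode_difference_bound[where v = v and w = w and f = g and g = g and ?v0.0 = w0 and ?w0.0 = w0])
    show "continuous_on {0..t} v" "continuous_on {0..t} w"
      using v w by (auto elim: continuous_on_subset)
    then show "continuous_on {0..t} (\<lambda>t. g t (v t))" "continuous_on {0..t} (\<lambda>t. g t (w t))"
      by (auto intro!: c continuous_intros)
    fix s assume s: "s \<in> {0..t}"
    have "L * \<bar>v s - w s\<bar> \<le> max L 0 * \<bar>v s - w s\<bar>" by (intro mult_right_mono) auto
    then show "\<bar>g s (v s) - g s (w s)\<bar> \<le> max L 0 * \<bar>v s - w s\<bar>"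
      using L[OF s, of "v s" "w s"] by linarith
  qed (use t veq weq in auto)
  then show ?thesis by simp
qed

text \<open>Picard iteration. Measured against \<open>exp (2 * L * t)\<close>, every iteration gains
  a factor 1/2 on an interval of any length, because integrating \<open>L * exp (2 * L * s)\<close>
  gives at most half the weight. The limit \<open>w\<close> is one pointwise series for all
  \<open>T\<close>, so no solutions have to be glued.\<close>

lemma ode_exists:
  fixes g :: "real \<Rightarrow> real \<Rightarrow> real"
  assumes g: "continuous_on ({0..} \<times> UNIV) (\<lambda>(t, \<xi>). g t \<xi>)"
    and lip: "\<And>T. \<exists>L. \<forall>t\<in>{0..T}. \<forall>\<xi> \<xi>'. \<bar>g t \<xi> - g t \<xi>'\<bar> \<le> L * \<bar>\<xi> - \<xi>'\<bar>"
  obtains w where "continuous_on {0..} w" "\<And>t. t \<ge> 0 \<Longrightarrow> w t = w0 + integral {0..t} (\<lambda>s. g s (w s))"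
proof -
  note cg = continuous_on_curried2[OF g]
  define W where "W = rec_nat (\<lambda>t. w0) (\<lambda>_ v t. w0 + integral {0..t} (\<lambda>s. g s (v s)))"
  have W0: "W 0 t = w0" and WS: "W (Suc n) t = w0 + integral {0..t} (\<lambda>s. g s (W n s))" for n t
    by (simp_all add: W_def)
  have cW: "continuous_on {0..T} (W n)" for n T
  proof (induction n)
    case (Suc n)
    then have "continuous_on {0..T} (\<lambda>s. g s (W n s))"
      by (intro cg) (auto intro: continuous_intros)
    from DERIV_continuous_on[OF integral_has_real_derivative[OF this]]
    show ?case by (auto simp: WS[abs_def] intro!: continuous_intros)
  qed (simp add: W0[abs_def])
  have cgW: "continuous_on {0..T} (\<lambda>s. g s (W n s))" for n T
    by (intro cg) (auto intro: continuous_intros cW)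
  define w where "w t = w0 + (\<Sum>i. W (Suc i) t - W i t)" for t
  have main: "uniform_limit {0..T} W w sequentially \<and> (\<forall>t\<in>{0..T}. w t = w0 + integral {0..t} (\<lambda>s. g s (w s)))" for T
  proof -
    obtain L0 where L0: "\<And>t \<xi> \<xi>'. t \<in> {0..T} \<Longrightarrow> \<bar>g t \<xi> - g t \<xi>'\<bar> \<le> L0 * \<bar>\<xi> - \<xi>'\<bar>"
      using lip[of T] by blast
    define L where "L = max L0 1"
    have L: "L > 0" "\<bar>g t \<xi> - g t \<xi>'\<bar> \<le> L * \<bar>\<xi> - \<xi>'\<bar>" if "t \<in> {0..T}" for t \<xi> \<xi>'
      using L0[OF that, of \<xi> \<xi>'] mult_right_mono[of L0 L "\<bar>\<xi> - \<xi>'\<bar>"] by (auto simp: L_def)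
    have "compact ((\<lambda>t. W 1 t - W 0 t) ` {0..T})"
      by (intro compact_continuous_image continuous_intros cW) simp
    then obtain C where C: "\<And>t. t \<in> {0..T} \<Longrightarrow> \<bar>W 1 t - W 0 t\<bar> \<le> C"
      by (fastforce simp: bounded_iff dest: compact_imp_bounded)
    have Lp: "L > 0" by (simp add: L_def)
    have bound: "\<bar>W (Suc n) t - W n t\<bar> \<le> C * (1/2)^n * exp (2 * L * t)" if "t \<in> {0..T}" for n t
      using that
    proof (induction n arbitrary: t)
      case 0
      have "C \<ge> 0" using C[OF 0] by linarith
      then have "C * 1 \<le> C * exp (2 * L * t)" using Lp 0 by (intro mult_left_mono) auto
      with C[OF 0] show ?case by simp
    next
      case (Suc n)
      define K where "K = C * (1/2)^n"
      have K: "K \<ge> 0" using C[OF Suc.prems] unfolding K_def by (intro mult_nonneg_nonneg) auto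
      have "((\<lambda>s. L * (K * exp (2 * L * s))) has_integral K / 2 * exp (2 * L * t) - K / 2 * exp (2 * L * 0)) {0..t}"
        using Suc.prems
        by (intro fundamental_theorem_of_calculus)
          (auto intro!: derivative_eq_intros simp flip: has_real_derivative_iff_has_vector_derivative)
      then have hi: "((\<lambda>s. L * (K * exp (2 * L * s))) has_integral K / 2 * exp (2 * L * t) - K / 2) {0..t}" by simp
      have "W (Suc (Suc n)) t - W (Suc n) t = integral {0..t} (\<lambda>s. g s (W (Suc n) s) - g s (W n s))"
        unfolding WS[of "Suc n"] WS[of n t]
        by (simp add: integral_diff integrable_continuous_real cgW)
      also have "norm \<dots> \<le> integral {0..t} (\<lambda>s. L * (K * exp (2 * L * s)))"
      proof (rule integral_norm_bound_integral)
        show "(\<lambda>s. g s (W (Suc n) s) - g s (W n s)) integrable_on {0..t}"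
          by (intro integrable_continuous_real continuous_intros cgW)
        show "(\<lambda>s. L * (K * exp (2 * L * s))) integrable_on {0..t}" using hi by blast
        fix s assume "s \<in> {0..t}"
        then have s: "s \<in> {0..T}" using Suc.prems by auto
        have "\<bar>g s (W (Suc n) s) - g s (W n s)\<bar> \<le> L * \<bar>W (Suc n) s - W n s\<bar>" by (rule L(2)[OF s])
        also have "\<dots> \<le> L * (K * exp (2 * L * s))"
          using Suc.IH[OF s] Lp unfolding K_def by (intro mult_left_mono) auto
        finally show "norm (g s (W (Suc n) s) - g s (W n s)) \<le> L * (K * exp (2 * L * s))" by simp
      qed
      also have "\<dots> = K / 2 * exp (2 * L * t) - K / 2" by (rule integral_unique[OF hi])
      also have "\<dots> \<le> K / 2 * exp (2 * L * t)" using K by simp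
      finally have "\<bar>W (Suc (Suc n)) t - W (Suc n) t\<bar> \<le> K / 2 * exp (2 * L * t)" by (simp only: real_norm_def)
      moreover have "K / 2 = C * (1/2)^Suc n" by (simp add: K_def)
      ultimately show ?case by (simp only:)
    qed
    have "uniform_limit {0..T} (\<lambda>n t. \<Sum>i<n. W (Suc i) t - W i t) (\<lambda>t. \<Sum>i. W (Suc i) t - W i t) sequentially"
    proof (rule Weierstrass_m_test)
      fix n t assume t: "t \<in> {0..T}"
      have "\<bar>W (Suc n) t - W n t\<bar> \<le> C * (1/2)^n * exp (2 * L * t)" by (rule bound[OF t])
      also have "\<dots> \<le> C * (1/2)^n * exp (2 * L * T)"
        using t Lp C[OF t] by (intro mult_left_mono mult_nonneg_nonneg) auto
      finally show "norm (W (Suc n) t - W n t) \<le> C * exp (2 * L * T) * (1/2)^n" by (simp add: mult_ac)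
    qed (intro summable_mult summable_geometric, simp)
    then have "uniform_limit {0..T} (\<lambda>n t. w0 + (\<Sum>i<n. W (Suc i) t - W i t)) w sequentially"
      unfolding w_def by (intro uniform_limit_add uniform_limit_const)
    moreover have "w0 + (\<Sum>i<n. W (Suc i) t - W i t) = W n t" for n t
      using sum_lessThan_telescope[of "\<lambda>i. W i t" n] by (simp only: W0)
    ultimately have ul: "uniform_limit {0..T} W w sequentially"
      by (simp only:)
    have ulg: "uniform_limit {0..T} (\<lambda>n t. g t (W n t)) (\<lambda>t. g t (w t)) sequentially"
    proof (rule uniform_limitI)
      fix e :: real assume "e > 0"
      then have "e / L > 0" using Lp by simp
      from uniform_limitD[OF ul this]
      show "\<forall>\<^sub>F n in sequentially. \<forall>t\<in>{0..T}. dist (g t (W n t)) (g t (w t)) < e"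
      proof eventually_elim
        case (elim n)
        show ?case
        proof
          fix t assume t: "t \<in> {0..T}"
          have "\<bar>g t (W n t) - g t (w t)\<bar> \<le> L * \<bar>W n t - w t\<bar>" by (rule L(2)[OF t])
          also have "\<dots> < e" using elim t Lp by (auto simp: dist_real_def field_simps)
          finally show "dist (g t (W n t)) (g t (w t)) < e" by (simp add: dist_real_def)
        qed
      qed
    qed
    have "w t = w0 + integral {0..t} (\<lambda>s. g s (w s))" if t: "t \<in> {0..T}" for t
    proof -
      have "uniform_limit {0..t} (\<lambda>n t. g t (W n t)) (\<lambda>t. g t (w t)) sequentially"
        using t by (intro uniform_limit_on_subset[OF ulg]) auto
      then obtain I J where IJ: "\<And>n. ((\<lambda>s. g s (W n s)) has_integral I n) {0..t}"
        "((\<lambda>s. g s (w s)) has_integral J) {0..t}" "I \<longlonglongrightarrow> J"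
        by (rule uniform_limit_integral[OF _ cgW sequentially_bot]) (rule that)
      have "(\<lambda>n. w0 + I n) \<longlonglongrightarrow> w0 + J" by (intro tendsto_intros IJ)
      moreover have "w0 + I n = W (Suc n) t" for n using integral_unique[OF IJ(1)[of n]] by (simp only: WS)
      moreover have "(\<lambda>n. W (Suc n) t) \<longlonglongrightarrow> w t"
        using tendsto_uniform_limitI[OF ul t] by (rule LIMSEQ_Suc)
      ultimately have "w t = w0 + J" by (simp only: LIMSEQ_unique)
      then show ?thesis using integral_unique[OF IJ(2)] by (simp only:)
    qed
    with ul show ?thesis by blast
  qed
  show thesis
  proof (rule that)
    have "continuous_on {0..T} w" for T
      using main[of T] by (intro uniform_limit_theorem[where f = W]) (auto simp: cW)
    then show "continuous_on {0..} w"
      unfolding continuous_on_eq_continuous_within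
    proof (intro ballI)
      fix t :: real assume c: "\<And>T. \<forall>x\<in>{0..T}. continuous (at x within {0..T}) w" and "t \<in> {0..}"
      then have "continuous (at t within {0..t + 1}) w" by auto
      moreover have "at t within {0..t + 1} = at t within {0..}"
        by (rule at_within_nhd[of _ "{..<t + 1}"]) auto
      ultimately show "continuous (at t within {0..}) w" by simp
    qed
    show "w t = w0 + integral {0..t} (\<lambda>s. g s (w s))" if "t \<ge> 0" for t
      using main[of t] that by auto
  qed
qed

text \<open>Clamping \<xi> to [-R,R] does not change \<open>g\<close>, which vanishes at both ends
  and beyond. The clamp is 1-Lipschitz, and on the compact box the derivative is bounded.\<close>

lemma lipschitz_of_vanishing:
  fixes g g' :: "real \<Rightarrow> real \<Rightarrow> real"
  assumes d: "\<And>t \<xi>. t \<ge> 0 \<Longrightarrow> (g t has_real_derivative g' t \<xi>) (at \<xi>)"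
    and g': "continuous_on ({0..} \<times> UNIV) (\<lambda>(t, \<xi>). g' t \<xi>)"
    and van: "\<And>t \<xi>. 0 \<le> t \<Longrightarrow> t \<le> T \<Longrightarrow> \<bar>\<xi>\<bar> \<ge> M \<Longrightarrow> g t \<xi> = 0"
  shows "\<exists>L. \<forall>t\<in>{0..T}. \<forall>\<xi> \<xi>'. \<bar>g t \<xi> - g t \<xi>'\<bar> \<le> L * \<bar>\<xi> - \<xi>'\<bar>"
proof -
  define R where "R = max M 0"
  define c where "c \<xi> = max (- R) (min R \<xi>)" for \<xi> :: real
  have "compact ((\<lambda>(t, \<xi>). g' t \<xi>) ` ({0..T} \<times> {-R..R}))"
    by (intro compact_continuous_image continuous_on_subset[OF g'] compact_Times) auto
  then obtain L where L: "\<And>t \<xi>. t \<in> {0..T} \<Longrightarrow> \<xi> \<in> {-R..R} \<Longrightarrow> \<bar>g' t \<xi>\<bar> \<le> L"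
    by (fastforce simp: bounded_iff dest: compact_imp_bounded)
  show ?thesis
  proof (intro exI[of _ L] ballI allI)
    fix t \<xi> \<xi>' assume t: "t \<in> {0..T}"
    have gc: "g t \<xi> = g t (c \<xi>)" for \<xi>
    proof (cases "\<xi> \<in> {-R..R}")
      case False
      then have "g t \<xi> = 0" "g t (c \<xi>) = 0"
        using t by (auto intro!: van simp: R_def c_def)
      then show ?thesis by simp
    qed (auto simp: c_def)
    have cR: "c \<xi> \<in> {-R..R}" for \<xi> by (auto simp: c_def R_def)
    have L0: "L \<ge> 0" using L[OF t cR] by (rule order_trans[OF abs_ge_zero])
    have "norm (g t (c \<xi>) - g t (c \<xi>')) \<le> L * norm (c \<xi> - c \<xi>')"
    proof (rule field_differentiable_bound[OF convex_real_interval(5)])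
      fix z assume "z \<in> {-R..R}"
      show "(g t has_real_derivative g' t z) (at z within {- R..R})"
        using d t by (auto intro: has_field_derivative_at_within)
      show "norm (g' t z) \<le> L" using L[OF t \<open>z \<in> {-R..R}\<close>] by simp
    qed (rule cR)+
    also have "\<dots> \<le> L * \<bar>\<xi> - \<xi>'\<bar>"
      using L0 by (intro mult_left_mono) (auto simp: c_def)
    finally show "\<bar>g t \<xi> - g t \<xi>'\<bar> \<le> L * \<bar>\<xi> - \<xi>'\<bar>"
      by (simp add: gc[symmetric])
  qed
qed

section \<open>Continuous and differentiable dependence on parameters\<close>

lemma continuity_bootstrap:
  fixes e :: "real \<Rightarrow> real"
  assumes e: "continuous_on {0..T} e" and e0: "e 0 < 1"
    and step: "\<And>t. t \<in> {0..T} \<Longrightarrow> (\<And>s. s \<in> {0..t} \<Longrightarrow> e s \<le> 1) \<Longrightarrow> e t < 1"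
    and t: "t \<in> {0..T}"
  shows "e t < 1"
proof (rule ccontr)
  assume "\<not> e t < 1"
  then have t1: "1 \<le> e t" by simp
  \<comment> \<open>The closed set of times with e \<ge> 1. At its first element \<open>s0\<close>
    the intermediate value theorem gives \<open>e s0 = 1\<close>; up to then e \<le> 1, so
    \<open>step\<close> yields the contradiction \<open>e s0 < 1\<close>.\<close>
  define Z where "Z = {s \<in> {0..t}. e s \<in> {1..}}"
  have ct: "continuous_on {0..t} e" using t by (auto intro: continuous_on_subset[OF e])
  have "closed Z"
    unfolding Z_def by (rule continuous_closed_preimage[OF ct, unfolded vimage_def Int_def mem_Collect_eq]) auto
  then have "compact Z"
    by (rule compact_eq_bounded_closed[THEN iffD2, OF conjI[rotated]]) (auto simp: Z_def intro: bounded_subset[of "{0..t}"])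
  moreover have "t \<in> Z" using t t1 by (auto simp: Z_def)
  ultimately obtain s0 where s0: "s0 \<in> Z" "\<And>s. s \<in> Z \<Longrightarrow> s0 \<le> s"
    using compact_attains_inf[of Z] by blast
  then have s0': "0 \<le> s0" "s0 \<le> t" "1 \<le> e s0" by (auto simp: Z_def)
  have "\<exists>s\<ge>0. s \<le> s0 \<and> e s = 1"
    using s0' e0 by (intro IVT' continuous_on_subset[OF ct]) auto
  then obtain s where s: "0 \<le> s" "s \<le> s0" "e s = 1" by blast
  then have "s \<in> Z" using s0' by (auto simp: Z_def)
  with s0 s have "e s0 = 1" by fastforce
  have "e r \<le> 1" if "r \<in> {0..s0}" for r
  proof (rule ccontr)
    assume "\<not> e r \<le> 1"
    then have "r \<in> Z" using that s0' by (auto simp: Z_def)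
    with s0 that have "r = s0" by fastforce
    with \<open>e s0 = 1\<close> \<open>\<not> e r \<le> 1\<close> show False by simp
  qed
  with step[of s0] s0' t \<open>e s0 = 1\<close> show False by auto
qed

text \<open>
  Right-hand sides with nearby parameters are close on compact sets only, so the Gronwall estimate
  is first available as long as the two solutions differ by at most 1.
\<close>

lemma ode_param_continuous:
  fixes g :: "'q::topological_space \<Rightarrow> real \<Rightarrow> real \<Rightarrow> real"
  assumes w0: "continuous_on UNIV w0"
    and g: "continuous_on (UNIV \<times> {0..} \<times> UNIV) (\<lambda>(q, t, \<xi>). g q t \<xi>)"
    and lip: "\<And>q T. \<exists>L. \<forall>t\<in>{0..T}. \<forall>\<xi> \<xi>'. \<bar>g q t \<xi> - g q t \<xi>'\<bar> \<le> L * \<bar>\<xi> - \<xi>'\<bar>"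
    and w: "\<And>q. continuous_on {0..} (w q)"
    and weq: "\<And>q t. t \<ge> 0 \<Longrightarrow> w q t = w0 q + integral {0..t} (\<lambda>s. g q s (w q s))"
  shows "continuous_on (UNIV \<times> {0..}) (\<lambda>(q, t). w q t)"
  unfolding continuous_on_def
proof (intro ballI tendstoI)
  fix p :: "'q \<times> real" and e :: real assume p: "p \<in> UNIV \<times> {0..}" and e: "e > 0"
  obtain q0 t0 where p_eq: "p = (q0, t0)" by force
  have t0: "t0 \<ge> 0" using p by (auto simp: p_eq)
  define T where "T = t0 + 1"
  have T: "T > 0" using t0 by (simp add: T_def)
  note cg = continuous_on_curried3[OF g]
  have wT: "continuous_on {0..T} (w q)" for q using w[of q] by (rule continuous_on_subset) auto
  have gT: "continuous_on {0..T} (\<lambda>s. g q s (w q s))" for q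
    by (rule cg) (auto intro!: continuous_intros wT)
  obtain L0 where L0: "\<And>t \<xi> \<xi>'. t \<in> {0..T} \<Longrightarrow> \<bar>g q0 t \<xi> - g q0 t \<xi>'\<bar> \<le> L0 * \<bar>\<xi> - \<xi>'\<bar>"
    using lip[of T q0] by blast
  define L where "L = max L0 0"
  have L: "L \<ge> 0" "\<And>t \<xi> \<xi>'. t \<in> {0..T} \<Longrightarrow> \<bar>g q0 t \<xi> - g q0 t \<xi>'\<bar> \<le> L * \<bar>\<xi> - \<xi>'\<bar>"
    using L0 order_trans[OF L0 mult_right_mono[of L0 L]] by (auto simp: L_def)
  have "compact (w q0 ` {0..T})"
    by (intro compact_continuous_image wT) simp
  then obtain R where R: "\<And>t. t \<in> {0..T} \<Longrightarrow> \<bar>w q0 t\<bar> \<le> R"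
    by (fastforce simp: bounded_iff dest: compact_imp_bounded)
  define K where "K = (1 + T) * exp (L * T)"
  have K: "K > 0" using T by (auto simp: K_def intro!: mult_pos_pos)
  \<comment> \<open>\<open>\<delta> * K\<close> is the final error: below 1 it closes the bootstrap,
    and being at most e/2 it leaves the other half of \<open>e\<close> to the continuity of
    \<open>w q0\<close> in time.\<close>
  define \<delta> where "\<delta> = min (1 / 2) (e / 2) / K"
  have \<delta>: "\<delta> > 0" "\<delta> * K < 1" "\<delta> * K \<le> e / 2" "\<delta> * K \<le> 1 / 2" using K e by (auto simp: \<delta>_def)
  \<comment> \<open>The box exceeds the range of \<open>w q0\<close> by 1, the deviation that
    \<open>est\<close> tolerates; compactness gives one neighbourhood of \<open>q0\<close> for the
    whole box.\<close>
  have "continuous_on (UNIV \<times> ({0..T} \<times> {-(R+1)..R+1})) (\<lambda>(q, t, \<xi>). g q t \<xi>)"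
    by (rule continuous_on_subset[OF g]) auto
  then obtain A where A: "q0 \<in> A" "open A"
    and A': "\<forall>q\<in>A \<inter> UNIV. \<forall>z\<in>{0..T} \<times> {-(R+1)..R+1}. dist ((\<lambda>(q, t, \<xi>). g q t \<xi>) (q, z)) ((\<lambda>(q, t, \<xi>). g q t \<xi>) (q0, z)) \<le> \<delta>"
    by (rule continuous_on_prod_compactE[OF _ compact_Times[OF compact_Icc compact_Icc] UNIV_I \<delta>(1)])
  have A3: "\<bar>g q t \<xi> - g q0 t \<xi>\<bar> \<le> \<delta>" if "q \<in> A" "t \<in> {0..T}" "\<xi> \<in> {-(R+1)..R+1}" for q t \<xi>
    using A'[rule_format, of q "(t, \<xi>)"] that by (simp add: dist_real_def)
  have "(w0 \<longlongrightarrow> w0 q0) (at q0 within UNIV)" using w0 by (simp add: continuous_on_def)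
  from tendstoD[OF this \<open>\<delta> > 0\<close>] obtain B where B: "open B" "q0 \<in> B" "\<And>q. q \<in> B \<Longrightarrow> \<bar>w0 q - w0 q0\<bar> \<le> \<delta>"
    unfolding eventually_at_topological using \<open>\<delta> > 0\<close> by (force simp: dist_real_def)
  have est: "\<bar>w q t - w q0 t\<bar> \<le> \<delta> * K" if q: "q \<in> A \<inter> B" and t: "t \<in> {0..T}"
    and le: "\<And>s. s \<in> {0..t} \<Longrightarrow> \<bar>w q s - w q0 s\<bar> \<le> 1" for q t
  proof -
    have sub: "{0..t} \<subseteq> {0..T}" using t by auto
    have "\<bar>w q t - w q0 t\<bar> \<le> \<delta> * (1 + t) * exp (L * t)"
    proof (rule ode_difference_bound[where g = "g q" and f = "g q0" and ?v0.0 = "w0 q" and ?w0.0 = "w0 q0"])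
      show "continuous_on {0..t} (w q)" "continuous_on {0..t} (w q0)"
        "continuous_on {0..t} (\<lambda>t. g q t (w q t))" "continuous_on {0..t} (\<lambda>t. g q0 t (w q0 t))"
        by (auto intro: continuous_on_subset[OF wT sub] continuous_on_subset[OF gT sub])
      fix s assume s: "s \<in> {0..t}"
      with sub have sT: "s \<in> {0..T}" by blast
      have "w q s \<in> {-(R+1)..R+1}" using le[OF s] R[OF sT] by (auto simp: abs_le_iff)
      with q A3 sT show "\<bar>g q s (w q s) - g q0 s (w q s)\<bar> \<le> \<delta>" by blast
      show "\<bar>g q0 s (w q s) - g q0 s (w q0 s)\<bar> \<le> L * \<bar>w q s - w q0 s\<bar>" by (rule L(2)[OF sT])
    qed (use \<delta> L q B t weq in auto)
    also have "\<dots> \<le> \<delta> * (1 + T) * exp (L * T)"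
    proof -
      have "L * t \<le> L * T" using t L(1) by (intro mult_left_mono) auto
      then show ?thesis using t \<delta>(1) by (intro mult_mono mult_left_mono) auto
    qed
    finally show ?thesis by (simp add: K_def mult.assoc)
  qed
  have close: "\<bar>w q t - w q0 t\<bar> \<le> \<delta> * K" if q: "q \<in> A \<inter> B" and t: "t \<in> {0..T}" for q t
  proof (rule est[OF q t])
    fix s assume s: "s \<in> {0..t}"
    have "\<bar>w q s - w q0 s\<bar> < 1"
    proof (rule continuity_bootstrap[of T "\<lambda>s. \<bar>w q s - w q0 s\<bar>"])
      show "continuous_on {0..T} (\<lambda>s. \<bar>w q s - w q0 s\<bar>)" by (intro continuous_intros wT)
      have "1 * 1 \<le> K" unfolding K_def using T L by (intro mult_mono) auto
      then have "\<delta> \<le> \<delta> * K" using \<delta>(1) by simp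
      then show "\<bar>w q 0 - w q0 0\<bar> < 1" using weq[of 0 q] weq[of 0 q0] B(3)[of q] q \<delta>(2) by simp
      fix t assume "t \<in> {0..T}" "\<And>s. s \<in> {0..t} \<Longrightarrow> \<bar>w q s - w q0 s\<bar> \<le> 1"
      from est[OF q this] \<delta>(2) show "\<bar>w q t - w q0 t\<bar> < 1" by simp
    qed (use s t in auto)
    then show "\<bar>w q s - w q0 s\<bar> \<le> 1" by simp
  qed
  have "(w q0 \<longlongrightarrow> w q0 t0) (at t0 within {0..})" using w[of q0] t0 by (simp add: continuous_on_def)
  from tendstoD[OF this, of "e / 2"] e obtain C where C: "open C" "t0 \<in> C" "\<And>t. t \<in> C \<Longrightarrow> t \<ge> 0 \<Longrightarrow> \<bar>w q0 t - w q0 t0\<bar> < e / 2"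
    unfolding eventually_at_topological by (force simp: dist_real_def)
  show "\<forall>\<^sub>F x in at p within UNIV \<times> {0..}. dist (case x of (q, t) \<Rightarrow> w q t) (case p of (q, t) \<Rightarrow> w q t) < e"
    unfolding eventually_at_topological
  proof (intro exI[of _ "(A \<inter> B) \<times> (C \<inter> {..<T})"] conjI ballI impI)
    show "open ((A \<inter> B) \<times> (C \<inter> {..<T}))" using A B C by (intro open_Times open_Int) auto
    show "p \<in> (A \<inter> B) \<times> (C \<inter> {..<T})" using A B C by (auto simp: p_eq T_def)
    fix x assume x: "x \<in> (A \<inter> B) \<times> (C \<inter> {..<T})" "x \<in> UNIV \<times> {0..}"
    obtain q t where x_eq: "x = (q, t)" by force
    have "\<bar>w q t - w q0 t\<bar> \<le> e / 2" using close[of q t] x \<delta>(3) by (auto simp: x_eq)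
    moreover have "\<bar>w q0 t - w q0 t0\<bar> < e / 2" using C(3)[of t] x by (auto simp: x_eq)
    ultimately show "dist (case x of (q, t) \<Rightarrow> w q t) (case p of (q, t) \<Rightarrow> w q t) < e"
      unfolding x_eq p_eq dist_real_def case_prod_conv by arith
  qed
qed

text \<open>Differentiability of \<open>W\<close> is a conclusion: the increment from 0 to
  \<open>h\<close> solves a linear equation in which the data carry the factor \<open>h\<close>. The
  solution formula pulls this factor out, and what remains is continuous in
  \<open>h\<close>.\<close>

lemma ode_param_derivative:
  fixes G Gh G\<xi> :: "real \<Rightarrow> real \<Rightarrow> real \<Rightarrow> real"
  assumes w0: "\<And>h. (w0 has_real_derivative w0' h) (at h)" "continuous_on UNIV w0'"
    and G: "continuous_on (UNIV \<times> {0..} \<times> UNIV) (\<lambda>(h, s, \<xi>). G h s \<xi>)"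
    and Gh: "\<And>h s \<xi>. s \<ge> 0 \<Longrightarrow> ((\<lambda>h. G h s \<xi>) has_real_derivative Gh h s \<xi>) (at h)"
      "continuous_on (UNIV \<times> {0..} \<times> UNIV) (\<lambda>(h, s, \<xi>). Gh h s \<xi>)"
    and G\<xi>: "\<And>h s \<xi>. s \<ge> 0 \<Longrightarrow> (G h s has_real_derivative G\<xi> h s \<xi>) (at \<xi>)"
      "continuous_on (UNIV \<times> {0..} \<times> UNIV) (\<lambda>(h, s, \<xi>). G\<xi> h s \<xi>)"
    and W: "continuous_on (UNIV \<times> {0..}) (\<lambda>(h, s). W h s)"
    and Weq: "\<And>h s. s \<ge> 0 \<Longrightarrow> W h s = w0 h + integral {0..s} (\<lambda>r. G h r (W h r))"
    and t: "t \<ge> 0"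
  shows "((\<lambda>h. W h t) has_real_derivative exp (integral {0..t} (\<lambda>s. G\<xi> 0 s (W 0 s))) *
    (w0' 0 + integral {0..t} (\<lambda>s. exp (- integral {0..s} (\<lambda>r. G\<xi> 0 r (W 0 r))) * Gh 0 s (W 0 s)))) (at 0)"
proof -
  note cW = continuous_on_curried2[OF W]
  note cG = continuous_on_curried3[OF G] and cGh = continuous_on_curried3[OF Gh(2)] and cG\<xi> = continuous_on_curried3[OF G\<xi>(2)]
  \<comment> \<open>The increment of \<open>G\<close> is split at \<open>G h s (W 0 s)\<close>:
    \<open>A\<close> averages the \<xi>-derivative at step \<open>h\<close>, \<open>B\<close>
    averages the h-derivative at the unperturbed value \<open>W 0 s\<close>. The shape
    \<open>0 + r * (h - 0)\<close> is \<open>hadamard\<close> on the segment from 0 to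
    \<open>h\<close>.\<close>
  define A where "A h s = integral {0..1} (\<lambda>r. G\<xi> h s (W 0 s + r * (W h s - W 0 s)))" for h s
  define B where "B h s = integral {0..1} (\<lambda>r. Gh (0 + r * (h - 0)) s (W 0 s))" for h s
  define c where "c h = integral {0..1} (\<lambda>r. w0' (0 + r * (h - 0)))" for h
  \<comment> \<open>\<open>Z h\<close> is the difference quotient of \<open>W\<close> for \<open>h \<noteq> 0\<close>, written so that it makes sense at \<open>h = 0\<close>.\<close>
  define Z where "Z h = exp (integral {0..t} (A h)) * (c h + integral {0..t} (\<lambda>s. exp (- integral {0..s} (A h)) * B h s))" for h
  have A: "continuous_on (UNIV \<times> {0..}) (\<lambda>p. A (fst p) (snd p))"
    unfolding A_def
    by (rule continuous_on_integral_param, unfold case_prod_unfold) (auto intro!: continuous_intros cG\<xi> cW)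
  have B: "continuous_on (UNIV \<times> {0..}) (\<lambda>p. B (fst p) (snd p))"
    unfolding B_def
    by (rule continuous_on_integral_param, unfold case_prod_unfold) (auto intro!: continuous_intros cGh cW)
  have A': "continuous_on (UNIV \<times> {0..}) (\<lambda>(h, s). A h s)" and B': "continuous_on (UNIV \<times> {0..}) (\<lambda>(h, s). B h s)"
    using A B by (simp_all add: case_prod_unfold)
  note cA = continuous_on_curried2[OF A'] and cB = continuous_on_curried2[OF B']
  have c: "continuous_on UNIV c"
    unfolding c_def
    by (rule continuous_on_integral_param, unfold case_prod_unfold) (auto intro!: continuous_intros continuous_on_compose2[OF w0(2)])
  have "continuous_on (UNIV \<times> {0..}) (\<lambda>p. integral {0..snd p} (A (fst p)))"
    by (rule continuous_on_integral_upto)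
      (auto intro!: continuous_intros cA simp: case_prod_unfold)
  then have IA': "continuous_on (UNIV \<times> {0..}) (\<lambda>(h, s). integral {0..s} (A h))"
    by (simp add: case_prod_unfold)
  note cIA = continuous_on_curried2[OF IA']
  have "continuous_on UNIV (\<lambda>h. integral {0..t} (\<lambda>s. exp (- integral {0..s} (A h)) * B h s))"
    by (rule continuous_on_integral_param, unfold case_prod_unfold) (auto intro!: continuous_intros cIA cB)
  then have "continuous_on UNIV Z"
    unfolding Z_def using t by (auto intro!: continuous_intros c cIA)
  then have Z: "isCont Z 0" by (simp add: continuous_on_eq_continuous_at)
  have "W h t - W 0 t = (h - 0) * Z h" for h
  proof -
    define D where "D s = W h s - W 0 s" for s
    have D: "continuous_on {0..} D" unfolding D_def by (auto intro!: continuous_intros cW)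
    have Geq: "G h s (W h s) - G 0 s (W 0 s) = A h s * D s + h * B h s" if s: "s \<ge> 0" for s
    proof -
      have "G h s (W h s) - G h s (W 0 s) = D s * A h s"
        unfolding D_def A_def by (rule hadamard[OF G\<xi>(1)[OF s]])
      moreover have "G h s (W 0 s) - G 0 s (W 0 s) = (h - 0) * B h s"
        unfolding B_def by (rule hadamard[of 0 h "\<lambda>h. G h s (W 0 s)", OF Gh(1)[OF s]])
      ultimately show ?thesis by (simp add: algebra_simps)
    qed
    have weq: "w0 h - w0 0 = (h - 0) * c h"
      unfolding c_def by (rule hadamard[OF w0(1)])
    have Deq: "D s = h * c h + integral {0..s} (\<lambda>r. A h r * D r + h * B h r)" if s: "s \<ge> 0" for s
    proof -
      have i: "(\<lambda>r. G k r (W k r)) integrable_on {0..s}" for k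
        by (auto intro!: integrable_continuous_real cG cW continuous_intros)
      have "D s = (w0 h - w0 0) + integral {0..s} (\<lambda>r. G h r (W h r) - G 0 r (W 0 r))"
        unfolding D_def using Weq[OF s, of h] Weq[OF s, of 0] i[of h] i[of 0] by (simp add: integral_diff)
      also have "integral {0..s} (\<lambda>r. G h r (W h r) - G 0 r (W 0 r)) = integral {0..s} (\<lambda>r. A h r * D r + h * B h r)"
        by (rule integral_cong) (simp add: Geq)
      finally show ?thesis using weq by simp
    qed
    have "D t = exp (integral {0..t} (A h)) * (h * c h + integral {0..t} (\<lambda>s. exp (- integral {0..s} (A h)) * (h * B h s)))"
      by (rule linear_ode_solution[where b = "\<lambda>s. h * B h s", OF t])
        (auto intro!: cA cB continuous_intros continuous_on_subset[OF D] Deq)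
    also have "(\<lambda>s. exp (- integral {0..s} (A h)) * (h * B h s)) = (\<lambda>s. h * (exp (- integral {0..s} (A h)) * B h s))"
      by (simp add: mult_ac)
    finally show ?thesis by (simp add: D_def Z_def algebra_simps)
  qed
  from has_real_derivative_factor[OF this Z]
  show ?thesis by (simp add: Z_def A_def[abs_def] B_def[abs_def] c_def)
qed

section \<open>Differentiability along flows\<close>

datatype 'i dir = Dt | Dx | Dp 'i

text \<open>The parameters form a mere topological space; the orbits of a flow take the place of
  lines in the directions \<open>Dp i\<close>.\<close>

fun move :: "('i \<Rightarrow> real \<Rightarrow> 'p \<Rightarrow> 'p) \<Rightarrow> 'i dir \<Rightarrow> real \<Rightarrow> 'p \<times> real \<times> real \<Rightarrow> 'p \<times> real \<times> real"
  where "move fl Dt h (p, t, x) = (p, t + h, x)"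
  | "move fl Dx h (p, t, x) = (p, t, x + h)"
  | "move fl (Dp i) h (p, t, x) = (fl i h p, t, x)"

abbreviation nonneg_time :: "('p \<times> real \<times> real) set"
  where "nonneg_time \<equiv> UNIV \<times> {0..} \<times> UNIV"

definition has_dir_deriv :: "('i \<Rightarrow> real \<Rightarrow> 'p \<Rightarrow> 'p) \<Rightarrow> 'i dir \<Rightarrow> ('p \<times> real \<times> real \<Rightarrow> real) \<Rightarrow> ('p \<times> real \<times> real \<Rightarrow> real) \<Rightarrow> bool"
  where "has_dir_deriv fl d g g' \<longleftrightarrow>
    (\<forall>p t x. t > 0 \<longrightarrow> ((\<lambda>h. g (move fl d h (p, t, x))) has_real_derivative g' (p, t, x)) (at 0))"

lemma has_dir_derivI:
  assumes "\<And>p t x. t > 0 \<Longrightarrow> ((\<lambda>h. g (move fl d h (p, t, x))) has_real_derivative g' (p, t, x)) (at 0)"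
  shows "has_dir_deriv fl d g g'"
  using assms by (simp add: has_dir_deriv_def)

lemma has_dir_derivD:
  assumes "has_dir_deriv fl d g g'" "t > 0"
  shows "((\<lambda>h. g (move fl d h (p, t, x))) has_real_derivative g' (p, t, x)) (at 0)"
  using assms by (simp add: has_dir_deriv_def)

text \<open>
  Directional derivatives are only required at positive times, but both the function and its
  derivatives have to be continuous up to \<open>t = 0\<close>; this is the convention of \<^const>\<open>C_fun\<close>.
\<close>

primrec Ck :: "('i \<Rightarrow> real \<Rightarrow> 'p \<Rightarrow> 'p) \<Rightarrow> nat \<Rightarrow> ('p::topological_space \<times> real \<times> real \<Rightarrow> real) \<Rightarrow> bool"
  where "Ck fl 0 g \<longleftrightarrow> continuous_on nonneg_time g"
  | "Ck fl (Suc k) g \<longleftrightarrow> continuous_on nonneg_time g \<and> (\<forall>d. \<exists>g'. has_dir_deriv fl d g g' \<and> Ck fl k g')"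

lemma Ck_continuous: "Ck fl k g \<Longrightarrow> continuous_on nonneg_time g"
  by (cases k) auto

lemma Ck_SucD: "Ck fl (Suc k) g \<Longrightarrow> Ck fl k g"
proof (induction k arbitrary: g)
  case (Suc k)
  show ?case
    unfolding Ck.simps(2)[of fl k]
  proof (intro conjI allI)
    fix d
    from Suc.prems obtain g' where "has_dir_deriv fl d g g'" "Ck fl (Suc k) g'"
      unfolding Ck.simps(2)[of fl "Suc k"] by blast
    with Suc.IH show "\<exists>g'. has_dir_deriv fl d g g' \<and> Ck fl k g'" by blast
  qed (use Suc.prems Ck_continuous in blast)
qed simp

lemma move_time_pos:
  assumes "t > 0"
  shows "\<forall>\<^sub>F h in nhds 0. 0 < fst (snd (move fl d h (p, t, x)))"
proof -
  have "\<forall>\<^sub>F h in nhds 0. h \<in> {-t<..}"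
    by (rule eventually_nhds_in_open) (use assms in auto)
  then show ?thesis
    by eventually_elim (use assms in \<open>cases d; auto\<close>)
qed

lemma move_zero_time: "d \<noteq> Dt \<Longrightarrow> fst (snd (move fl d h q)) = fst (snd q)"
  by (cases d; cases q) auto

lemma has_dir_deriv_cong:
  assumes "has_dir_deriv fl d g g'" and eq: "\<And>q. q \<in> nonneg_time \<Longrightarrow> f q = g q" "\<And>q. q \<in> nonneg_time \<Longrightarrow> f' q = g' q"
  shows "has_dir_deriv fl d f f'"
proof (rule has_dir_derivI)
  fix p t x assume t: "(t::real) > 0"
  have "\<forall>\<^sub>F h in nhds 0. f (move fl d h (p, t, x)) = g (move fl d h (p, t, x))"
    using move_time_pos[OF t, of fl d p x]
    by eventually_elim (auto intro!: eq simp: mem_Times_iff)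
  then show "((\<lambda>h. f (move fl d h (p, t, x))) has_real_derivative f' (p, t, x)) (at 0)"
    using has_dir_derivD[OF assms(1) t, of p x] t DERIV_cong_ev[OF refl _ refl, of "\<lambda>h. f (move fl d h (p, t, x))"
      "\<lambda>h. g (move fl d h (p, t, x))" 0 "f' (p, t, x)"]
    by (simp add: eq)
qed

lemma Ck_cong:
  assumes eq: "\<And>q. q \<in> nonneg_time \<Longrightarrow> f q = g q" and g: "Ck fl k g"
  shows "Ck fl k f"
proof -
  have c: "continuous_on nonneg_time f"
    by (rule continuous_on_eq[OF Ck_continuous[OF g]]) (rule eq[symmetric])
  show ?thesis
  proof (cases k)
    case (Suc l)
    have "\<exists>f'. has_dir_deriv fl d f f' \<and> Ck fl l f'" for d
    proof -
      from g obtain g' where g': "has_dir_deriv fl d g g'" "Ck fl l g'" unfolding Suc Ck.simps(2) by blast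
      have "has_dir_deriv fl d f g'" by (rule has_dir_deriv_cong[OF g'(1) eq refl])
      with g' show ?thesis by blast
    qed
    with c show ?thesis unfolding Suc Ck.simps(2) by blast
  qed (simp add: c)
qed

text \<open>At t = 0 two candidates agree as limits from positive times. Uniqueness identifies the
  witnesses that \<open>Ck\<close> provides separately for each order, so that one derivative serves
  all orders.\<close>

lemma has_dir_deriv_unique:
  assumes "has_dir_deriv fl d g f" "has_dir_deriv fl d g f'"
    and "continuous_on nonneg_time f" "continuous_on nonneg_time f'" and "q \<in> nonneg_time"
  shows "f q = f' q"
proof -
  obtain p t x where q: "q = (p, t, x)" by (metis prod_cases3)
  have "f (p, t, x) - f' (p, t, x) = 0"
  proof (rule continuous_constant_on_closure[of "{0<..}" "\<lambda>t. f (p, t, x) - f' (p, t, x)"])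
    show "continuous_on (closure {0<..}) (\<lambda>t. f (p, t, x) - f' (p, t, x))"
      by (auto intro!: continuous_intros continuous_on_compose2[OF assms(3)] continuous_on_compose2[OF assms(4)])
    show "f (p, t, x) - f' (p, t, x) = 0" if "t \<in> {0<..}" for t
      using DERIV_unique[OF has_dir_derivD[OF assms(1)] has_dir_derivD[OF assms(2)]] that by simp
    show "t \<in> closure {0<..}" using assms(5) by (simp add: q)
  qed
  then show ?thesis by (simp add: q)
qed

section \<open>Operations that preserve the class \<open>Ck\<close>\<close>

lemma Ck_const: "Ck fl k (\<lambda>_. c)"
proof (induction k arbitrary: c)
  case (Suc k)
  have "has_dir_deriv fl d (\<lambda>_. c) (\<lambda>_. 0)" for d by (rule has_dir_derivI) simp
  with Suc[of 0] show ?case by auto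
qed simp

lemma has_dir_deriv_add:
  assumes "has_dir_deriv fl d f f'" "has_dir_deriv fl d g g'"
  shows "has_dir_deriv fl d (\<lambda>q. f q + g q) (\<lambda>q. f' q + g' q)"
proof (rule has_dir_derivI)
  fix p t x assume t: "(t::real) > 0"
  show "((\<lambda>h. f (move fl d h (p, t, x)) + g (move fl d h (p, t, x))) has_real_derivative f' (p, t, x) + g' (p, t, x)) (at 0)"
    by (rule DERIV_add[OF has_dir_derivD[OF assms(1) t] has_dir_derivD[OF assms(2) t]])
qed

lemma Ck_add:
  assumes "Ck fl k f" "Ck fl k g"
  shows "Ck fl k (\<lambda>q. f q + g q)"
  using assms
proof (induction k arbitrary: f g)
  case (Suc k)
  show ?case
    unfolding Ck.simps(2)
  proof (intro conjI allI)
    fix d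
    from Suc.prems obtain f' g' where "has_dir_deriv fl d f f'" "Ck fl k f'" "has_dir_deriv fl d g g'" "Ck fl k g'"
      unfolding Ck.simps(2) by blast
    with Suc.IH[of f' g'] show "\<exists>h. has_dir_deriv fl d (\<lambda>q. f q + g q) h \<and> Ck fl k h"
      by (intro exI[of _ "\<lambda>q. f' q + g' q"]) (simp add: has_dir_deriv_add)
  qed (use Suc.prems in \<open>auto intro: continuous_intros\<close>)
qed (auto intro: continuous_intros)

text \<open>Integration along the characteristic of unit speed that ends at (t, x): the solution
  with zero initial values of the transport equation with right-hand side \<open>g\<close>.\<close>

definition time_integral :: "('p \<times> real \<times> real \<Rightarrow> real) \<Rightarrow> 'p \<times> real \<times> real \<Rightarrow> real"
  where "time_integral g = (\<lambda>(p, t, x). integral {0..t} (\<lambda>s. g (p, s, x - t + s)))"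

fun lift_flow :: "('i \<Rightarrow> real \<Rightarrow> 'p \<Rightarrow> 'p) \<Rightarrow> 'i option \<Rightarrow> real \<Rightarrow> 'p \<times> real \<Rightarrow> 'p \<times> real"
  where "lift_flow fl None h (p, \<xi>) = (p, \<xi> + h)"
  | "lift_flow fl (Some i) h (p, \<xi>) = (fl i h p, \<xi>)"

primrec lift_dir :: "'i dir \<Rightarrow> 'i option dir"
  where "lift_dir Dt = Dt" | "lift_dir Dx = Dx" | "lift_dir (Dp i) = Dp (Some i)"

text \<open>
  A right-hand side \<open>\<phi>(t, x, \<xi>)\<close> is treated as a function on the same kind of domain with \<open>\<xi>\<close> as an
  additional parameter; \<open>Dp None\<close> is differentiation in \<open>\<xi>\<close>.
\<close>

definition superpose :: "(('p \<times> real) \<times> real \<times> real \<Rightarrow> real) \<Rightarrow> ('p \<times> real \<times> real \<Rightarrow> real) \<Rightarrow> 'p \<times> real \<times> real \<Rightarrow> real"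
  where "superpose \<Phi> y = (\<lambda>(p, t, x). \<Phi> ((p, y (p, t, x)), t, x))"

text \<open>The group law transports a derivative at h = 0 to every h; continuity of the orbits
  makes these derivatives continuous in h, as the mean value formulas require.\<close>

locale flows =
  fixes fl :: "'i \<Rightarrow> real \<Rightarrow> 'p::topological_space \<Rightarrow> 'p"
  assumes flow_0 [simp]: "fl i 0 p = p"
    and flow_add: "fl i (h + k) p = fl i h (fl i k p)"
    and flow_continuous: "continuous_on UNIV (\<lambda>h. fl i h p)"
begin

lemma move_0 [simp]: "move fl d 0 q = q"
  by (cases d; cases q) auto

lemma move_add: "move fl d (h + k) q = move fl d h (move fl d k q)"
  by (cases d; cases q) (auto simp: flow_add)

lemma continuous_on_flow: "continuous_on A h \<Longrightarrow> continuous_on A (\<lambda>z. fl i (h z) p)"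
  by (rule continuous_on_compose2[OF flow_continuous]) auto

lemma continuous_on_move:
  assumes "continuous_on A h" "continuous_on A t" "continuous_on A x"
  shows "continuous_on A (\<lambda>z. move fl d (h z) (p, t z, x z))"
  by (cases d) (auto intro!: continuous_intros continuous_on_flow assms)

lemma continuous_on_along:
  assumes g: "continuous_on nonneg_time g" and c: "continuous_on A h" "continuous_on A t" "continuous_on A x"
    and pos: "\<And>z. z \<in> A \<Longrightarrow> 0 \<le> fst (snd (move fl d (h z) (p, t z, x z)))"
  shows "continuous_on A (\<lambda>z. g (move fl d (h z) (p, t z, x z)))"
  by (rule continuous_on_compose2[OF g continuous_on_move[OF c]]) (intro image_subsetI, simp add: mem_Times_iff pos)

lemma has_dir_deriv_along:
  assumes "has_dir_deriv fl d g g'" "0 < fst (snd (move fl d s q))"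
  shows "((\<lambda>h. g (move fl d h q)) has_real_derivative g' (move fl d s q)) (at s)"
proof -
  obtain p t x where m: "move fl d s q = (p, t, x)" by (metis prod_cases3)
  have "((\<lambda>h. g (move fl d (h + s) q)) has_real_derivative g' (p, t, x)) (at 0)"
    using has_dir_derivD[OF assms(1), of t p x] assms(2) m by (simp add: move_add)
  then show ?thesis
    using DERIV_shift[of "\<lambda>h. g (move fl d h q)" "g' (p, t, x)" 0 s] m by simp
qed

lemma has_dir_deriv_boundary:
  assumes d: "has_dir_deriv fl d g g'" and g: "continuous_on nonneg_time g" and g': "continuous_on nonneg_time g'"
    and dt: "d \<noteq> Dt" and t: "t \<ge> 0"
  shows "((\<lambda>h. g (move fl d h (p, t, x))) has_real_derivative g' (move fl d s (p, t, x))) (at s)"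
proof (rule has_real_derivative_boundary[of "\<lambda>t h. g (move fl d h (p, t, x))" "\<lambda>t h. g' (move fl d h (p, t, x))", OF _ _ _ t])
  show "((\<lambda>h. g (move fl d h (p, t, x))) has_real_derivative g' (move fl d h (p, t, x))) (at h)" if "t > 0" for t h
    by (rule has_dir_deriv_along[OF d]) (use that dt in \<open>simp add: move_zero_time\<close>)
  show "continuous_on ({0..} \<times> UNIV) (\<lambda>(t, h). g (move fl d h (p, t, x)))"
    "continuous_on ({0..} \<times> UNIV) (\<lambda>(t, h). g' (move fl d h (p, t, x)))"
    unfolding case_prod_unfold
    by (intro continuous_on_along[OF g] continuous_on_along[OF g'] continuous_intros; use dt in \<open>auto simp: move_zero_time\<close>)+
qed

lemma has_dir_deriv_mult:
  assumes "has_dir_deriv fl d f f'" "has_dir_deriv fl d g g'"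
  shows "has_dir_deriv fl d (\<lambda>q. f q * g q) (\<lambda>q. f' q * g q + g' q * f q)"
proof (rule has_dir_derivI)
  fix p t x assume "(t::real) > 0"
  from DERIV_mult[OF has_dir_derivD[OF assms(1) this] has_dir_derivD[OF assms(2) this], of p x p x]
  show "((\<lambda>h. f (move fl d h (p, t, x)) * g (move fl d h (p, t, x))) has_real_derivative
      f' (p, t, x) * g (p, t, x) + g' (p, t, x) * f (p, t, x)) (at 0)" by simp
qed

lemma has_dir_deriv_exp:
  assumes "has_dir_deriv fl d f f'"
  shows "has_dir_deriv fl d (\<lambda>q. exp (f q)) (\<lambda>q. exp (f q) * f' q)"
proof (rule has_dir_derivI)
  fix p t x assume "(t::real) > 0"
  from DERIV_fun_exp[OF has_dir_derivD[OF assms this], of p x]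
  show "((\<lambda>h. exp (f (move fl d h (p, t, x)))) has_real_derivative exp (f (p, t, x)) * f' (p, t, x)) (at 0)" by simp
qed

lemma Ck_mult:
  assumes "Ck fl k f" "Ck fl k g"
  shows "Ck fl k (\<lambda>q. f q * g q)"
  using assms
proof (induction k arbitrary: f g)
  case (Suc k)
  show ?case
    unfolding Ck.simps(2)
  proof (intro conjI allI)
    fix d
    from Suc.prems obtain f' g' where "has_dir_deriv fl d f f'" "Ck fl k f'" "has_dir_deriv fl d g g'" "Ck fl k g'"
      unfolding Ck.simps(2) by blast
    then show "\<exists>h. has_dir_deriv fl d (\<lambda>q. f q * g q) h \<and> Ck fl k h"
      using Suc.prems[THEN Ck_SucD]
      by (intro exI[of _ "\<lambda>q. f' q * g q + g' q * f q"] conjI has_dir_deriv_mult Ck_add Suc.IH)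
  qed (use Suc.prems in \<open>auto intro: continuous_intros\<close>)
qed (auto intro: continuous_intros)

lemma Ck_minus: "Ck fl k f \<Longrightarrow> Ck fl k (\<lambda>q. - f q)"
  using Ck_mult[OF Ck_const[of fl k "-1"], of f] by simp

lemma Ck_diff: "Ck fl k f \<Longrightarrow> Ck fl k g \<Longrightarrow> Ck fl k (\<lambda>q. f q - g q)"
  using Ck_add[of fl k f "\<lambda>q. - g q"] Ck_minus by simp

lemma Ck_exp:
  assumes "Ck fl k f"
  shows "Ck fl k (\<lambda>q. exp (f q))"
  using assms
proof (induction k)
  case (Suc k)
  show ?case
    unfolding Ck.simps(2)
  proof (intro conjI allI)
    fix d
    from Suc.prems obtain f' where "has_dir_deriv fl d f f'" "Ck fl k f'"
      unfolding Ck.simps(2) by blast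
    then show "\<exists>h. has_dir_deriv fl d (\<lambda>q. exp (f q)) h \<and> Ck fl k h"
      using Ck_SucD[OF Suc.prems]
      by (intro exI[of _ "\<lambda>q. exp (f q) * f' q"] conjI has_dir_deriv_exp Ck_mult Suc.IH)
  qed (use Suc.prems in \<open>auto intro: continuous_intros\<close>)
qed (auto intro: continuous_intros)

lemma continuous_time_integral:
  assumes "continuous_on nonneg_time g"
  shows "continuous_on nonneg_time (time_integral g :: 'p \<times> _ \<Rightarrow> real)"
  unfolding time_integral_def case_prod_unfold
  by (rule continuous_on_integral_upto)
    (auto intro!: continuous_intros continuous_on_compose2[OF assms] simp: case_prod_unfold)

text \<open>Moving the end point in a direction other than time moves the whole characteristic in
  the same way, so Leibniz' rule applies; the integrand at s = 0 needs the boundary version of the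
  derivative.\<close>

lemma has_dir_deriv_time_integral:
  assumes d: "has_dir_deriv fl d g g'" and g: "continuous_on nonneg_time g" and g': "continuous_on nonneg_time g'" and dt: "d \<noteq> Dt"
  shows "has_dir_deriv fl d (time_integral g) (time_integral g')"
proof (rule has_dir_derivI)
  fix p t x assume t: "(t::real) > 0"
  have "((\<lambda>h. integral (cbox 0 t) (\<lambda>s. g (move fl d h (p, s, x - t + s)))) has_real_derivative
      integral (cbox 0 t) (\<lambda>s. g' (move fl d 0 (p, s, x - t + s)))) (at 0 within UNIV)"
  proof (rule leibniz_rule_field_derivative)
    show "((\<lambda>h. g (move fl d h (p, s, x - t + s))) has_real_derivative g' (move fl d h (p, s, x - t + s))) (at h within UNIV)"
      if "s \<in> cbox 0 t" for h s
      using has_dir_deriv_boundary[OF d g g' dt, of s p "x - t + s" h] that by simp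
    show "(\<lambda>s. g (move fl d h (p, s, x - t + s))) integrable_on cbox 0 t" for h
      by (intro integrable_continuous continuous_on_along[OF g] continuous_intros)
        (use dt in \<open>auto simp: move_zero_time\<close>)
    show "continuous_on (UNIV \<times> cbox 0 t) (\<lambda>(h, s). g' (move fl d h (p, s, x - t + s)))"
      unfolding case_prod_unfold
      by (intro continuous_on_along[OF g'] continuous_intros) (use dt in \<open>auto simp: move_zero_time\<close>)
  qed auto
  moreover have "time_integral g (move fl d h (p, t, x)) = integral (cbox 0 t) (\<lambda>s. g (move fl d h (p, s, x - t + s)))" for h
    using dt by (cases d) (auto simp: time_integral_def algebra_simps)
  ultimately show "((\<lambda>h. time_integral g (move fl d h (p, t, x))) has_real_derivative time_integral g' (p, t, x)) (at 0)"
    by (simp add: time_integral_def)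
qed

text \<open>The transport equation for \<open>time_integral\<close>. In \<open>H\<close> the two
  roles of time are separated: the first argument shifts the characteristic, the second moves the
  upper limit; the chain rule on the diagonal adds both effects.\<close>

lemma has_dir_deriv_time_integral_Dt:
  assumes d: "has_dir_deriv fl Dx g g'" and g: "continuous_on nonneg_time g" and g': "continuous_on nonneg_time g'"
  shows "has_dir_deriv fl Dt (time_integral g) (\<lambda>q. g q - time_integral g' q)"
proof (rule has_dir_derivI)
  fix p t x assume t: "(t::real) > 0"
  define H where "H h \<xi> = integral {0..t + \<xi>} (\<lambda>s. g (p, s, x - t - h + s))" for h \<xi>
  define H' where "H' h \<xi> = g (p, t + \<xi>, x - t - h + (t + \<xi>))" for h \<xi>
  have "((\<lambda>h. H h h) has_real_derivative (time_integral g' (p, t, x) * (-1)) + H' 0 0 * 1) (at 0)"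
  proof (rule has_real_derivative_compose2[where H = H and H' = H' and y = "\<lambda>h. h"])
    have D: "((\<lambda>h. time_integral g (p, t, x + h)) has_real_derivative time_integral g' (p, t, x)) (at (-0))"
      using has_dir_derivD[OF has_dir_deriv_time_integral[OF d g g'] t, of p x] by simp
    have "((\<lambda>h. time_integral g (p, t, x + (- h))) has_real_derivative time_integral g' (p, t, x) * (-1)) (at 0)"
      by (rule DERIV_chain2[where f = "\<lambda>h. time_integral g (p, t, x + h)" and g = "\<lambda>h. - h"], rule D)
        (auto intro!: derivative_eq_intros)
    then show "((\<lambda>h. H h 0) has_real_derivative time_integral g' (p, t, x) * (-1)) (at 0)"
      by (simp add: H_def time_integral_def algebra_simps)
    have pos: "\<forall>\<^sub>F \<xi> in nhds 0. - t < \<xi>"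
      using eventually_nhds_in_open[of "{-t<..}" 0] t by auto
    have "(H h has_real_derivative H' h \<xi>) (at \<xi>)" if \<xi>: "- t < \<xi>" for h \<xi>
    proof -
      \<comment> \<open>The extra unit makes t + \<xi> an interior point, so the one-sided
        derivative of the integral is two-sided.\<close>
      have "continuous_on {0..t + \<xi> + 1} (\<lambda>s. g (p, s, x - t - h + s))"
        by (intro continuous_on_compose2[OF g] continuous_intros) auto
      from integral_has_real_derivative[OF this, of "t + \<xi>"] \<xi>
      have "((\<lambda>r. integral {0..r} (\<lambda>s. g (p, s, x - t - h + s))) has_real_derivative H' h \<xi>) (at (t + \<xi>) within {0..t + \<xi> + 1})"
        by (simp add: H'_def)
      moreover have "at (t + \<xi>) within {0..t + \<xi> + 1} = at (t + \<xi>)"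
        using \<xi> by (intro at_within_Icc_at) auto
      ultimately have "((\<lambda>r. integral {0..r} (\<lambda>s. g (p, s, x - t - h + s))) has_real_derivative H' h \<xi>) (at (t + \<xi>))"
        by simp
      then show ?thesis
        using DERIV_shift[of "\<lambda>r. integral {0..r} (\<lambda>s. g (p, s, x - t - h + s))" "H' h \<xi>" \<xi> t] 
        by (simp add: H_def[abs_def] add.commute)
    qed
    then show "\<forall>\<^sub>F (h, \<xi>) in at 0 \<times>\<^sub>F nhds 0. (H h has_real_derivative H' h \<xi>) (at \<xi>)"
      unfolding eventually_prod_filter
      by (intro exI[of _ "\<lambda>_. True"] exI[of _ "\<lambda>\<xi>. - t < \<xi>"]) (use pos in auto)
    have c: "continuous_on (UNIV \<times> {-t<..}) (\<lambda>(h, \<xi>). H' h \<xi>)"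
      unfolding H'_def case_prod_unfold by (intro continuous_on_compose2[OF g] continuous_intros) auto
    then show "isCont (\<lambda>(h, \<xi>). H' h \<xi>) (0, 0)"
      using continuous_on_interior[OF c, of "(0, 0)"] t by (simp add: interior_Times interior_open)
  qed auto
  moreover have "time_integral g (move fl Dt h (p, t, x)) = H h h" for h
    by (simp add: time_integral_def H_def algebra_simps)
  ultimately show "((\<lambda>h. time_integral g (move fl Dt h (p, t, x))) has_real_derivative g (p, t, x) - time_integral g' (p, t, x)) (at 0)"
    by (simp add: H'_def)
qed

lemma Ck_time_integral:
  assumes "Ck fl k g"
  shows "Ck fl k (time_integral g)"
  using assms
proof (induction k arbitrary: g)
  case (Suc k)
  note g = Ck_continuous[OF Suc.prems]
  show ?case
    unfolding Ck.simps(2)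
  proof (intro conjI allI)
    fix d
    show "\<exists>h. has_dir_deriv fl d (time_integral g) h \<and> Ck fl k h"
    proof (cases "d = Dt")
      case True
      from Suc.prems obtain g' where g': "has_dir_deriv fl Dx g g'" "Ck fl k g'"
        unfolding Ck.simps(2) by blast
      then show ?thesis
        unfolding True using Ck_SucD[OF Suc.prems]
        by (intro exI[of _ "\<lambda>q. g q - time_integral g' q"] conjI has_dir_deriv_time_integral_Dt g Ck_continuous Ck_diff Suc.IH)
    next
      case False
      from Suc.prems obtain g' where g': "has_dir_deriv fl d g g'" "Ck fl k g'"
        unfolding Ck.simps(2) by blast
      then show ?thesis
        by (intro exI[of _ "time_integral g'"] conjI has_dir_deriv_time_integral g False Ck_continuous Suc.IH)
    qed
  qed (simp add: continuous_time_integral g)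
qed (simp add: continuous_time_integral)

lemma flows_lift: "flows (lift_flow fl)"
proof
  show "lift_flow fl i 0 p = p" for i p by (cases i; cases p) auto
  show "lift_flow fl i (h + k) p = lift_flow fl i h (lift_flow fl i k p)" for i h k p
    by (cases i; cases p) (auto simp: flow_add)
  show "continuous_on UNIV (\<lambda>h. lift_flow fl i h p)" for i p
    by (cases i; cases p) (auto intro!: continuous_intros flow_continuous)
qed

interpretation lift: flows "lift_flow fl"
  by (rule flows_lift)

lemma lift_move: "move (lift_flow fl) (lift_dir d) h ((p, \<xi>), t, x) = (case move fl d h (p, t, x) of (p', t', x') \<Rightarrow> ((p', \<xi>), t', x'))"
  by (cases d) auto

lemma lift_dir_Dt [simp]: "lift_dir d = Dt \<longleftrightarrow> d = Dt"
  by (cases d) auto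

lemma continuous_superpose:
  assumes "continuous_on nonneg_time \<Phi>" "continuous_on nonneg_time y"
  shows "continuous_on nonneg_time (superpose \<Phi> y :: 'p \<times> _ \<Rightarrow> real)"
  unfolding superpose_def case_prod_unfold
  by (intro continuous_on_compose2[OF assms(1)] continuous_intros continuous_on_compose2[OF assms(2)]) auto

text \<open>A move changes the point and, through \<open>y\<close>, also the \<xi>-argument of
  \<open>\<Phi>\<close>. With \<xi> as a second variable this is the situation of
  \<open>has_real_derivative_compose2\<close>.\<close>

lemma has_dir_deriv_superpose:
  assumes \<Phi>d: "has_dir_deriv (lift_flow fl) (lift_dir d) \<Phi> \<Phi>d"
    and \<Phi>\<xi>: "has_dir_deriv (lift_flow fl) (Dp None) \<Phi> \<Phi>\<xi>" "continuous_on nonneg_time \<Phi>\<xi>"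
    and y: "has_dir_deriv fl d y y'"
  shows "has_dir_deriv fl d (superpose \<Phi> y) (\<lambda>q. superpose \<Phi>d y q + superpose \<Phi>\<xi> y q * y' q)"
proof (rule has_dir_derivI)
  fix p t x assume t: "(t::real) > 0"
  define m where "m h = move fl d h (p, t, x)" for h
  define pt where "pt h \<xi> = ((fst (m h), \<xi>), snd (m h))" for h and \<xi> :: real
  have pt: "pt h \<xi> = move (lift_flow fl) (lift_dir d) h ((p, \<xi>), t, x)" for h \<xi>
    by (simp add: lift_move pt_def m_def case_prod_unfold)
  have m0: "m 0 = (p, t, x)" by (simp add: m_def)
  have "((\<lambda>h. \<Phi> (pt h (y (m h)))) has_real_derivative \<Phi>d ((p, y (m 0)), t, x) + \<Phi>\<xi> (pt 0 (y (m 0))) * y' (p, t, x)) (at 0)"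
  proof (rule has_real_derivative_compose2[where H = "\<lambda>h \<xi>. \<Phi> (pt h \<xi>)" and H' = "\<lambda>h \<xi>. \<Phi>\<xi> (pt h \<xi>)" and y = "\<lambda>h. y (m h)"])
    show "((\<lambda>h. \<Phi> (pt h (y (m 0)))) has_real_derivative \<Phi>d ((p, y (m 0)), t, x)) (at 0)"
      unfolding pt by (rule has_dir_derivD[OF \<Phi>d t])
    show "((\<lambda>h. y (m h)) has_real_derivative y' (p, t, x)) (at 0)"
      unfolding m_def by (rule has_dir_derivD[OF y t])
    have pos: "\<forall>\<^sub>F h in at 0. 0 < fst (snd (m h))"
      using move_time_pos[OF t, of fl d p x] unfolding m_def by (rule eventually_nhds_conv_at[THEN iffD1, THEN conjunct1])
    have "((\<lambda>\<xi>. \<Phi> (pt h \<xi>)) has_real_derivative \<Phi>\<xi> (pt h \<xi>)) (at \<xi>)" if "0 < fst (snd (m h))" for h \<xi>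
    proof -
      have e: "pt h \<xi> = move (lift_flow fl) (Dp None) \<xi> ((fst (m h), 0), snd (m h))" for \<xi>
        by (cases "m h") (simp add: pt_def)
      show ?thesis
        unfolding e using that by (intro lift.has_dir_deriv_along[OF \<Phi>\<xi>(1)]) (simp add: move_zero_time)
    qed
    then show "\<forall>\<^sub>F (h, \<xi>) in at 0 \<times>\<^sub>F nhds (y (m 0)). ((\<lambda>\<xi>. \<Phi> (pt h \<xi>)) has_real_derivative \<Phi>\<xi> (pt h \<xi>)) (at \<xi>)"
      using eventually_prod1[THEN iffD2, OF _ pos, of "nhds (y (m 0))"] by (auto simp: case_prod_unfold elim!: eventually_mono)
    have pos': "0 < fst (snd (m h))" if "h \<in> {-t<..}" for h
      unfolding m_def using that t by (cases d) auto
    then have pos'': "0 \<le> fst (snd (move fl d h (p, t, x)))" if "- t < h" for h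
      using that by (simp add: m_def less_imp_le)
    have c: "continuous_on ({-t<..} \<times> UNIV) (\<lambda>(h, \<xi>). \<Phi>\<xi> (pt h \<xi>))"
      unfolding pt_def m_def case_prod_unfold
    proof (rule continuous_on_compose2[OF \<Phi>\<xi>(2)])
      show "continuous_on ({-t<..} \<times> UNIV) (\<lambda>z. ((fst (move fl d (fst z) (p, t, x)), snd z), snd (move fl d (fst z) (p, t, x))))"
        by (intro continuous_intros continuous_on_move)
    qed (intro image_subsetI, simp add: mem_Times_iff pos'')
    then show "isCont (\<lambda>(h, \<xi>). \<Phi>\<xi> (pt h \<xi>)) (0, y (m 0))"
      using continuous_on_interior[OF c, of "(0, y (m 0))"] t by (simp add: interior_Times interior_open)
  qed
  moreover have "superpose \<Phi> y (move fl d h (p, t, x)) = \<Phi> (pt h (y (m h)))" for h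
    by (simp add: superpose_def pt_def m_def case_prod_unfold)
  ultimately show "((\<lambda>h. superpose \<Phi> y (move fl d h (p, t, x))) has_real_derivative
      superpose \<Phi>d y (p, t, x) + superpose \<Phi>\<xi> y (p, t, x) * y' (p, t, x)) (at 0)"
    by (simp add: superpose_def m0 pt)
qed

lemma Ck_superpose:
  assumes "Ck (lift_flow fl) k \<Phi>" "Ck fl k y"
  shows "Ck fl k (superpose \<Phi> y)"
  using assms
proof (induction k arbitrary: \<Phi> y)
  case (Suc k)
  note c = Ck_continuous[OF Suc.prems(1)] Ck_continuous[OF Suc.prems(2)]
  show ?case
    unfolding Ck.simps(2)
  proof (intro conjI allI)
    fix d
    from Suc.prems obtain \<Phi>d \<Phi>\<xi> y' where *: "has_dir_deriv (lift_flow fl) (lift_dir d) \<Phi> \<Phi>d" "Ck (lift_flow fl) k \<Phi>d"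
      "has_dir_deriv (lift_flow fl) (Dp None) \<Phi> \<Phi>\<xi>" "Ck (lift_flow fl) k \<Phi>\<xi>" "has_dir_deriv fl d y y'" "Ck fl k y'"
      unfolding Ck.simps(2) by meson
    then show "\<exists>h. has_dir_deriv fl d (superpose \<Phi> y) h \<and> Ck fl k h"
      using Ck_SucD[OF Suc.prems(2)]
      by (intro exI[of _ "\<lambda>q. superpose \<Phi>d y q + superpose \<Phi>\<xi> y q * y' q"] conjI has_dir_deriv_superpose
          Ck_continuous[OF *(4)] Ck_add Ck_mult Suc.IH)
  qed (simp add: continuous_superpose c)
qed (simp add: continuous_superpose)

section \<open>Smooth solutions of the transport equation\<close>

lemma smooth_dir_deriv:
  assumes "\<And>k. Ck fl k g"
  shows "\<exists>g'. has_dir_deriv fl d g g' \<and> (\<forall>k. Ck fl k g')"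
proof -
  from assms[of "Suc 0"] obtain g' where g': "has_dir_deriv fl d g g'" "Ck fl 0 g'"
    unfolding Ck.simps(2) by blast
  have "Ck fl k g'" for k
  proof -
    from assms[of "Suc k"] obtain f where f: "has_dir_deriv fl d g f" "Ck fl k f"
      unfolding Ck.simps(2) by blast
    show ?thesis
      by (rule Ck_cong[OF has_dir_deriv_unique[OF g'(1) f(1) Ck_continuous[OF g'(2)] Ck_continuous[OF f(2)]] f(2)])
  qed
  with g'(1) show ?thesis by blast
qed

text \<open>The initial values enter as \<open>w0 p (x - t)\<close>, carried along characteristics.
  Their derivatives \<open>w'\<close> are demanded at every step \<open>h\<close>, since the mean
  value formula integrates over the whole segment from 0 to \<open>h\<close>.\<close>

theorem smooth_solution:
  fixes \<Phi> :: "('p \<times> real) \<times> real \<times> real \<Rightarrow> real" and w0 :: "'p \<Rightarrow> real \<Rightarrow> real"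
  assumes \<Phi>: "\<And>k. Ck (lift_flow fl) k \<Phi>"
    and van: "\<And>p T. \<exists>M. \<forall>t x \<xi>. 0 \<le> t \<and> t \<le> T \<and> \<bar>\<xi>\<bar> \<ge> M \<longrightarrow> \<Phi> ((p, \<xi>), t, x) = 0"
    and w0: "continuous_on UNIV (\<lambda>(p, s). w0 p s)"
    and c0: "\<And>k. Ck fl k (\<lambda>(p, t, x). w0 p (x - t))"
    and c0': "\<And>d. d \<noteq> Dt \<Longrightarrow> \<exists>w'. continuous_on UNIV (\<lambda>(p, s). w' p s) \<and> (\<forall>k. Ck fl k (\<lambda>(p, t, x). w' p (x - t))) \<and>
      (\<forall>p s h. ((\<lambda>h. case move fl d h (p, 0, s) of (p, t, s) \<Rightarrow> w0 p s) has_real_derivative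
        (case move fl d h (p, 0, s) of (p, t, s) \<Rightarrow> w' p s)) (at h))"
  obtains y where "\<And>k. Ck fl k y"
    and "\<And>p t x. t \<ge> 0 \<Longrightarrow> y (p, t, x) = w0 p (x - t) + time_integral (superpose \<Phi> y) (p, t, x)"
proof -
  note c\<Phi> = Ck_continuous[OF \<Phi>[of 0]]
  obtain \<Phi>\<xi> where \<Phi>\<xi>: "has_dir_deriv (lift_flow fl) (Dp None) \<Phi> \<Phi>\<xi>" "Ck (lift_flow fl) 0 \<Phi>\<xi>"
    using \<Phi>[of "Suc 0"] unfolding Ck.simps(2) by blast
  note c\<Phi>\<xi> = Ck_continuous[OF \<Phi>\<xi>(2)]
  have \<Phi>\<xi>': "((\<lambda>\<xi>. \<Phi> ((p, \<xi>), t, x)) has_real_derivative \<Phi>\<xi> ((p, \<xi>), t, x)) (at \<xi>)" if "t \<ge> 0" for p \<xi> t x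
    using lift.has_dir_deriv_boundary[OF \<Phi>\<xi>(1) c\<Phi> c\<Phi>\<xi> _ that, of "(p, 0)" x \<xi>] by simp
  have lip: "\<exists>L. \<forall>t\<in>{0..T}. \<forall>\<xi> \<xi>'. \<bar>\<Phi> ((p, \<xi>), t, s + t) - \<Phi> ((p, \<xi>'), t, s + t)\<bar> \<le> L * \<bar>\<xi> - \<xi>'\<bar>" for p s T
  proof -
    obtain M where M: "\<And>t x \<xi>. 0 \<le> t \<Longrightarrow> t \<le> T \<Longrightarrow> \<bar>\<xi>\<bar> \<ge> M \<Longrightarrow> \<Phi> ((p, \<xi>), t, x) = 0"
      using van[of T p] by blast
    show ?thesis
    proof (rule lipschitz_of_vanishing[where M = M])
      show "((\<lambda>\<xi>. \<Phi> ((p, \<xi>), t, s + t)) has_real_derivative \<Phi>\<xi> ((p, \<xi>), t, s + t)) (at \<xi>)" if "t \<ge> 0" for t \<xi>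
        by (rule \<Phi>\<xi>'[OF that])
      show "continuous_on ({0..} \<times> UNIV) (\<lambda>(t, \<xi>). \<Phi>\<xi> ((p, \<xi>), t, s + t))"
        unfolding case_prod_unfold by (intro continuous_on_compose2[OF c\<Phi>\<xi>] continuous_intros) auto
    qed (use M in auto)
  qed
  \<comment> \<open>The equation on one characteristic; its parameter consists of \<open>p\<close>
    and of the foot \<open>s\<close> at time 0.\<close>
  define g where "g = (\<lambda>(p, s) t \<xi>. \<Phi> ((p, \<xi>), t, s + t))"
  have cg: "continuous_on (UNIV \<times> {0..} \<times> UNIV) (\<lambda>(q, t, \<xi>). g q t \<xi>)"
    unfolding g_def case_prod_unfold by (intro continuous_on_compose2[OF c\<Phi>] continuous_intros) auto
  have lipg: "\<exists>L. \<forall>t\<in>{0..T}. \<forall>\<xi> \<xi>'. \<bar>g q t \<xi> - g q t \<xi>'\<bar> \<le> L * \<bar>\<xi> - \<xi>'\<bar>" for q T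
    using lip by (cases q) (simp add: g_def)
  have "\<exists>w. continuous_on {0..} w \<and> (\<forall>t\<ge>0. w t = w0 (fst q) (snd q) + integral {0..t} (\<lambda>s. g q s (w s)))" for q
  proof -
    have "continuous_on ({0..} \<times> UNIV) (\<lambda>(t, \<xi>). g q t \<xi>)"
      unfolding case_prod_unfold by (intro continuous_on_curried3[OF cg] continuous_intros) auto
    from ode_exists[OF this lipg, of "w0 (fst q) (snd q)"] show ?thesis by metis
  qed
  then obtain w where w: "\<And>q. continuous_on {0..} (w q)"
    and weq: "\<And>q t. t \<ge> 0 \<Longrightarrow> w q t = w0 (fst q) (snd q) + integral {0..t} (\<lambda>s. g q s (w q s))"
    by metis
  have cw: "continuous_on (UNIV \<times> {0..}) (\<lambda>(q, t). w q t)"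
    by (rule ode_param_continuous[OF _ cg lipg w weq]) (use w0 in \<open>simp_all add: case_prod_unfold\<close>)
  define y where "y = (\<lambda>(p, t, x). w (p, x - t) t)"
  have cy: "continuous_on nonneg_time y"
    unfolding y_def case_prod_unfold by (intro continuous_on_curried2[OF cw] continuous_intros) auto
  have yeq: "y (p, t, x) = w0 p (x - t) + time_integral (superpose \<Phi> y) (p, t, x)" if "t \<ge> 0" for p t x
    using weq[OF that, of "(p, x - t)"] by (simp add: y_def time_integral_def superpose_def g_def)

  \<comment> \<open>The derivative of \<open>y\<close> in a direction other than time: it involves only \<open>y\<close>, not its derivatives.\<close>
  define Y where "Y \<Phi>d w' = (\<lambda>q. exp (time_integral (superpose \<Phi>\<xi> y) q) *
    ((case q of (p, t, x) \<Rightarrow> w' p (x - t)) + time_integral (\<lambda>q. exp (- time_integral (superpose \<Phi>\<xi> y) q) * superpose \<Phi>d y q) q))"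
    for \<Phi>d :: "('p \<times> real) \<times> real \<times> real \<Rightarrow> real" and w' :: "'p \<Rightarrow> real \<Rightarrow> real"
  have deriv: "has_dir_deriv fl d y (Y \<Phi>d w')"
    if d: "d \<noteq> Dt" and \<Phi>d: "has_dir_deriv (lift_flow fl) (lift_dir d) \<Phi> \<Phi>d" "continuous_on nonneg_time \<Phi>d"
      and w': "continuous_on UNIV (\<lambda>(p, s). w' p s)"
      "\<And>p s h. ((\<lambda>h. case move fl d h (p, 0, s) of (p, t, s) \<Rightarrow> w0 p s) has_real_derivative
        (case move fl d h (p, 0, s) of (p, t, s) \<Rightarrow> w' p s)) (at h)" for d \<Phi>d w'
  proof (rule has_dir_derivI)
    fix p t x assume t: "(t::real) > 0"
    \<comment> \<open>The foot (p, 0, x - t) of the characteristic through (p, t, x). A direction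
      other than time moves foot and point alike, so differentiating \<open>y\<close> means
      differentiating the ordinary equation in its parameter \<open>q h\<close>.\<close>
    define m where "m h = move fl d h (p, 0, x - t)" for h
    define q where "q h = (fst (m h), snd (snd (m h)))" for h
    have m0: "m 0 = (p, 0, x - t)" by (simp add: m_def)
    have q0: "q 0 = (p, x - t)" by (simp add: q_def m0)
    have cq: "continuous_on UNIV q"
      unfolding q_def m_def by (intro continuous_intros continuous_on_move)
    have G: "g (q h) s \<xi> = \<Phi> (move (lift_flow fl) (lift_dir d) h ((p, \<xi>), s, x - t + s))" for h s \<xi>
      using d by (cases d) (simp_all add: g_def q_def m_def add_ac)
    define Gh where "Gh h s \<xi> = \<Phi>d (move (lift_flow fl) (lift_dir d) h ((p, \<xi>), s, x - t + s))" for h s \<xi>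
    define G\<xi> where "G\<xi> h s \<xi> = \<Phi>\<xi> (move (lift_flow fl) (lift_dir d) h ((p, \<xi>), s, x - t + s))" for h s \<xi>
    have mv: "move (lift_flow fl) (lift_dir d) h ((p, \<xi>), s, z) = ((fst (move fl d h (p, s, z)), \<xi>), snd (move fl d h (p, s, z)))" for h \<xi> s z
      by (simp add: lift_move case_prod_unfold)
    have pos: "0 \<le> fst (snd (move fl d h (p, s, z)))" if "s \<ge> 0" for h s z
      using d that by (simp add: move_zero_time)
    have cmove: "continuous_on (UNIV \<times> {0..} \<times> UNIV) (\<lambda>z. F (move (lift_flow fl) (lift_dir d) (fst z) ((p, snd (snd z)), fst (snd z), x - t + fst (snd z))))"
      if "continuous_on nonneg_time F" for F :: "('p \<times> real) \<times> real \<times> real \<Rightarrow> real"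
      unfolding mv
    proof (rule continuous_on_compose2[OF that])
      show "continuous_on (UNIV \<times> {0..} \<times> UNIV) (\<lambda>z. ((fst (move fl d (fst z) (p, fst (snd z), x - t + fst (snd z))), snd (snd z)),
          snd (move fl d (fst z) (p, fst (snd z), x - t + fst (snd z)))))"
        by (intro continuous_intros continuous_on_move)
    qed (intro image_subsetI, simp add: mem_Times_iff pos)
    have "((\<lambda>h. w (q h) t) has_real_derivative exp (integral {0..t} (\<lambda>s. G\<xi> 0 s (w (q 0) s))) *
      ((case m 0 of (p, t, s) \<Rightarrow> w' p s) + integral {0..t} (\<lambda>s. exp (- integral {0..s} (\<lambda>r. G\<xi> 0 r (w (q 0) r))) * Gh 0 s (w (q 0) s)))) (at 0)"
    proof (rule ode_param_derivative[where G = "\<lambda>h. g (q h)" and W = "\<lambda>h. w (q h)" and ?w0.0 = "\<lambda>h. case m h of (p, t, s) \<Rightarrow> w0 p s"])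
      show "((\<lambda>h. case m h of (p, t, s) \<Rightarrow> w0 p s) has_real_derivative (case m h of (p, t, s) \<Rightarrow> w' p s)) (at h)" for h
        unfolding m_def by (rule w'(2))
      have eq: "(\<lambda>h. case m h of (p, t, s) \<Rightarrow> w' p s) = (\<lambda>h. case q h of (p, s) \<Rightarrow> w' p s)"
        by (simp add: q_def case_prod_unfold)
      show "continuous_on UNIV (\<lambda>h. case m h of (p, t, s) \<Rightarrow> w' p s)"
        unfolding eq using continuous_on_compose2[OF w'(1) cq] by simp
      show "continuous_on (UNIV \<times> {0..} \<times> UNIV) (\<lambda>(h, s, \<xi>). g (q h) s \<xi>)"
        unfolding G case_prod_unfold by (rule cmove[OF c\<Phi>])
      show "continuous_on (UNIV \<times> {0..} \<times> UNIV) (\<lambda>(h, s, \<xi>). Gh h s \<xi>)"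
        unfolding Gh_def case_prod_unfold by (rule cmove[OF \<Phi>d(2)])
      show "continuous_on (UNIV \<times> {0..} \<times> UNIV) (\<lambda>(h, s, \<xi>). G\<xi> h s \<xi>)"
        unfolding G\<xi>_def case_prod_unfold by (rule cmove[OF c\<Phi>\<xi>])
      show "((\<lambda>h. g (q h) s \<xi>) has_real_derivative Gh h s \<xi>) (at h)" if "s \<ge> 0" for h s \<xi>
        unfolding G Gh_def by (rule lift.has_dir_deriv_boundary[OF \<Phi>d(1) c\<Phi> \<Phi>d(2) _ that]) (simp add: d)
      show "(g (q h) s has_real_derivative G\<xi> h s \<xi>) (at \<xi>)" if "s \<ge> 0" for h s \<xi>
      proof -
        have e: "g (q h) s = (\<lambda>\<xi>. \<Phi> ((fst (q h), \<xi>), s, snd (q h) + s))" by (simp add: g_def case_prod_unfold)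
        have "G\<xi> h s \<xi> = \<Phi>\<xi> ((fst (q h), \<xi>), s, snd (q h) + s)"
          using d by (cases d) (simp_all add: G\<xi>_def q_def m_def add_ac)
        with \<Phi>\<xi>'[OF that] show ?thesis unfolding e by simp
      qed
      show "continuous_on (UNIV \<times> {0..}) (\<lambda>(h, s). w (q h) s)"
        unfolding case_prod_unfold by (intro continuous_on_curried2[OF cw] continuous_intros continuous_on_compose2[OF cq]) auto
      show "w (q h) s = (case m h of (p, t, s) \<Rightarrow> w0 p s) + integral {0..s} (\<lambda>r. g (q h) r (w (q h) r))" if "s \<ge> 0" for h s
        using weq[OF that, of "q h"] by (simp add: q_def case_prod_unfold)
    qed (use t in simp)
    moreover have "y (move fl d h (p, t, x)) = w (q h) t" for h
      using d by (cases d) (simp_all add: y_def q_def m_def algebra_simps)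
    moreover have G\<xi>0: "G\<xi> 0 s (w (p, x - t) s) = superpose \<Phi>\<xi> y (p, s, x - t + s)" for s
      by (simp add: G\<xi>_def superpose_def y_def)
    moreover have "Gh 0 s (w (p, x - t) s) = superpose \<Phi>d y (p, s, x - t + s)" for s
      by (simp add: Gh_def superpose_def y_def)
    ultimately show "((\<lambda>h. y (move fl d h (p, t, x))) has_real_derivative Y \<Phi>d w' (p, t, x)) (at 0)"
      by (simp add: Y_def time_integral_def q0 m0)
  qed

  have Cky: "Ck fl k y" for k
  proof (induction k)
    case (Suc k)
    obtain \<Phi>\<xi>' where \<Phi>\<xi>'k: "has_dir_deriv (lift_flow fl) (Dp None) \<Phi> \<Phi>\<xi>'" "Ck (lift_flow fl) k \<Phi>\<xi>'"
      using \<Phi>[of "Suc k"] unfolding Ck.simps(2) by blast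
    \<comment> \<open>\<open>\<Phi>\<xi>\<close> was fixed before the induction with continuity
      only; uniqueness gives it the regularity of the witness of order \<open>k\<close>.\<close>
    have Ck\<Phi>\<xi>: "Ck (lift_flow fl) k \<Phi>\<xi>"
      by (rule Ck_cong[OF has_dir_deriv_unique[OF \<Phi>\<xi>(1) \<Phi>\<xi>'k(1) c\<Phi>\<xi> Ck_continuous[OF \<Phi>\<xi>'k(2)]] \<Phi>\<xi>'k(2)])
    have CkY: "Ck fl k (Y \<Phi>d w')" if "Ck (lift_flow fl) k \<Phi>d" "Ck fl k (\<lambda>(p, t, x). w' p (x - t))" for \<Phi>d w'
      unfolding Y_def by (intro Ck_mult Ck_add Ck_exp Ck_minus Ck_time_integral Ck_superpose Ck\<Phi>\<xi> Suc that)
    have space: "\<exists>y'. has_dir_deriv fl d y y' \<and> Ck fl k y'" if d: "d \<noteq> Dt" for d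
    proof -
      obtain \<Phi>d where \<Phi>d: "has_dir_deriv (lift_flow fl) (lift_dir d) \<Phi> \<Phi>d" "Ck (lift_flow fl) k \<Phi>d"
        using \<Phi>[of "Suc k"] unfolding Ck.simps(2) by blast
      obtain w' where w': "continuous_on UNIV (\<lambda>(p, s). w' p s)" "\<And>k. Ck fl k (\<lambda>(p, t, x). w' p (x - t))"
        "\<And>p s h. ((\<lambda>h. case move fl d h (p, 0, s) of (p, t, s) \<Rightarrow> w0 p s) has_real_derivative
          (case move fl d h (p, 0, s) of (p, t, s) \<Rightarrow> w' p s)) (at h)"
        using c0'[OF d] by blast
      show ?thesis
        using deriv[OF d \<Phi>d(1) Ck_continuous[OF \<Phi>d(2)] w'(1,3)] CkY[OF \<Phi>d(2) w'(2)] by blast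
    qed
    \<comment> \<open>Varying t changes the foot and the length of integration together, so
      \<open>Y\<close> does not cover it. The integral equation is differentiated instead, with the
      x-derivative \<open>yx\<close> already at hand.\<close>
    have time: "\<exists>y'. has_dir_deriv fl Dt y y' \<and> Ck fl k y'"
    proof -
      obtain yx where yx: "has_dir_deriv fl Dx y yx" "Ck fl k yx" using space[of Dx] by auto
      obtain \<Phi>x where \<Phi>x: "has_dir_deriv (lift_flow fl) (lift_dir Dx) \<Phi> \<Phi>x" "Ck (lift_flow fl) k \<Phi>x"
        using \<Phi>[of "Suc k"] unfolding Ck.simps(2) by blast
      define s where "s = (\<lambda>q. superpose \<Phi>x y q + superpose \<Phi>\<xi> y q * yx q)"
      have s: "has_dir_deriv fl Dx (superpose \<Phi> y) s"
        unfolding s_def by (rule has_dir_deriv_superpose[OF \<Phi>x(1) \<Phi>\<xi>(1) c\<Phi>\<xi> yx(1)])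
      have Cks: "Ck fl k s"
        unfolding s_def by (intro Ck_add Ck_mult Ck_superpose \<Phi>x(2) Ck\<Phi>\<xi> yx(2) Suc)
      obtain c' where c': "has_dir_deriv fl Dt (\<lambda>(p, t, x). w0 p (x - t)) c'" "Ck fl k c'"
        using c0[of "Suc k"] unfolding Ck.simps(2) by blast
      have "has_dir_deriv fl Dt (\<lambda>q. (case q of (p, t, x) \<Rightarrow> w0 p (x - t)) + time_integral (superpose \<Phi> y) q)
          (\<lambda>q. c' q + (superpose \<Phi> y q - time_integral s q))"
        by (rule has_dir_deriv_add[OF c'(1) has_dir_deriv_time_integral_Dt[OF s continuous_superpose[OF c\<Phi> cy] Ck_continuous[OF Cks]]])
      then have "has_dir_deriv fl Dt y (\<lambda>q. c' q + (superpose \<Phi> y q - time_integral s q))"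
        by (rule has_dir_deriv_cong) (auto simp: yeq)
      moreover have "Ck fl k (\<lambda>q. c' q + (superpose \<Phi> y q - time_integral s q))"
        by (intro Ck_add Ck_diff Ck_superpose Ck_time_integral c'(2) Cks \<Phi> Suc)
      ultimately show ?thesis by blast
    qed
    show ?case
    proof -
      have "\<exists>y'. has_dir_deriv fl d y y' \<and> Ck fl k y'" for d
        using space[of d] time by (cases "d = Dt") simp_all
      with cy show ?thesis unfolding Ck.simps(2) by blast
    qed
  qed (simp add: cy)
  show thesis by (rule that[of y]) (rule Cky, rule yeq)
qed

end

section \<open>The spaces of smooth functions on a closed domain\<close>

lemma partials_Nil [simp]: "partials [] f = f"
  and partials_Cons: "partials (b # bs) f = partial b (partials bs f)"
  by (simp_all add: partials_def)

lemma eventually_line_open: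
  fixes x b :: "'a::real_normed_vector"
  assumes "open A" "x \<in> A"
  shows "\<forall>\<^sub>F t in nhds (0::real). x + t *\<^sub>R b \<in> A"
proof -
  have "((\<lambda>t. x + t *\<^sub>R b) \<longlongrightarrow> x + 0 *\<^sub>R b) (nhds 0)"
    by (intro tendsto_intros) (simp add: filterlim_def)
  from topological_tendstoD[OF this assms(1)] assms(2) show ?thesis by simp
qed

locale regular_closed_domain =
  fixes S :: "'a::euclidean_space set"
  assumes regular: "closure (interior S) = S"
begin

lemma closed: "closed S"
  by (metis regular closed_closure)

lemma extends_continuously_unique:
  assumes "extends_continuously S g h" "extends_continuously S g h'" "x \<in> S"
  shows "h x = h' x"
proof -
  have "h x - h' x = 0"
    by (rule continuous_constant_on_closure[of "interior S" "\<lambda>x. h x - h' x"])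
      (use assms in \<open>auto simp: regular extends_continuously_def intro!: continuous_intros\<close>)
  then show ?thesis by simp
qed

lemma ext_partials_extends:
  assumes "f \<in> C_fun \<infinity> S" "set bs \<subseteq> Basis"
  shows "extends_continuously S (partials bs f) (ext_partials S bs f)"
proof -
  have "\<exists>h. extends_continuously S (partials bs f) h" using assms by (auto simp: C_fun_def)
  then show ?thesis unfolding ext_partials_def by (rule someI_ex)
qed

lemma continuous_ext_partials:
  "f \<in> C_fun \<infinity> S \<Longrightarrow> set bs \<subseteq> Basis \<Longrightarrow> continuous_on S (ext_partials S bs f)"
  using ext_partials_extends by (simp add: extends_continuously_def)

lemma ext_partials_interior:
  "f \<in> C_fun \<infinity> S \<Longrightarrow> set bs \<subseteq> Basis \<Longrightarrow> x \<in> interior S \<Longrightarrow> ext_partials S bs f x = partials bs f x"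
  using ext_partials_extends by (simp add: extends_continuously_def)

lemma ext_partials_Nil:
  assumes "f \<in> C_fun \<infinity> S" "x \<in> S"
  shows "ext_partials S [] f x = f x"
  using assms
  by (intro extends_continuously_unique[OF ext_partials_extends[OF assms(1), of "[]"]])
    (auto simp: extends_continuously_def C_fun_def)

lemma ext_partials_deriv:
  assumes f: "f \<in> C_fun \<infinity> S" and bs: "set bs \<subseteq> Basis" "b \<in> Basis" and x: "x \<in> interior S"
  shows "((\<lambda>t. ext_partials S bs f (x + t *\<^sub>R b)) has_real_derivative ext_partials S (b # bs) f x) (at 0)"
proof -
  have "(\<lambda>t. partials bs f (x + t *\<^sub>R b)) differentiable (at (0::real))"
    using assms by (auto simp: C_fun_def)
  then have d: "((\<lambda>t. partials bs f (x + t *\<^sub>R b)) has_real_derivative partials (b # bs) f x) (at 0)"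
    by (simp add: partials_Cons partial_def DERIV_deriv_iff_real_differentiable)
  have ev: "\<forall>\<^sub>F t in nhds 0. ext_partials S bs f (x + t *\<^sub>R b) = partials bs f (x + t *\<^sub>R b)"
    using eventually_line_open[OF open_interior x, of b]
    by eventually_elim (rule ext_partials_interior[OF f bs(1)])
  have eq: "ext_partials S (b # bs) f x = partials (b # bs) f x"
    by (rule ext_partials_interior[OF f]) (use bs x in auto)
  show ?thesis by (rule DERIV_cong_ev[OF refl ev eq, THEN iffD2, OF d])
qed

text \<open>The choices hidden in \<open>partials\<close> (\<open>deriv\<close>) and
  \<open>ext_partials\<close> (\<open>SOME\<close>) are resolved here: a continuous tower
  \<open>G\<close> whose members differentiate into each other inside \<open>S\<close> must consist
  of the extended partial derivatives.\<close>

lemma C_fun_tower: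
  fixes G :: "'a list \<Rightarrow> 'a \<Rightarrow> real"
  assumes out: "\<And>x. x \<notin> S \<Longrightarrow> f x = 0" and f: "\<And>x. x \<in> S \<Longrightarrow> G [] x = f x"
    and cont: "\<And>bs. set bs \<subseteq> Basis \<Longrightarrow> continuous_on S (G bs)"
    and deriv: "\<And>bs b x. set bs \<subseteq> Basis \<Longrightarrow> b \<in> Basis \<Longrightarrow> x \<in> interior S \<Longrightarrow>
      ((\<lambda>t. G bs (x + t *\<^sub>R b)) has_real_derivative G (b # bs) x) (at 0)"
  shows "f \<in> C_fun i S" and "set bs \<subseteq> Basis \<Longrightarrow> x \<in> S \<Longrightarrow> ext_partials S bs f x = G bs x"
proof -
  have p: "partials bs f x = G bs x" if "set bs \<subseteq> Basis" "x \<in> interior S" for bs x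
    using that
  proof (induction bs arbitrary: x)
    case Nil
    then have "x \<in> S" using interior_subset by blast
    then show ?case by (simp add: f)
  next
    case (Cons b bs)
    have "\<forall>\<^sub>F t in nhds 0. partials bs f (x + t *\<^sub>R b) = G bs (x + t *\<^sub>R b)"
      using eventually_line_open[OF open_interior Cons.prems(2), of b]
      by eventually_elim (use Cons in auto)
    then have "deriv (\<lambda>t. partials bs f (x + t *\<^sub>R b)) 0 = deriv (\<lambda>t. G bs (x + t *\<^sub>R b)) 0"
      by (rule deriv_cong_ev) simp
    also have "\<dots> = G (b # bs) x"
      using Cons.prems by (intro DERIV_imp_deriv deriv) auto
    finally show ?case by (simp add: partials_Cons partial_def)
  qed
  have ext: "extends_continuously S (partials bs f) (G bs)" if "set bs \<subseteq> Basis" for bs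
    using cont p that by (simp add: extends_continuously_def)
  have "(\<lambda>t. partials bs f (x + t *\<^sub>R b)) differentiable (at (0::real))"
    if "set bs \<subseteq> Basis" "b \<in> Basis" "x \<in> interior S" for bs b x
  proof -
    have ev: "\<forall>\<^sub>F t in nhds 0. partials bs f (x + t *\<^sub>R b) = G bs (x + t *\<^sub>R b)"
      using eventually_line_open[OF open_interior that(3), of b]
      by eventually_elim (use p that in auto)
    have "((\<lambda>t. partials bs f (x + t *\<^sub>R b)) has_real_derivative G (b # bs) x) (at 0)"
      by (rule DERIV_cong_ev[OF refl ev refl, THEN iffD2, OF deriv[OF that]])
    then show ?thesis by (auto simp: real_differentiable_def)
  qed
  moreover have "continuous_on S f"
    using cont[of "[]"] by (rule continuous_on_eq) (auto simp: f)
  moreover have "continuous_on (interior S) (partials bs f)" if "set bs \<subseteq> Basis" for bs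
    by (rule continuous_on_eq[OF continuous_on_subset[OF cont[OF that] interior_subset]]) (simp add: p that)
  ultimately have C: "f \<in> C_fun i S" for i
    unfolding C_fun_def using out ext by blast
  show "f \<in> C_fun i S" by (rule C)
  show "ext_partials S bs f x = G bs x" if "set bs \<subseteq> Basis" "x \<in> S"
    by (rule extends_continuously_unique[OF ext_partials_extends[OF C] ext]) (use that in auto)
qed

lemma C_fun_linear:
  assumes f: "f \<in> C_fun \<infinity> S" and g: "g \<in> C_fun \<infinity> S"
  shows "a *\<^sub>R f + b *\<^sub>R g \<in> C_fun \<infinity> S"
    and "set bs \<subseteq> Basis \<Longrightarrow> x \<in> S \<Longrightarrow>
      ext_partials S bs (a *\<^sub>R f + b *\<^sub>R g) x = a * ext_partials S bs f x + b * ext_partials S bs g x"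
proof -
  let ?G = "\<lambda>bs x. a * ext_partials S bs f x + b * ext_partials S bs g x"
  have 1: "(a *\<^sub>R f + b *\<^sub>R g) x = 0" if "x \<notin> S" for x
    using that f g by (auto simp: C_fun_def)
  have 2: "?G [] x = (a *\<^sub>R f + b *\<^sub>R g) x" if "x \<in> S" for x
    using that f g by (simp add: ext_partials_Nil)
  have 3: "continuous_on S (?G bs)" if "set bs \<subseteq> Basis" for bs
    by (intro continuous_intros continuous_ext_partials f g that)
  have 4: "((\<lambda>t. ?G bs (x + t *\<^sub>R c)) has_real_derivative ?G (c # bs) x) (at 0)"
    if "set bs \<subseteq> Basis" "c \<in> Basis" "x \<in> interior S" for bs c x
    by (intro DERIV_add DERIV_cmult ext_partials_deriv f g that)
  show "a *\<^sub>R f + b *\<^sub>R g \<in> C_fun \<infinity> S"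
    by (rule C_fun_tower(1)[of "a *\<^sub>R f + b *\<^sub>R g" ?G]) (rule 1 2 3 4; assumption)+
  show "ext_partials S bs (a *\<^sub>R f + b *\<^sub>R g) x = ?G bs x" if "set bs \<subseteq> Basis" "x \<in> S"
    by (rule C_fun_tower(2)[of "a *\<^sub>R f + b *\<^sub>R g" ?G]) (rule 1 2 3 4 that; assumption?)+
qed

lemma subspace_C_fun: "subspace (C_fun \<infinity> S)"
proof (rule subspaceI)
  show 0: "0 \<in> C_fun \<infinity> S"
    by (rule C_fun_tower(1)[where G = "\<lambda>_ _. 0"]) auto
  show "x + y \<in> C_fun \<infinity> S" if "x \<in> C_fun \<infinity> S" "y \<in> C_fun \<infinity> S" for x y
    using C_fun_linear(1)[OF that, of 1 1] by simp
  show "c *\<^sub>R x \<in> C_fun \<infinity> S" if "x \<in> C_fun \<infinity> S" for c x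
    using C_fun_linear(1)[OF that that, of c 0] by simp
qed

definition seminorm_index :: "('a set \<times> 'a list) set set"
  where "seminorm_index = {J. finite J \<and> (\<forall>(K, bs)\<in>J. compact K \<and> K \<subseteq> S \<and> set bs \<subseteq> Basis)}"

text \<open>The functionals behind the maximum, over finitely many pairs (K, bs), of the seminorms
  sup |D^bs f| on K. Finite index sets are closed under union, which makes the family directed
  although single \<open>C_ball\<close>s form only a subbase.\<close>

definition evaluations :: "('a set \<times> 'a list) set \<Rightarrow> (('a \<Rightarrow> real) \<Rightarrow> real) set"
  where "evaluations J = (\<Union>(K, bs)\<in>J. (\<lambda>x f. ext_partials S bs f x) ` K)"

lemma evaluations_Un: "evaluations (J \<union> J') = evaluations J \<union> evaluations J'"
  by (simp add: evaluations_def)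

text \<open>The deviation of \<open>g\<close> from \<open>f\<close> attains its maximum m <
  \<epsilon> on the compact set, which leaves room \<epsilon> - m around \<open>g\<close>. Subbasic
  sets can thus be recentred at any of their points.\<close>

lemma C_ball_shrink:
  assumes K: "compact K" "K \<subseteq> S" and bs: "set bs \<subseteq> Basis" and f: "f \<in> C_fun \<infinity> S" and g: "g \<in> C_ball \<infinity> S K bs \<epsilon> f"
  obtains \<delta> where "\<delta> > 0" "\<And>h. h \<in> C_ball \<infinity> S K bs \<delta> g \<Longrightarrow> h \<in> C_ball \<infinity> S K bs \<epsilon> f"
proof (cases "K = {}")
  case True
  show thesis by (rule that[of 1]) (auto simp: True C_ball_def)
next
  case False
  have gC: "g \<in> C_fun \<infinity> S" using g by (simp add: C_ball_def)
  have "continuous_on K (\<lambda>x. \<bar>ext_partials S bs g x - ext_partials S bs f x\<bar>)"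
    by (intro continuous_intros continuous_on_subset[OF continuous_ext_partials K(2)] f gC bs)
  from continuous_attains_sup[OF K(1) False this] obtain x where x: "x \<in> K"
    "\<And>y. y \<in> K \<Longrightarrow> \<bar>ext_partials S bs g y - ext_partials S bs f y\<bar> \<le> \<bar>ext_partials S bs g x - ext_partials S bs f x\<bar>"
    by blast
  define m where "m = \<bar>ext_partials S bs g x - ext_partials S bs f x\<bar>"
  have m: "m < \<epsilon>" using g x by (auto simp: C_ball_def m_def)
  show thesis
  proof (rule that[of "\<epsilon> - m"])
    fix h assume h: "h \<in> C_ball \<infinity> S K bs (\<epsilon> - m) g"
    have "\<bar>ext_partials S bs h y - ext_partials S bs f y\<bar> < \<epsilon>" if "y \<in> K" for y
    proof -
      have "\<bar>ext_partials S bs h y - ext_partials S bs g y\<bar> < \<epsilon> - m" using h that by (auto simp: C_ball_def)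
      then show ?thesis using x(2)[OF that] unfolding m_def by linarith
    qed
    with h show "h \<in> C_ball \<infinity> S K bs \<epsilon> f" by (simp add: C_ball_def)
  qed (use m in simp)
qed

lemma openin_C_ball:
  assumes "compact K" "K \<subseteq> S" "set bs \<subseteq> Basis" "f \<in> C_fun \<infinity> S" "\<epsilon> > 0"
  shows "openin (C_top \<infinity> S) (C_ball \<infinity> S K bs \<epsilon> f)"
  unfolding C_top_def by (rule topology_generated_by_Basis) (use assms in auto)

text \<open>The neighbourhood property follows the generation of the topology: subbasic sets are
  recentred by \<open>C_ball_shrink\<close>, and an intersection takes the union of the index sets
  with the smaller radius. Points are separated by evaluating the empty list of derivatives on
  singletons.\<close>

theorem functional_topology_C_top: "functional_topology (C_top \<infinity> S) (evaluations ` seminorm_index)"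
proof -
  define \<B> where "\<B> = {C_ball \<infinity> S K bs \<epsilon> f | K bs \<epsilon> f.
       compact K \<and> K \<subseteq> S \<and> set bs \<subseteq> Basis \<and> enat (length bs) < \<infinity> + 1 \<and> \<epsilon> > 0 \<and> f \<in> C_fun \<infinity> S}"
  have top: "C_top \<infinity> S = topology_generated_by \<B>"
    by (simp add: C_top_def \<B>_def)
  show ?thesis
  proof
  show "subspace (topspace (C_top \<infinity> S))" by (simp add: subspace_C_fun)
  show "functional_on (topspace (C_top \<infinity> S)) \<mu>" if "\<Lambda> \<in> evaluations ` seminorm_index" "\<mu> \<in> \<Lambda>" for \<Lambda> \<mu>
  proof -
    from that obtain bs x where "\<mu> = (\<lambda>f. ext_partials S bs f x)" "set bs \<subseteq> Basis" "x \<in> S"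
      unfolding evaluations_def seminorm_index_def by blast
    then show ?thesis by (simp add: functional_on_def C_fun_linear(2))
  qed
  show "\<exists>B. \<forall>\<mu>\<in>\<Lambda>. \<bar>\<mu> f\<bar> \<le> B" if "\<Lambda> \<in> evaluations ` seminorm_index" "f \<in> topspace (C_top \<infinity> S)" for \<Lambda> f
  proof -
    from that(1) obtain J where J: "J \<in> seminorm_index" "\<Lambda> = evaluations J" by blast
    have "bounded (ext_partials S bs f ` K)" if "(K, bs) \<in> J" for K bs
      using J(1) that \<open>f \<in> _\<close>
      by (intro compact_imp_bounded compact_continuous_image continuous_on_subset[OF continuous_ext_partials])
        (auto simp: seminorm_index_def)
    then have "bounded (\<Union>(K, bs)\<in>J. ext_partials S bs f ` K)"
      using J(1) by (intro bounded_UN) (auto simp: seminorm_index_def)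
    moreover have "(\<lambda>\<mu>. \<mu> f) ` \<Lambda> = (\<Union>(K, bs)\<in>J. ext_partials S bs f ` K)"
      unfolding J(2) evaluations_def image_UN by (rule SUP_cong[OF refl]) (auto simp: image_image)
    ultimately have "bounded ((\<lambda>\<mu>. \<mu> f) ` \<Lambda>)" by simp
    then show ?thesis by (simp add: bounded_iff)
  qed
  show "openin (C_top \<infinity> S) (polar_ball (C_top \<infinity> S) \<Lambda> r f)"
    if "\<Lambda> \<in> evaluations ` seminorm_index" "f \<in> topspace (C_top \<infinity> S)" "r > 0" for \<Lambda> f r
  proof -
    from that(1) obtain J where J: "J \<in> seminorm_index" "\<Lambda> = evaluations J" by blast
    have eq: "polar_ball (C_top \<infinity> S) \<Lambda> r f = (\<Inter>(K, bs)\<in>J. C_ball \<infinity> S K bs r f) \<inter> topspace (C_top \<infinity> S)"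
      unfolding polar_ball_def J(2) evaluations_def C_ball_def by auto
    show ?thesis
      unfolding eq using J(1) that
      by (intro openin_INT) (auto simp: seminorm_index_def intro!: openin_C_ball)
  qed
  show "\<exists>\<Lambda>\<in>evaluations ` seminorm_index. \<exists>r>0. polar_ball (C_top \<infinity> S) \<Lambda> r f \<subseteq> U"
    if "openin (C_top \<infinity> S) U" "f \<in> U" for U f
    using that unfolding top openin_topology_generated_by_iff
  proof (induction arbitrary: f rule: generate_topology_on.induct)
    case (Int A B)
    from Int.IH(1)[of f] Int.prems obtain J r where 1: "J \<in> seminorm_index" "r > 0"
      "polar_ball (topology_generated_by \<B>) (evaluations J) r f \<subseteq> A" by blast
    from Int.IH(2)[of f] Int.prems obtain J' r' where 2: "J' \<in> seminorm_index" "r' > 0"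
      "polar_ball (topology_generated_by \<B>) (evaluations J') r' f \<subseteq> B" by blast
    have "polar_ball (topology_generated_by \<B>) (evaluations (J \<union> J')) (min r r') f \<subseteq>
        polar_ball (topology_generated_by \<B>) (evaluations J) r f \<inter> polar_ball (topology_generated_by \<B>) (evaluations J') r' f"
      unfolding polar_ball_def evaluations_Un ball_Un by auto
    then have "polar_ball (topology_generated_by \<B>) (evaluations (J \<union> J')) (min r r') f \<subseteq> A \<inter> B"
      using 1(3) 2(3) by blast
    moreover have "J \<union> J' \<in> seminorm_index" using 1 2 by (auto simp: seminorm_index_def)
    moreover have "min r r' > 0" using 1 2 by simp
    ultimately show ?case by blast
  next
    case (UN K)
    then obtain k where k: "k \<in> K" "f \<in> k" by blast
    from UN.IH[OF this] k(1) show ?case by blast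
  next
    case (Basis s)
    from Basis(1) obtain K bs \<epsilon> g where *: "s = C_ball \<infinity> S K bs \<epsilon> g" "compact K" "K \<subseteq> S" "set bs \<subseteq> Basis" "\<epsilon> > 0" "g \<in> C_fun \<infinity> S"
      unfolding \<B>_def by blast
    have fs: "f \<in> C_ball \<infinity> S K bs \<epsilon> g" using Basis(2) *(1) by simp
    obtain \<delta> where d: "\<delta> > 0" "\<And>h. h \<in> C_ball \<infinity> S K bs \<delta> f \<Longrightarrow> h \<in> s"
      using C_ball_shrink[OF *(2,3,4,6) fs] unfolding *(1) by blast
    have "polar_ball (C_top \<infinity> S) (evaluations {(K, bs)}) \<delta> f \<subseteq> C_ball \<infinity> S K bs \<delta> f"
      by (auto simp: polar_ball_def evaluations_def C_ball_def)
    then have "polar_ball (topology_generated_by \<B>) (evaluations {(K, bs)}) \<delta> f \<subseteq> s"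
      using d(2) unfolding top by blast
    moreover have "{(K, bs)} \<in> seminorm_index" using * by (auto simp: seminorm_index_def)
    ultimately show ?case using d(1) by blast
  qed simp
  show "f = 0" if f: "f \<in> topspace (C_top \<infinity> S)"
    and 0: "\<And>\<Lambda> \<mu>. \<Lambda> \<in> evaluations ` seminorm_index \<Longrightarrow> \<mu> \<in> \<Lambda> \<Longrightarrow> \<mu> f = 0" for f
  proof
    fix x
    show "f x = 0 x"
    proof (cases "x \<in> S")
      case True
      have "ext_partials S [] f x = 0"
      proof (rule 0)
        show "evaluations {({x}, [])} \<in> evaluations ` seminorm_index"
          using True by (intro imageI) (simp add: seminorm_index_def)
      qed (simp add: evaluations_def)
      then show ?thesis using f True by (simp add: ext_partials_Nil)
    qed (use f in \<open>simp add: C_fun_def\<close>)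
  qed
  qed
qed

text \<open>Local compactness of \<open>S\<close>: the trace on \<open>S\<close> of a closed ball
  around \<open>x0\<close> is a compact set whose seminorm controls all nearby evaluations at
  once.\<close>

lemma eval_continuous:
  assumes f0: "f0 \<in> C_fun \<infinity> S" and x0: "x0 \<in> S" and bs: "set bs \<subseteq> Basis" and e: "e > 0"
  obtains U V where "openin (C_top \<infinity> S) U" "f0 \<in> U" "open V" "x0 \<in> V"
    "\<And>f x. f \<in> U \<Longrightarrow> x \<in> V \<Longrightarrow> x \<in> S \<Longrightarrow> \<bar>ext_partials S bs f x - ext_partials S bs f0 x0\<bar> < e"
proof -
  define K where "K = cball x0 1 \<inter> S"
  have K: "compact K" "K \<subseteq> S" by (auto simp: K_def closed compact_Int_closed)
  have "(ext_partials S bs f0 \<longlongrightarrow> ext_partials S bs f0 x0) (at x0 within S)"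
    using continuous_ext_partials[OF f0 bs] x0 by (simp add: continuous_on_def)
  from tendstoD[OF this, of "e / 2"] e obtain V where V: "open V" "x0 \<in> V"
    "\<And>x. x \<in> V \<Longrightarrow> x \<in> S \<Longrightarrow> x \<noteq> x0 \<Longrightarrow> dist (ext_partials S bs f0 x) (ext_partials S bs f0 x0) < e / 2"
    unfolding eventually_at_topological by auto
  show thesis
  proof (rule that[of "C_ball \<infinity> S K bs (e / 2) f0" "V \<inter> ball x0 1"])
    show "openin (C_top \<infinity> S) (C_ball \<infinity> S K bs (e / 2) f0)"
      by (rule openin_C_ball) (use K bs f0 e in auto)
    show "f0 \<in> C_ball \<infinity> S K bs (e / 2) f0" using f0 e by (simp add: C_ball_def)
    fix f x assume f: "f \<in> C_ball \<infinity> S K bs (e / 2) f0" and x: "x \<in> V \<inter> ball x0 1" "x \<in> S"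
    have "\<bar>ext_partials S bs f x - ext_partials S bs f0 x\<bar> < e / 2"
      using f x by (auto simp: C_ball_def K_def)
    moreover have "\<bar>ext_partials S bs f0 x - ext_partials S bs f0 x0\<bar> < e / 2"
      using V(3)[of x] x e by (cases "x = x0") (auto simp: dist_real_def)
    ultimately show "\<bar>ext_partials S bs f x - ext_partials S bs f0 x0\<bar> < e" by linarith
  qed (use V in auto)
qed

text \<open>One half of the exponential law: over a compact \<open>K\<close> a jointly continuous
  function changes uniformly little near \<open>p\<close>, by the tube lemma, and this is closeness
  in the seminorm of \<open>K\<close>.\<close>

lemma continuous_map_into_C_top:
  fixes g :: "'p::topological_space \<Rightarrow> 'a \<Rightarrow> real" and G :: "'a list \<Rightarrow> 'p \<Rightarrow> 'a \<Rightarrow> real"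
  assumes out: "\<And>p x. x \<notin> S \<Longrightarrow> g p x = 0" and g: "\<And>p x. x \<in> S \<Longrightarrow> G [] p x = g p x"
    and cont: "\<And>bs. set bs \<subseteq> Basis \<Longrightarrow> continuous_on (UNIV \<times> S) (\<lambda>(p, x). G bs p x)"
    and deriv: "\<And>bs b p x. set bs \<subseteq> Basis \<Longrightarrow> b \<in> Basis \<Longrightarrow> x \<in> interior S \<Longrightarrow>
      ((\<lambda>t. G bs p (x + t *\<^sub>R b)) has_real_derivative G (b # bs) p x) (at 0)"
  shows "continuous_map euclidean (C_top \<infinity> S) g"
proof -
  have cont': "continuous_on S (G bs p)" if "set bs \<subseteq> Basis" for bs p
    using continuous_on_curried2[OF cont[OF that], of S "\<lambda>_. p" "\<lambda>x. x"] by (simp add: continuous_on_const continuous_on_id)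
  have C: "g p \<in> C_fun i S" and ext: "set bs \<subseteq> Basis \<Longrightarrow> x \<in> S \<Longrightarrow> ext_partials S bs (g p) x = G bs p x" for p i bs x
    using C_fun_tower[of "g p" "\<lambda>bs. G bs p", OF out g cont' deriv] by blast+
  show ?thesis
    unfolding C_top_def
  proof (rule continuous_on_generated_topo)
    fix U assume "U \<in> {C_ball \<infinity> S K bs \<epsilon> f |K bs \<epsilon> f. compact K \<and> K \<subseteq> S \<and> set bs \<subseteq> Basis \<and> enat (length bs) < \<infinity> + 1 \<and> 0 < \<epsilon> \<and> f \<in> C_fun \<infinity> S}"
    then obtain K bs \<epsilon> f where U: "U = C_ball \<infinity> S K bs \<epsilon> f" "compact K" "K \<subseteq> S" "set bs \<subseteq> Basis" "\<epsilon> > 0" "f \<in> C_fun \<infinity> S"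
      by blast
    have "\<exists>A. open A \<and> p \<in> A \<and> A \<subseteq> g -` U" if p: "g p \<in> U" for p
    proof -
      obtain \<delta> where d: "\<delta> > 0" "\<And>h. h \<in> C_ball \<infinity> S K bs \<delta> (g p) \<Longrightarrow> h \<in> U"
        using C_ball_shrink[OF U(2,3,4,6), of "g p"] p unfolding U(1) by blast
      have "continuous_on (UNIV \<times> K) (\<lambda>(p, x). G bs p x)"
        by (rule continuous_on_subset[OF cont[OF U(4)]]) (use U in auto)
      then obtain A where A: "p \<in> A" "open A"
        "\<forall>q\<in>A \<inter> UNIV. \<forall>x\<in>K. dist ((\<lambda>(p, x). G bs p x) (q, x)) ((\<lambda>(p, x). G bs p x) (p, x)) \<le> \<delta> / 2"
        by (rule continuous_on_prod_compactE[OF _ U(2) UNIV_I half_gt_zero[OF d(1)]])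
      have "g q \<in> U" if q: "q \<in> A" for q
      proof (rule d(2))
        have "\<bar>G bs q x - G bs p x\<bar> < \<delta>" if "x \<in> K" for x
          using A(3)[rule_format, of q x] q that d(1) by (simp add: dist_real_def)
        then show "g q \<in> C_ball \<infinity> S K bs \<delta> (g p)"
          using U(3,4) by (auto simp: C_ball_def C ext subset_iff)
      qed
      with A show ?thesis by blast
    qed
    then have "open (g -` U)" by (subst open_subopen) blast
    then show "openin euclidean (g -` U \<inter> topspace euclidean)" by simp
  next
    have "g ` topspace euclidean \<subseteq> topspace (C_top \<infinity> S)" using C by auto
    then show "g ` topspace euclidean \<subseteq> \<Union> {C_ball \<infinity> S K bs \<epsilon> f |K bs \<epsilon> f. compact K \<and> K \<subseteq> S \<and> set bs \<subseteq> Basis \<and> enat (length bs) < \<infinity> + 1 \<and> 0 < \<epsilon> \<and> f \<in> C_fun \<infinity> S}"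
      unfolding C_top_def by (simp only: topology_generated_by_topspace)
  qed
qed

end

section \<open>The three domains, and maps into the smooth functions on the half-plane\<close>

abbreviation half_plane :: "(real \<times> real) set"
  where "half_plane \<equiv> {0..} \<times> UNIV"

lemma interior_half_plane: "interior half_plane = {0<..} \<times> UNIV"
  by (simp add: interior_Times)

abbreviation half_space :: "(real \<times> real \<times> real) set"
  where "half_space \<equiv> {0..} \<times> UNIV \<times> UNIV"

interpretation line: regular_closed_domain "UNIV :: real set"
  by standard simp

interpretation half_plane: regular_closed_domain half_plane
  by standard (simp add: interior_half_plane closure_Times)

interpretation half_space: regular_closed_domain half_space
  by standard (simp add: interior_Times closure_Times)

text \<open>Membership in \<open>Ck\<close> says nothing about negative times; the value 0 there is
  the normalization of \<open>C_fun\<close>.\<close>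

definition slice :: "('p \<times> real \<times> real \<Rightarrow> real) \<Rightarrow> 'p \<Rightarrow> real \<times> real \<Rightarrow> real"
  where "slice g p = (\<lambda>(t, x). if 0 \<le> t then g (p, t, x) else 0)"

lemma (in flows) continuous_slice:
  assumes "\<And>k. Ck fl k g"
  shows "continuous_map euclidean (C_top \<infinity> half_plane) (slice g)"
proof -
  define ok where "ok d g g' \<longleftrightarrow> has_dir_deriv fl d g g' \<and> (\<forall>k. Ck fl k g')" for d g g'
  \<comment> \<open>The basis of the plane is (1, 0) and (0, 1); all arguments other than (1, 0) are
    sent to \<open>Dx\<close>.\<close>
  define dir :: "real \<times> real \<Rightarrow> 'i dir" where "dir b = (if b = (1, 0) then Dt else Dx)" for b
  \<comment> \<open>The head of the list is differentiated last, as in \<open>partials\<close>. Each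
    choice keeps smoothness of all orders, so the recursion never runs out of derivatives.\<close>
  define G where "G = rec_list g (\<lambda>b _ f. SOME f'. ok (dir b) f f')"
  have smooth: "\<forall>k. Ck fl k (G bs)" for bs
  proof (induction bs)
    case (Cons b bs)
    then have "\<exists>f'. ok (dir b) (G bs) f'" unfolding ok_def by (intro smooth_dir_deriv) blast
    from someI_ex[OF this] show ?case by (simp add: G_def ok_def)
  qed (simp add: G_def assms)
  have step: "has_dir_deriv fl (dir b) (G bs) (G (b # bs))" for b bs
  proof -
    have "\<exists>f'. ok (dir b) (G bs) f'" unfolding ok_def using smooth by (intro smooth_dir_deriv) blast
    from someI_ex[OF this] show ?thesis by (simp add: G_def ok_def)
  qed
  show ?thesis
  proof (rule half_plane.continuous_map_into_C_top[where G = "\<lambda>bs p x. G bs (p, x)"])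
    show "slice g p x = 0" if "x \<notin> half_plane" for p x
      using that by (cases x) (simp add: slice_def)
    show "G [] (p, x) = slice g p x" if "x \<in> half_plane" for p x
      using that by (auto simp: slice_def G_def)
    show "continuous_on (UNIV \<times> half_plane) (\<lambda>(p, x). G bs (p, x))" for bs
      using Ck_continuous[OF smooth[of bs, rule_format, of 0]] by simp
    show "((\<lambda>t. G bs (p, x + t *\<^sub>R b)) has_real_derivative G (b # bs) (p, x)) (at 0)"
      if "b \<in> Basis" "x \<in> interior half_plane" for bs b p x
    proof -
      obtain s z where x: "x = (s, z)" by force
      have s: "s > 0" using that(2) by (simp add: x interior_half_plane)
      have "b = (1, 0) \<or> b = (0, 1)" using that(1) by (auto simp: Basis_prod_def)
      then have "(p, x + t *\<^sub>R b) = move fl (dir b) t (p, s, z)" for t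
        by (auto simp: dir_def x)
      with has_dir_derivD[OF step[of b bs] s, of p z] show ?thesis by (simp add: x)
    qed
  qed
qed

text \<open>Parameters in which only continuity matters carry the trivial flow.\<close>

abbreviation no_flow :: "unit \<Rightarrow> real \<Rightarrow> 'p \<Rightarrow> 'p"
  where "no_flow \<equiv> \<lambda>_ _ p. p"

section \<open>Integrals over a parameter with the trivial flow\<close>

lemma flows_no_flow: "flows (no_flow :: unit \<Rightarrow> real \<Rightarrow> 'p::topological_space \<Rightarrow> 'p)"
  by standard auto

lemma has_dir_deriv_no_flow: "has_dir_deriv no_flow (Dp i) g (\<lambda>_. 0)"
  by (rule has_dir_derivI) simp

text \<open>A continuous substitution in the parameter keeps the derivatives in t and x but forgets
  those along the flows \<open>fl\<close>, so the result lives over the trivial flow.\<close>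

lemma Ck_pullback:
  fixes \<kappa> :: "'q::topological_space \<Rightarrow> 'p::topological_space"
  assumes "Ck fl k g" "continuous_on UNIV \<kappa>"
  shows "Ck no_flow k (\<lambda>(q, t, x). g (\<kappa> q, t, x))"
  using assms(1)
proof (induction k arbitrary: g)
  have c: "continuous_on nonneg_time (\<lambda>(q, t, x). g (\<kappa> q, t, x))" if "continuous_on nonneg_time g" for g :: "'p \<times> real \<times> real \<Rightarrow> real"
    unfolding case_prod_unfold
    by (intro continuous_on_compose2[OF that] continuous_intros continuous_on_compose2[OF assms(2)]) auto
  {
    case 0
    then show ?case unfolding Ck.simps(1) by (rule c)
  next
    case (Suc k)
    show ?case
      unfolding Ck.simps(2)
    proof (intro conjI allI)
      fix d :: "unit dir"
      show "\<exists>g'. has_dir_deriv no_flow d (\<lambda>(q, t, x). g (\<kappa> q, t, x)) g' \<and> Ck no_flow k g'"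
      proof (cases d)
        case (Dp i)
        show ?thesis unfolding Dp by (intro exI[of _ "\<lambda>_. 0"] conjI has_dir_deriv_no_flow Ck_const)
      next
        case Dt
        from Suc.prems obtain g' where g': "has_dir_deriv fl Dt g g'" "Ck fl k g'" unfolding Ck.simps(2) by blast
        have "has_dir_deriv no_flow Dt (\<lambda>(q, t, x). g (\<kappa> q, t, x)) (\<lambda>(q, t, x). g' (\<kappa> q, t, x))"
          by (rule has_dir_derivI) (use has_dir_derivD[OF g'(1)] in simp)
        with Suc.IH[OF g'(2)] show ?thesis unfolding Dt by blast
      next
        case Dx
        from Suc.prems obtain g' where g': "has_dir_deriv fl Dx g g'" "Ck fl k g'" unfolding Ck.simps(2) by blast
        have "has_dir_deriv no_flow Dx (\<lambda>(q, t, x). g (\<kappa> q, t, x)) (\<lambda>(q, t, x). g' (\<kappa> q, t, x))"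
          by (rule has_dir_derivI) (use has_dir_derivD[OF g'(1)] in simp)
        with Suc.IH[OF g'(2)] show ?thesis unfolding Dx by blast
      qed
    qed (rule c[OF Ck_continuous[OF Suc.prems]])
  }
qed

text \<open>Leibniz' rule over the compact interval of \<open>r\<close>, order by order; the
  integration variable is the last component of the parameter and does not move.\<close>

lemma Ck_param_integral:
  fixes g :: "('q::topological_space \<times> real) \<times> real \<times> real \<Rightarrow> real"
  assumes "Ck no_flow k g"
  shows "Ck no_flow k (\<lambda>(q, t, x). integral {0..1} (\<lambda>r. g ((q, r), t, x)))"
  using assms
proof (induction k arbitrary: g)
  have c: "continuous_on nonneg_time (\<lambda>(q, t, x). integral {0..1} (\<lambda>r. g ((q, r), t, x)))"
    if "continuous_on nonneg_time g" for g :: "('q \<times> real) \<times> real \<times> real \<Rightarrow> real"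
    unfolding case_prod_unfold
    by (intro continuous_on_integral_param, unfold case_prod_unfold)
      (auto intro!: continuous_on_compose2[OF that] continuous_intros)
  {
    case 0
    then show ?case unfolding Ck.simps(1) by (rule c)
  next
    case (Suc k)
    interpret no_flow: flows "no_flow :: unit \<Rightarrow> real \<Rightarrow> ('q \<times> real) \<Rightarrow> ('q \<times> real)" by (rule flows_no_flow)
    note g = Ck_continuous[OF Suc.prems]
    show ?case
      unfolding Ck.simps(2)
    proof (intro conjI allI)
      fix d :: "unit dir"
      show "\<exists>g'. has_dir_deriv no_flow d (\<lambda>(q, t, x). integral {0..1} (\<lambda>r. g ((q, r), t, x))) g' \<and> Ck no_flow k g'"
      proof (cases "\<exists>i. d = Dp i")
        case True
        then show ?thesis by (blast intro: has_dir_deriv_no_flow Ck_const)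
      next
        case False
        from Suc.prems obtain g' where g': "has_dir_deriv no_flow d g g'" "Ck no_flow k g'" unfolding Ck.simps(2) by blast
        have mv': "move no_flow d h ((q, r), t, x) = ((q, r), snd (move no_flow d h ((q, 0::real), t, x)))" for h r t x and q :: 'q
          using False by (cases d) auto
        have "has_dir_deriv no_flow d (\<lambda>(q, t, x). integral {0..1} (\<lambda>r. g ((q, r), t, x))) (\<lambda>(q, t, x). integral {0..1} (\<lambda>r. g' ((q, r), t, x)))"
        proof (rule has_dir_derivI)
          fix q :: 'q and t x :: real assume t: "t > 0"
          \<comment> \<open>Steps shorter than t keep the time positive even in the direction
            \<open>Dt\<close>.\<close>
          have pos: "0 < fst (snd (move no_flow d h ((q, r), t, x)))" if "h \<in> {-t<..<t}" for h r
            using that False by (cases d) (use t in auto)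
          have cmv: "continuous_on A (\<lambda>z. f (move no_flow d (a z) ((q, b z), t, x)))"
            if f: "continuous_on nonneg_time f" and c: "continuous_on A a" "continuous_on A b" and a: "\<And>z. z \<in> A \<Longrightarrow> a z \<in> {-t<..<t}"
            for A :: "(real \<times> real) set" and a b and f :: "('q \<times> real) \<times> real \<times> real \<Rightarrow> real"
            unfolding mv'[of _ _ "b _"]
          proof (rule continuous_on_compose2[OF f])
            show "continuous_on A (\<lambda>z. ((q, b z), snd (move no_flow d (a z) ((q, 0::real), t, x))))"
              using c by (cases d) (auto intro!: continuous_intros)
          qed (intro image_subsetI, simp add: mem_Times_iff less_imp_le[OF pos[OF a]])
          have cmv1: "continuous_on {0..1} (\<lambda>r. g (move no_flow d h ((q, r), t, x)))" if "h \<in> {-t<..<t}" for h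
            by (rule continuous_on_compose2[OF cmv[OF g, of "{h} \<times> {0..1}" fst snd], of "{0..1}" "\<lambda>r. (h, r)",
                unfolded fst_conv snd_conv]) (use that in \<open>auto intro!: continuous_intros\<close>)
          have "((\<lambda>h. integral (cbox 0 1) (\<lambda>r. g (move no_flow d h ((q, r), t, x)))) has_real_derivative
              integral (cbox 0 1) (\<lambda>r. g' (move no_flow d 0 ((q, r), t, x)))) (at 0 within {-t<..<t})"
          proof (rule leibniz_rule_field_derivative)
            show "((\<lambda>h. g (move no_flow d h ((q, r), t, x))) has_real_derivative g' (move no_flow d h ((q, r), t, x))) (at h within {-t<..<t})"
              if "h \<in> {-t<..<t}" for h r
              by (rule has_field_derivative_at_within, rule no_flow.has_dir_deriv_along[OF g'(1) pos[OF that]])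
            show "(\<lambda>r. g (move no_flow d h ((q, r), t, x))) integrable_on cbox 0 1" if "h \<in> {-t<..<t}" for h
              using cmv1[OF that] by (intro integrable_continuous) simp
            show "continuous_on ({-t<..<t} \<times> cbox 0 1) (\<lambda>(h, r). g' (move no_flow d h ((q, r), t, x)))"
              unfolding case_prod_unfold by (rule cmv[OF Ck_continuous[OF g'(2)]]) (auto intro!: continuous_intros)
          qed (use t in auto)
          then have "((\<lambda>h. integral {0..1} (\<lambda>r. g (move no_flow d h ((q, r), t, x)))) has_real_derivative
              integral {0..1} (\<lambda>r. g' ((q, r), t, x))) (at 0)"
            using t by (simp add: at_within_open[of 0 "{-t<..<t}"])
          moreover have "(case move no_flow d h (q, t, x) of (q, t, x) \<Rightarrow> integral {0..1} (\<lambda>r. g ((q, r), t, x))) =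
              integral {0..1} (\<lambda>r. g (move no_flow d h ((q, r), t, x)))" for h
            using False by (cases d) auto
          ultimately show "((\<lambda>h. case move no_flow d h (q, t, x) of (q, t, x) \<Rightarrow> integral {0..1} (\<lambda>r. g ((q, r), t, x))) has_real_derivative
              (case (q, t, x) of (q, t, x) \<Rightarrow> integral {0..1} (\<lambda>r. g' ((q, r), t, x)))) (at 0)"
            by simp
        qed
        with Suc.IH[OF g'(2)] show ?thesis by blast
      qed
    qed (rule c[OF g])
  }
qed

text \<open>The other half of the exponential law, from the joint continuity of evaluation. It turns
  the Cauchy data into coefficients that are jointly continuous in parameter and point.\<close>

lemma (in regular_closed_domain) continuous_on_ext_partials:
  fixes g :: "'p::topological_space \<Rightarrow> 'a \<Rightarrow> real"
  assumes g: "continuous_map euclidean (C_top \<infinity> S) g" and bs: "set bs \<subseteq> Basis"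
  shows "continuous_on (UNIV \<times> S) (\<lambda>(p, x). ext_partials S bs (g p) x)"
  unfolding continuous_on_def
proof (intro ballI tendstoI)
  fix q :: "'p \<times> 'a" and e :: real assume q: "q \<in> UNIV \<times> S" and e: "e > 0"
  obtain p0 x0 where q_eq: "q = (p0, x0)" by force
  have gp: "g p0 \<in> C_fun \<infinity> S" using continuous_map_image_subset_topspace[OF g] by auto
  have x0: "x0 \<in> S" using q by (simp add: q_eq)
  obtain U V where UV: "openin (C_top \<infinity> S) U" "g p0 \<in> U" "open V" "x0 \<in> V"
    "\<And>f x. f \<in> U \<Longrightarrow> x \<in> V \<Longrightarrow> x \<in> S \<Longrightarrow> \<bar>ext_partials S bs f x - ext_partials S bs (g p0) x0\<bar> < e"
    by (rule eval_continuous[OF gp x0 bs e]) blast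
  have "open {p. g p \<in> U}" using openin_continuous_map_preimage[OF g UV(1)] by simp
  then show "\<forall>\<^sub>F z in at q within UNIV \<times> S. dist (case z of (p, x) \<Rightarrow> ext_partials S bs (g p) x)
      (case q of (p, x) \<Rightarrow> ext_partials S bs (g p) x) < e"
    unfolding eventually_at_topological
    by (intro exI[of _ "{p. g p \<in> U} \<times> V"]) (use UV in \<open>auto simp: q_eq dist_real_def open_Times\<close>)
qed

section \<open>The Cauchy data as parameters\<close>

lemma functional_topology_E0: "functional_topology E\<^sub>0 (line.evaluations ` line.seminorm_index)"
  unfolding E\<^sub>0_def
  by (intro functional_topology_subtopology line.functional_topology_C_top subspaceI) auto

lemma functional_topology_E1: "functional_topology E\<^sub>1 (half_space.evaluations ` half_space.seminorm_index)"
  unfolding E\<^sub>1_def C_half_S1_R_def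
proof (intro functional_topology_subtopology half_space.functional_topology_C_top)
  let ?V = "{\<phi> :: real \<times> real \<times> real \<Rightarrow> real. \<forall>T\<ge>0. \<exists>M. \<forall>t \<eta> \<xi>. 0 \<le> t \<and> t \<le> T \<and> \<bar>\<xi>\<bar> \<ge> M \<longrightarrow> \<phi> (t, \<eta>, \<xi>) = 0}"
  show "subspace ?V"
  proof (rule subspaceI)
    fix f g assume fg: "f \<in> ?V" "g \<in> ?V"
    show "f + g \<in> ?V"
    proof (intro CollectI allI impI)
      fix T :: real assume T: "T \<ge> 0"
      from fg T obtain M N where "\<forall>t \<eta> \<xi>. 0 \<le> t \<and> t \<le> T \<and> \<bar>\<xi>\<bar> \<ge> M \<longrightarrow> f (t, \<eta>, \<xi>) = 0"
        "\<forall>t \<eta> \<xi>. 0 \<le> t \<and> t \<le> T \<and> \<bar>\<xi>\<bar> \<ge> N \<longrightarrow> g (t, \<eta>, \<xi>) = 0"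
        unfolding mem_Collect_eq by meson
      then show "\<exists>M. \<forall>t \<eta> \<xi>. 0 \<le> t \<and> t \<le> T \<and> \<bar>\<xi>\<bar> \<ge> M \<longrightarrow> (f + g) (t, \<eta>, \<xi>) = 0"
        by (intro exI[of _ "max M N"]) simp
    qed
  next
    fix c f assume f: "f \<in> ?V"
    show "c *\<^sub>R f \<in> ?V"
    proof (intro CollectI allI impI)
      fix T :: real assume T: "T \<ge> 0"
      from f T obtain M where "\<forall>t \<eta> \<xi>. 0 \<le> t \<and> t \<le> T \<and> \<bar>\<xi>\<bar> \<ge> M \<longrightarrow> f (t, \<eta>, \<xi>) = 0"
        unfolding mem_Collect_eq by meson
      then show "\<exists>M. \<forall>t \<eta> \<xi>. 0 \<le> t \<and> t \<le> T \<and> \<bar>\<xi>\<bar> \<ge> M \<longrightarrow> (c *\<^sub>R f) (t, \<eta>, \<xi>) = 0"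
        by (intro exI[of _ M]) simp
    qed
  qed simp
qed (intro subspaceI; simp)

lemma functional_topology_F: "functional_topology F_space (half_plane.evaluations ` half_plane.seminorm_index)"
  unfolding F_space_def C_half_S1_def
  by (intro functional_topology_subtopology half_plane.functional_topology_C_top subspaceI) auto

lemma locally_convex_E: "locally_convex_space E_space"
  unfolding E_space_def
  using functional_topology_prod[OF functional_topology_E0 functional_topology_E1]
  by (rule functional_topology.locally_convex)

lemma subspace_E: "subspace (topspace E_space)"
  using locally_convex_E by (simp add: locally_convex_space_def)

lemma topspace_E0: "y \<in> topspace E\<^sub>0 \<longleftrightarrow> y \<in> C_fun \<infinity> UNIV \<and> (\<forall>\<eta>. y (\<eta> + 1) = y \<eta>)"
  by (simp add: E\<^sub>0_def)

lemma topspace_E1: "\<phi> \<in> topspace E\<^sub>1 \<longleftrightarrow> \<phi> \<in> C_fun \<infinity> half_space \<and>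
    (\<forall>t\<ge>0. \<forall>\<eta> \<xi>. \<phi> (t, \<eta> + 1, \<xi>) = \<phi> (t, \<eta>, \<xi>)) \<and>
    (\<forall>T\<ge>0. \<exists>M. \<forall>t \<eta> \<xi>. 0 \<le> t \<and> t \<le> T \<and> \<bar>\<xi>\<bar> \<ge> M \<longrightarrow> \<phi> (t, \<eta>, \<xi>) = 0)"
  by (simp add: E\<^sub>1_def C_half_S1_R_def)

lemma topspace_E: "(y, \<phi>) \<in> topspace E_space \<longleftrightarrow> y \<in> topspace E\<^sub>0 \<and> \<phi> \<in> topspace E\<^sub>1"
  by (simp add: E_space_def)

lemma continuous_fst_E: "continuous_map E_space (C_top \<infinity> UNIV) fst"
  and continuous_snd_E: "continuous_map E_space (C_top \<infinity> half_space) snd"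
  using continuous_map_fst[of E\<^sub>0 E\<^sub>1] continuous_map_snd[of E\<^sub>0 E\<^sub>1]
  unfolding E_space_def E\<^sub>0_def E\<^sub>1_def C_half_S1_R_def continuous_map_in_subtopology by blast+

text \<open>
  A type of its own for the points of \<^term>\<open>E_space\<close>: the type of pairs of functions already carries
  the topology of pointwise convergence.
\<close>

typedef cauchy_data = "topspace E_space" morphisms data_rep data_abs
  using subspace_E subspace_0 by blast

declare data_rep [simp]

instantiation cauchy_data :: topological_space
begin

definition open_cauchy_data :: "cauchy_data set \<Rightarrow> bool"
  where "open_cauchy_data U \<longleftrightarrow> openin E_space (data_rep ` U)"

instance
proof
  have "range data_rep = topspace E_space"
    using type_definition.Rep_range[OF type_definition_cauchy_data] .
  then show "open (UNIV :: cauchy_data set)" by (simp add: open_cauchy_data_def)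
  show "open (S \<inter> T)" if "open S" "open T" for S T :: "cauchy_data set"
    using that by (simp add: open_cauchy_data_def image_Int inj_def data_rep_inject openin_Int)
  show "open (\<Union>K)" if "\<forall>S\<in>K. open S" for K :: "cauchy_data set set"
    using that by (auto simp: open_cauchy_data_def image_Union intro!: openin_Union)
qed

end

lemma continuous_data_rep: "continuous_map euclidean E_space data_rep"
  unfolding continuous_map_def
proof (intro conjI allI impI)
  fix U assume U: "openin E_space U"
  have "data_rep ` {x. data_rep x \<in> U} = U"
    using openin_subset[OF U] data_abs_inverse by (auto simp: image_iff) (metis subsetD)
  with U show "openin euclidean {x \<in> topspace euclidean. data_rep x \<in> U}"
    by (simp add: open_cauchy_data_def)
qed auto

lemma continuous_data_abs: "continuous_map E_space euclidean data_abs"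
  unfolding continuous_map_def
proof (intro conjI allI impI)
  fix U :: "cauchy_data set" assume U: "openin euclidean U"
  have "{x \<in> topspace E_space. data_abs x \<in> U} = data_rep ` U"
    using data_abs_inverse data_rep_inverse by (force simp: image_iff)
  with U show "openin E_space {x \<in> topspace E_space. data_abs x \<in> U}"
    by (simp add: open_cauchy_data_def)
qed auto

text \<open>
  A base point together with a sequence of tangent vectors. The \<open>i\<close>-th flow moves the base point
  along the \<open>i\<close>-th tangent vector and keeps all tangent vectors, so differentiating successively
  along the flows 0, \<dots>, \<open>l - 1\<close> yields \<open>d\<^sup>l f(x)(u\<^sub>0, \<dots>, u\<^bsub>l-1\<^esub>)\<close>.
\<close>

type_synonym params = "cauchy_data \<times> (nat \<Rightarrow> cauchy_data)"

section \<open>Derivatives of the Cauchy data along the flows\<close>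

definition init :: "cauchy_data \<Rightarrow> real \<Rightarrow> real" where "init e = fst (data_rep e)"

definition source :: "cauchy_data \<Rightarrow> real \<times> real \<times> real \<Rightarrow> real" where "source e = snd (data_rep e)"

definition data_shift :: "real \<Rightarrow> cauchy_data \<Rightarrow> cauchy_data \<Rightarrow> cauchy_data"
  where "data_shift h v e = data_abs (data_rep e + h *\<^sub>R data_rep v)"

definition data_flow :: "nat \<Rightarrow> real \<Rightarrow> params \<Rightarrow> params"
  where "data_flow i h p = (data_shift h (snd p i) (fst p), snd p)"

primrec component :: "nat option \<Rightarrow> params \<Rightarrow> cauchy_data"
  where "component None p = fst p" | "component (Some i) p = snd p i"

lemma data_rep_shift: "data_rep (data_shift h v e) = data_rep e + h *\<^sub>R data_rep v"
  unfolding data_shift_def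
  by (intro data_abs_inverse subspace_add[OF subspace_E] subspace_scale[OF subspace_E] data_rep)

lemma init_shift: "init (data_shift h v e) = 1 *\<^sub>R init e + h *\<^sub>R init v"
  and source_shift: "source (data_shift h v e) = 1 *\<^sub>R source e + h *\<^sub>R source v"
  by (simp_all add: init_def source_def data_rep_shift)

lemma init_mem: "init e \<in> topspace E\<^sub>0" and source_mem: "source e \<in> topspace E\<^sub>1"
  using data_rep[of e] topspace_E[of "init e" "source e"] by (auto simp: init_def source_def)

lemma init_C_fun: "init e \<in> C_fun \<infinity> UNIV" and source_C_fun: "source e \<in> C_fun \<infinity> half_space"
  using init_mem source_mem topspace_E0 topspace_E1 by blast+

interpretation data_flow: flows data_flow
proof
  show "data_flow i 0 p = p" for i p
    by (simp add: data_flow_def data_shift_def data_rep_inverse)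
  show "data_flow i (h + k) p = data_flow i h (data_flow i k p)" for i h k p
  proof -
    have "data_rep (data_shift (h + k) v e) = data_rep (data_shift h v (data_shift k v e))" for v e
      by (simp add: data_rep_shift algebra_simps)
    then show ?thesis by (simp add: data_flow_def data_rep_inject)
  qed
  show "continuous_on UNIV (\<lambda>h. data_flow i h p)" for i p
  proof -
    have "continuous_map euclideanreal euclidean (data_abs \<circ> (\<lambda>h. data_rep (fst p) + h *\<^sub>R data_rep (snd p i)))"
      by (rule continuous_map_compose[OF continuous_line[OF locally_convex_E] continuous_data_abs]) simp_all
    then have "continuous_on UNIV (\<lambda>h. data_shift h (snd p i) (fst p))"
      by (simp add: o_def data_shift_def)
    then show ?thesis unfolding data_flow_def by (intro continuous_intros)
  qed
qed

lemma continuous_component: "continuous_on UNIV (component j)"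
proof (cases j)
  case None
  have "component j = fst" using None by auto
  then show ?thesis by (simp add: continuous_on_fst continuous_on_id)
next
  case (Some i)
  have eq: "component j = (\<lambda>p. snd p i)" using Some by auto
  have "continuous_on UNIV (snd :: params \<Rightarrow> _)" by (intro continuous_intros)
  then show ?thesis unfolding eq by (rule continuous_on_product_then_coordinatewise)
qed

text \<open>A family closed under differentiation: \<open>Dx\<close> and, up to sign,
  \<open>Dt\<close> raise \<open>n\<close>; the flow \<open>i\<close> turns the base point
  (\<open>None\<close>) into tangent vector \<open>i\<close>, as the data enter linearly, and
  annihilates the tangent vectors, which it does not move. Smoothness is then an induction over the
  family.\<close>

definition init_deriv :: "nat \<Rightarrow> nat option \<Rightarrow> params \<Rightarrow> real \<Rightarrow> real"
  where "init_deriv n j p = ext_partials UNIV (replicate n 1) (init (component j p))"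

text \<open>The same scheme with derivatives in all three variables. The \<xi>-variable is stored
  with the parameters, as \<open>superpose\<close> expects, whence the permuted arguments.\<close>

definition source_deriv :: "(real \<times> real \<times> real) list \<Rightarrow> nat option \<Rightarrow> (params \<times> real) \<times> real \<times> real \<Rightarrow> real"
  where "source_deriv bs j = (\<lambda>((p, \<xi>), t, x). ext_partials half_space bs (source (component j p)) (t, x, \<xi>))"

lemma continuous_init_deriv: "continuous_on UNIV (\<lambda>(p, s). init_deriv n j p s)"
proof -
  have "continuous_map euclidean euclidean (component j)" using continuous_component by simp
  from continuous_map_compose[OF continuous_map_compose[OF this continuous_data_rep] continuous_fst_E]
  have "continuous_map euclidean (C_top \<infinity> UNIV) (\<lambda>p. init (component j p))"
    by (simp add: o_def init_def)
  from line.continuous_on_ext_partials[OF this, of "replicate n 1"] show ?thesis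
    by (auto simp: init_deriv_def set_replicate_conv_if split: if_splits)
qed

lemma continuous_source_deriv:
  assumes "set bs \<subseteq> Basis"
  shows "continuous_on nonneg_time (source_deriv bs j)"
proof -
  have "continuous_map euclidean euclidean (component j)" using continuous_component by simp
  from continuous_map_compose[OF continuous_map_compose[OF this continuous_data_rep] continuous_snd_E]
  have "continuous_map euclidean (C_top \<infinity> half_space) (\<lambda>p. source (component j p))"
    by (simp add: o_def source_def)
  from half_space.continuous_on_ext_partials[OF this assms]
  have "continuous_on (UNIV \<times> half_space) (\<lambda>(p, x). ext_partials half_space bs (source (component j p)) x)" .
  note c = continuous_on_curried2[OF this]
  show ?thesis
    unfolding source_deriv_def case_prod_unfold by (rule c) (auto intro!: continuous_intros)
qed

lemma init_deriv_derivative: "((\<lambda>h. init_deriv n j p (s + h)) has_real_derivative init_deriv (Suc n) j p (s + h)) (at h)"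
proof -
  have "((\<lambda>k. init_deriv n j p ((s + h) + k *\<^sub>R 1)) has_real_derivative init_deriv (Suc n) j p (s + h)) (at 0)"
    unfolding init_deriv_def replicate_Suc
    by (rule line.ext_partials_deriv[OF init_C_fun]) auto
  then show ?thesis
    using DERIV_shift[of "\<lambda>h. init_deriv n j p (s + h)" "init_deriv (Suc n) j p (s + h)" 0 h]
    by (simp add: add_ac)
qed

lemma init_deriv_flow:
  "init_deriv n None (data_flow i h p) s = init_deriv n None p s + h * init_deriv n (Some i) p s"
  "init_deriv n (Some k) (data_flow i h p) s = init_deriv n (Some k) p s"
proof -
  have "ext_partials UNIV (replicate n 1) (1 *\<^sub>R init (fst p) + h *\<^sub>R init (snd p i)) s =
      1 * ext_partials UNIV (replicate n 1) (init (fst p)) s + h * ext_partials UNIV (replicate n 1) (init (snd p i)) s"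
    by (rule line.C_fun_linear(2)) (auto intro: init_C_fun)
  then show "init_deriv n None (data_flow i h p) s = init_deriv n None p s + h * init_deriv n (Some i) p s"
    by (simp only: init_deriv_def component.simps data_flow_def fst_conv snd_conv init_shift mult_1)
qed (simp add: init_deriv_def data_flow_def)

lemma source_deriv_flow:
  assumes "set bs \<subseteq> Basis" "t \<ge> 0"
  shows "source_deriv bs None ((data_flow i h p, \<xi>), t, x) = source_deriv bs None ((p, \<xi>), t, x) + h * source_deriv bs (Some i) ((p, \<xi>), t, x)"
    "source_deriv bs (Some k) ((data_flow i h p, \<xi>), t, x) = source_deriv bs (Some k) ((p, \<xi>), t, x)"
proof -
  have "ext_partials half_space bs (1 *\<^sub>R source (fst p) + h *\<^sub>R source (snd p i)) (t, x, \<xi>) =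
      1 * ext_partials half_space bs (source (fst p)) (t, x, \<xi>) + h * ext_partials half_space bs (source (snd p i)) (t, x, \<xi>)"
    by (rule half_space.C_fun_linear(2)[OF source_C_fun source_C_fun assms(1)]) (use assms(2) in simp)
  then show "source_deriv bs None ((data_flow i h p, \<xi>), t, x) = source_deriv bs None ((p, \<xi>), t, x) + h * source_deriv bs (Some i) ((p, \<xi>), t, x)"
    by (simp only: source_deriv_def component.simps data_flow_def fst_conv snd_conv source_shift mult_1 case_prod_conv)
qed (simp add: source_deriv_def data_flow_def)

lemma Ck_init_deriv: "Ck data_flow k (\<lambda>(p, t, x). init_deriv n j p (x - t))"
proof (induction k arbitrary: n j)
  have c: "continuous_on nonneg_time (\<lambda>(p, t, x). init_deriv n j p (x - t))" for n j
    unfolding case_prod_unfold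
    by (intro continuous_on_compose2[OF continuous_init_deriv, unfolded case_prod_unfold, of _ "\<lambda>q. (fst q, snd (snd q) - fst (snd q))" n j, simplified])
      (auto intro!: continuous_intros)
  {
    case 0
    then show ?case unfolding Ck.simps(1) by (rule c)
  next
    case (Suc k)
    show ?case
      unfolding Ck.simps(2)
    proof (intro conjI allI)
      fix d :: "nat dir"
      show "\<exists>g'. has_dir_deriv data_flow d (\<lambda>(p, t, x). init_deriv n j p (x - t)) g' \<and> Ck data_flow k g'"
      proof (cases d)
        case Dt
        have "has_dir_deriv data_flow Dt (\<lambda>(p, t, x). init_deriv n j p (x - t)) (\<lambda>q. - (case q of (p, t, x) \<Rightarrow> init_deriv (Suc n) j p (x - t)))"
        proof (rule has_dir_derivI)
          fix p t x
          have "((\<lambda>h. init_deriv n j p ((x - t) + (- h))) has_real_derivative init_deriv (Suc n) j p ((x - t) + (- 0)) * (-1)) (at 0)"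
            by (rule DERIV_chain2[where f = "\<lambda>h. init_deriv n j p ((x - t) + h)" and g = uminus], rule init_deriv_derivative)
              (auto intro!: derivative_eq_intros)
          then show "((\<lambda>h. case move data_flow Dt h (p, t, x) of (p, t, x) \<Rightarrow> init_deriv n j p (x - t)) has_real_derivative
              - (case (p, t, x) of (p, t, x) \<Rightarrow> init_deriv (Suc n) j p (x - t))) (at 0)"
            by (simp add: algebra_simps)
        qed
        with data_flow.Ck_minus[OF Suc.IH] show ?thesis unfolding Dt by blast
      next
        case Dx
        have "has_dir_deriv data_flow Dx (\<lambda>(p, t, x). init_deriv n j p (x - t)) (\<lambda>(p, t, x). init_deriv (Suc n) j p (x - t))"
        proof (rule has_dir_derivI)
          fix p t x
          show "((\<lambda>h. case move data_flow Dx h (p, t, x) of (p, t, x) \<Rightarrow> init_deriv n j p (x - t)) has_real_derivative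
              (case (p, t, x) of (p, t, x) \<Rightarrow> init_deriv (Suc n) j p (x - t))) (at 0)"
            using init_deriv_derivative[of n j p "x - t" 0] by (simp add: algebra_simps)
        qed
        with Suc.IH show ?thesis unfolding Dx by blast
      next
        case (Dp i)
        show ?thesis
        proof (cases j)
          case None
          have "has_dir_deriv data_flow (Dp i) (\<lambda>(p, t, x). init_deriv n j p (x - t)) (\<lambda>(p, t, x). init_deriv n (Some i) p (x - t))"
            by (rule has_dir_derivI) (auto simp: None init_deriv_flow intro!: derivative_eq_intros)
          with Suc.IH show ?thesis unfolding Dp by blast
        next
          case (Some m)
          have "has_dir_deriv data_flow (Dp i) (\<lambda>(p, t, x). init_deriv n j p (x - t)) (\<lambda>_. 0)"
            by (rule has_dir_derivI) (auto simp: Some init_deriv_flow)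
          then show ?thesis unfolding Dp using Ck_const by blast
        qed
      qed
    qed (rule c)
  }
qed

lemma Ck_source_deriv: "set bs \<subseteq> Basis \<Longrightarrow> Ck (lift_flow data_flow) k (source_deriv bs j)"
proof (induction k arbitrary: bs j)
  case 0
  then show ?case by (simp add: continuous_source_deriv)
next
  case (Suc k)
  \<comment> \<open>Time, space and \<xi> are treated at once: each of these moves translates (t, x,
    \<xi>) by a multiple of a basis vector \<open>b\<close>.\<close>
  have dir: "has_dir_deriv (lift_flow data_flow) d (source_deriv bs j) (source_deriv (b # bs) j)"
    if b: "b \<in> Basis" and mv: "\<And>p \<xi> t x h. move (lift_flow data_flow) d h ((p, \<xi>), t, x) =
       ((p, \<xi> + h * snd (snd b)), t + h * fst b, x + h * fst (snd b))" for d b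
  proof (rule has_dir_derivI)
    fix q :: "params \<times> real" and t x :: real assume t: "t > 0"
    obtain p \<xi> where q: "q = (p, \<xi>)" by (cases q)
    have "((\<lambda>h. ext_partials half_space bs (source (component j p)) ((t, x, \<xi>) + h *\<^sub>R b)) has_real_derivative
        ext_partials half_space (b # bs) (source (component j p)) (t, x, \<xi>)) (at 0)"
      by (rule half_space.ext_partials_deriv[OF source_C_fun Suc.prems b]) (use t in \<open>simp add: interior_Times\<close>)
    moreover have "(t, x, \<xi>) + h *\<^sub>R b = (t + h * fst b, x + h * fst (snd b), \<xi> + h * snd (snd b))" for h
      by (cases b) simp
    ultimately show "((\<lambda>h. source_deriv bs j (move (lift_flow data_flow) d h (q, t, x))) has_real_derivative source_deriv (b # bs) j (q, t, x)) (at 0)"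
      by (simp add: q mv source_deriv_def)
  qed
  have B: "(1, 0, 0) \<in> (Basis :: (real \<times> real \<times> real) set)" "(0, 1, 0) \<in> (Basis :: (real \<times> real \<times> real) set)" "(0, 0, 1) \<in> (Basis :: (real \<times> real \<times> real) set)"
    by (auto simp: Basis_prod_def zero_prod_def)
  have IH: "Ck (lift_flow data_flow) k (source_deriv (b # bs) j)" if "b \<in> Basis" for b
    using that Suc.prems by (intro Suc.IH) auto
  show ?case
    unfolding Ck.simps(2)
  proof (intro conjI allI)
    show "continuous_on nonneg_time (source_deriv bs j)" by (rule continuous_source_deriv[OF Suc.prems])
    fix d :: "nat option dir"
    consider "d = Dt" | "d = Dx" | "d = Dp None" | i where "d = Dp (Some i)" by (metis dir.exhaust option.exhaust)
    then show "\<exists>g'. has_dir_deriv (lift_flow data_flow) d (source_deriv bs j) g' \<and> Ck (lift_flow data_flow) k g'"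
    proof cases
      case 1
      then show ?thesis using dir[OF B(1), of d] IH[OF B(1)] by auto
    next
      case 2
      then show ?thesis using dir[OF B(2), of d] IH[OF B(2)] by auto
    next
      case 3
      then show ?thesis using dir[OF B(3), of d] IH[OF B(3)] by auto
    next
      case 4
      show ?thesis
      proof (cases j)
        case None
        have "has_dir_deriv (lift_flow data_flow) (Dp (Some i)) (source_deriv bs j) (source_deriv bs (Some i))"
        proof (rule has_dir_derivI)
          fix q :: "params \<times> real" and t x :: real assume t: "t > 0"
          obtain p \<xi> where q: "q = (p, \<xi>)" by (cases q)
          show "((\<lambda>h. source_deriv bs j (move (lift_flow data_flow) (Dp (Some i)) h (q, t, x))) has_real_derivative source_deriv bs (Some i) (q, t, x)) (at 0)"
            using t by (auto simp: q None source_deriv_flow[OF Suc.prems] intro!: derivative_eq_intros)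
        qed
        with Suc.IH[OF Suc.prems] show ?thesis unfolding 4 by blast
      next
        case (Some m)
        have "has_dir_deriv (lift_flow data_flow) (Dp (Some i)) (source_deriv bs j) (\<lambda>_. 0)"
        proof (rule has_dir_derivI)
          fix q :: "params \<times> real" and t x :: real assume t: "t > 0"
          obtain p \<xi> where q: "q = (p, \<xi>)" by (cases q)
          show "((\<lambda>h. source_deriv bs j (move (lift_flow data_flow) (Dp (Some i)) h (q, t, x))) has_real_derivative 0) (at 0)"
            using t by (simp add: q Some source_deriv_flow[OF Suc.prems])
        qed
        then show ?thesis unfolding 4 using Ck_const by blast
      qed
    qed
  qed
qed

section \<open>The solution map\<close>

lemma topspace_E1_vanishing:
  assumes "\<phi> \<in> topspace E\<^sub>1" "0 \<le> T"
  shows "\<exists>M. \<forall>t \<eta> \<xi>. 0 \<le> t \<and> t \<le> T \<and> \<bar>\<xi>\<bar> \<ge> M \<longrightarrow> \<phi> (t, \<eta>, \<xi>) = 0"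
  by (rule assms(1)[unfolded topspace_E1, THEN conjunct2, THEN conjunct2, THEN spec, THEN mp, OF assms(2)])

text \<open>Mere continuity of \<open>v\<close> and \<open>w\<close> is assumed, so the result
  applies to an arbitrary \<open>y\<close> of \<open>Sol\<close> and to translates of the
  constructed solution alike.\<close>

lemma characteristic_unique:
  fixes v w :: "real \<Rightarrow> real"
  assumes \<phi>: "\<phi> \<in> topspace E\<^sub>1" and v: "continuous_on {0..} v" and w: "continuous_on {0..} w"
    and veq: "\<And>t. t \<ge> 0 \<Longrightarrow> v t = c + integral {0..t} (\<lambda>r. \<phi> (r, s + r, v r))"
    and weq: "\<And>t. t \<ge> 0 \<Longrightarrow> w t = c + integral {0..t} (\<lambda>r. \<phi> (r, s + r, w r))"
    and t: "t \<ge> 0"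
  shows "v t = w t"
proof (rule ode_unique[OF v w _ _ veq weq t])
  have C: "\<phi> \<in> C_fun \<infinity> half_space" using \<phi> topspace_E1 by blast
  have B: "set [(0, 0, 1)] \<subseteq> (Basis :: (real \<times> real \<times> real) set)" by (auto simp: Basis_prod_def zero_prod_def)
  have c0: "continuous_on half_space \<phi>"
    by (rule continuous_on_eq[OF half_space.continuous_ext_partials[OF C, of "[]"] half_space.ext_partials_Nil[OF C]]) simp
  note c1 = half_space.continuous_ext_partials[OF C B]
  show cont: "continuous_on ({0..} \<times> UNIV) (\<lambda>(t, \<xi>). \<phi> (t, s + t, \<xi>))"
    unfolding case_prod_unfold by (intro continuous_on_compose2[OF c0] continuous_intros) auto
  have cont': "continuous_on ({0..} \<times> UNIV) (\<lambda>(t, \<xi>). ext_partials half_space [(0, 0, 1)] \<phi> (t, s + t, \<xi>))"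
    unfolding case_prod_unfold by (intro continuous_on_compose2[OF c1] continuous_intros) auto
  have d: "((\<lambda>\<xi>. \<phi> (t, s + t, \<xi>)) has_real_derivative ext_partials half_space [(0, 0, 1)] \<phi> (t, s + t, \<xi>)) (at \<xi>)" if t: "t > 0" for t \<xi>
  proof -
    have "((\<lambda>h. ext_partials half_space [] \<phi> ((t, s + t, \<xi>) + h *\<^sub>R (0, 0, 1))) has_real_derivative ext_partials half_space [(0, 0, 1)] \<phi> (t, s + t, \<xi>)) (at 0)"
      by (rule half_space.ext_partials_deriv[OF C]) (use t B in \<open>simp_all add: interior_Times\<close>)
    moreover have "ext_partials half_space [] \<phi> ((t, s + t, \<xi>) + h *\<^sub>R (0, 0, 1)) = \<phi> (t, s + t, \<xi> + h)" for h
    proof -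
      have "(t, s + t, \<xi>) + h *\<^sub>R (0, 0, 1) = (t, s + t, \<xi> + h)" by simp
      then show ?thesis using half_space.ext_partials_Nil[OF C, of "(t, s + t, \<xi> + h)"] t by simp
    qed
    ultimately have "((\<lambda>h. \<phi> (t, s + t, \<xi> + h)) has_real_derivative ext_partials half_space [(0, 0, 1)] \<phi> (t, s + t, \<xi>)) (at 0)"
      by (simp only:)
    then show ?thesis
      using DERIV_shift[of "\<lambda>\<xi>. \<phi> (t, s + t, \<xi>)" "ext_partials half_space [(0, 0, 1)] \<phi> (t, s + t, \<xi>)" 0 \<xi>]
      by (simp only: add.commute[of \<xi>] add_0)
  qed
  have d': "((\<lambda>\<xi>. \<phi> (t, s + t, \<xi>)) has_real_derivative ext_partials half_space [(0, 0, 1)] \<phi> (t, s + t, \<xi>)) (at \<xi>)" if t: "t \<ge> 0" for t \<xi>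
    by (rule has_real_derivative_boundary[OF d cont cont' t])
  show "\<exists>L. \<forall>t\<in>{0..T}. \<forall>\<xi> \<xi>'. \<bar>\<phi> (t, s + t, \<xi>) - \<phi> (t, s + t, \<xi>')\<bar> \<le> L * \<bar>\<xi> - \<xi>'\<bar>" for T
  proof -
    \<comment> \<open>\<open>ode_unique\<close> asks for a Lipschitz constant at every real
      \<open>T\<close>, while vanishing is granted for T \<ge> 0.\<close>
    have T: "max T 0 \<ge> 0" by simp
    from topspace_E1_vanishing[OF \<phi> T] obtain M where M: "\<forall>t \<eta> \<xi>. 0 \<le> t \<and> t \<le> max T 0 \<and> \<bar>\<xi>\<bar> \<ge> M \<longrightarrow> \<phi> (t, \<eta>, \<xi>) = 0"
      by blast
    show ?thesis
      by (rule lipschitz_of_vanishing[OF d' cont', where M = M]) (use M in simp_all)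
  qed
qed

lemma init_deriv_0: "init_deriv 0 None p s = init (fst p) s"
  using line.ext_partials_Nil[OF init_C_fun] by (simp add: init_deriv_def)

lemma source_deriv_Nil: "t \<ge> 0 \<Longrightarrow> source_deriv [] None ((p, \<xi>), t, x) = source (fst p) (t, x, \<xi>)"
  using half_space.ext_partials_Nil[OF source_C_fun] by (simp add: source_deriv_def)

lemma smooth_data_solution:
  "\<exists>y. (\<forall>k. Ck data_flow k y) \<and> (\<forall>p t x. t \<ge> 0 \<longrightarrow>
    y (p, t, x) = init (fst p) (x - t) + integral {0..t} (\<lambda>r. source (fst p) (r, x - t + r, y (p, r, x - t + r))))"
proof -
  obtain y where y: "\<And>k. Ck data_flow k y"
    and eq: "\<And>p t x. t \<ge> 0 \<Longrightarrow> y (p, t, x) = init_deriv 0 None p (x - t) + time_integral (superpose (source_deriv [] None) y) (p, t, x)"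
  proof (rule data_flow.smooth_solution[of "source_deriv [] None" "init_deriv 0 None"])
    show "Ck (lift_flow data_flow) k (source_deriv [] None)" for k by (rule Ck_source_deriv) simp
    show "\<exists>M. \<forall>t x \<xi>. 0 \<le> t \<and> t \<le> T \<and> \<bar>\<xi>\<bar> \<ge> M \<longrightarrow> source_deriv [] None ((p, \<xi>), t, x) = 0" for p T
    proof -
      have T: "max T 0 \<ge> 0" by simp
      from topspace_E1_vanishing[OF source_mem[of "fst p"] T] obtain M where M: "\<forall>t \<eta> \<xi>. 0 \<le> t \<and> t \<le> max T 0 \<and> \<bar>\<xi>\<bar> \<ge> M \<longrightarrow> source (fst p) (t, \<eta>, \<xi>) = 0"
        by blast
      then show ?thesis by (intro exI[of _ M]) (simp add: source_deriv_Nil)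
    qed
    show "continuous_on UNIV (\<lambda>(p, s). init_deriv 0 None p s)" by (rule continuous_init_deriv)
    show "Ck data_flow k (\<lambda>(p, t, x). init_deriv 0 None p (x - t))" for k by (rule Ck_init_deriv)
    show "\<exists>w'. continuous_on UNIV (\<lambda>(p, s). w' p s) \<and> (\<forall>k. Ck data_flow k (\<lambda>(p, t, x). w' p (x - t))) \<and>
      (\<forall>p s h. ((\<lambda>h. case move data_flow d h (p, 0, s) of (p, t, s) \<Rightarrow> init_deriv 0 None p s) has_real_derivative
        (case move data_flow d h (p, 0, s) of (p, t, s) \<Rightarrow> w' p s)) (at h))" if "d \<noteq> Dt" for d
    proof (cases d)
      case Dx
      show ?thesis
        by (rule exI[of _ "init_deriv (Suc 0) None"], intro conjI allI continuous_init_deriv Ck_init_deriv)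
          (simp add: Dx init_deriv_derivative)
    next
      case (Dp i)
      show ?thesis
        by (rule exI[of _ "init_deriv 0 (Some i)"], intro conjI allI continuous_init_deriv Ck_init_deriv)
          (auto simp: Dp init_deriv_flow intro!: derivative_eq_intros)
    qed (use that in simp)
  qed blast
  have "y (p, t, x) = init (fst p) (x - t) + integral {0..t} (\<lambda>r. source (fst p) (r, x - t + r, y (p, r, x - t + r)))" if "t \<ge> 0" for p t x
  proof -
    have "time_integral (superpose (source_deriv [] None) y) (p, t, x) = integral {0..t} (\<lambda>r. source (fst p) (r, x - t + r, y (p, r, x - t + r)))"
      unfolding time_integral_def superpose_def case_prod_conv
      by (rule integral_cong) (simp add: source_deriv_Nil)
    with eq[OF that] show ?thesis by (simp add: init_deriv_0)
  qed
  with y show ?thesis by blast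
qed

section \<open>The solution and its derivatives along the flows\<close>

definition solution :: "params \<times> real \<times> real \<Rightarrow> real"
  where "solution = (SOME y. (\<forall>k. Ck data_flow k y) \<and> (\<forall>p t x. t \<ge> 0 \<longrightarrow>
    y (p, t, x) = init (fst p) (x - t) + integral {0..t} (\<lambda>r. source (fst p) (r, x - t + r, y (p, r, x - t + r)))))"

lemma Ck_solution: "Ck data_flow k solution"
  and solution_eq: "t \<ge> 0 \<Longrightarrow> solution (p, t, x) =
    init (fst p) (x - t) + integral {0..t} (\<lambda>r. source (fst p) (r, x - t + r, solution (p, r, x - t + r)))"
  using someI_ex[OF smooth_data_solution, folded solution_def] by blast+

lemma solution_unique:
  assumes p: "p = fst q" and z: "continuous_on half_plane z"
    and eq: "\<And>t x. t \<ge> 0 \<Longrightarrow> z (t, x) = init p (x - t) + integral {0..t} (\<lambda>r. source p (r, x - t + r, z (r, x - t + r)))"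
    and t: "t \<ge> 0"
  shows "z (t, x) = solution (q, t, x)"
proof -
  \<comment> \<open>The point is written through its foot x - t, so that both sides are functions of
    time on one characteristic.\<close>
  have "z (t, (x - t) + t) = solution (q, t, (x - t) + t)"
  proof (rule characteristic_unique[OF source_mem[of p] _ _ _ _ t, where s = "x - t" and c = "init p (x - t)"
        and v = "\<lambda>t'. z (t', (x - t) + t')" and w = "\<lambda>t'. solution (q, t', (x - t) + t')"])
    show "continuous_on {0..} (\<lambda>t'. z (t', (x - t) + t'))"
      by (rule continuous_on_compose2[OF z]) (auto intro!: continuous_intros)
    show "continuous_on {0..} (\<lambda>t'. solution (q, t', (x - t) + t'))"
      by (rule continuous_on_compose2[OF Ck_continuous[OF Ck_solution[of 0]]]) (auto intro!: continuous_intros)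
    show "z (r, x - t + r) = init p (x - t) + integral {0..r} (\<lambda>r. source p (r, x - t + r, z (r, x - t + r)))" if "r \<ge> 0" for r
      using eq[OF that, of "x - t + r"] by simp
    show "solution (q, r, x - t + r) = init p (x - t) + integral {0..r} (\<lambda>r. source p (r, x - t + r, solution (q, r, x - t + r)))" if "r \<ge> 0" for r
      using solution_eq[OF that, of q "x - t + r"] by (simp add: p)
  qed
  then show ?thesis by simp
qed

lemma continuous_solution: "continuous_on half_plane (\<lambda>m. solution (p, m))"
  by (rule continuous_on_compose2[OF Ck_continuous[OF Ck_solution[of 0]]]) (auto intro!: continuous_intros)

text \<open>\<open>solution\<close> is chosen as a function of base point and tangent vectors
  together, but its equation contains the base point only; uniqueness then removes the dependence on
  the tangent vectors.\<close>

lemma solution_cong: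
  assumes "fst p = fst q" "t \<ge> 0"
  shows "solution (p, t, x) = solution (q, t, x)"
  using solution_unique[of "fst p" q "\<lambda>m. solution (p, m)", OF assms(1) continuous_solution solution_eq assms(2)] by simp

text \<open>By periodicity of the data, the translate by 1 solves the same equation, so uniqueness
  applies.\<close>

lemma solution_periodic:
  assumes "t \<ge> 0"
  shows "solution (p, t, x + 1) = solution (p, t, x)"
proof -
  have i: "init (fst p) (s + 1) = init (fst p) s" for s
    using init_mem[of "fst p"] by (simp add: topspace_E0)
  have f: "source (fst p) (r, \<eta> + 1, \<xi>) = source (fst p) (r, \<eta>, \<xi>)" if "r \<ge> 0" for r \<eta> \<xi>
    using source_mem[of "fst p"] that by (simp add: topspace_E1)
  define z where "z = (\<lambda>m. solution (p, fst m, snd m + 1))"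
  have "z (t, x) = solution (p, t, x)"
  proof (rule solution_unique[OF refl _ _ assms])
    show "continuous_on half_plane z"
      unfolding z_def
      by (rule continuous_on_compose2[OF continuous_solution, of _ "\<lambda>m. (fst m, snd m + 1)"]) (auto intro!: continuous_intros)
    show "z (t, x) = init (fst p) (x - t) + integral {0..t} (\<lambda>r. source (fst p) (r, x - t + r, z (r, x - t + r)))" if t: "t \<ge> 0" for t x
    proof -
      have "z (t, x) = init (fst p) (x + 1 - t) + integral {0..t} (\<lambda>r. source (fst p) (r, x + 1 - t + r, solution (p, r, x + 1 - t + r)))"
        using solution_eq[OF t, of p "x + 1"] by (simp add: z_def)
      also have "integral {0..t} (\<lambda>r. source (fst p) (r, x + 1 - t + r, solution (p, r, x + 1 - t + r))) =
          integral {0..t} (\<lambda>r. source (fst p) (r, x - t + r, z (r, x - t + r)))"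
      proof (rule integral_cong)
        fix r assume "r \<in> {0..t}"
        then have r: "r \<ge> 0" by simp
        have e: "x + 1 - t + r = x - t + r + 1" by simp
        show "source (fst p) (r, x + 1 - t + r, solution (p, r, x + 1 - t + r)) = source (fst p) (r, x - t + r, z (r, x - t + r))"
          unfolding z_def fst_conv snd_conv e by (rule f[OF r])
      qed
      also have "init (fst p) (x + 1 - t) = init (fst p) (x - t)"
        unfolding i[of "x - t", symmetric] by (rule arg_cong[of _ _ "init (fst p)"]) simp
      finally show ?thesis .
    qed
  qed
  then show ?thesis by (simp add: z_def)
qed

text \<open>Smoothness of all orders is demanded in one choice, since the next derivative is chosen
  from this one.\<close>

primrec solution_deriv :: "nat \<Rightarrow> params \<times> real \<times> real \<Rightarrow> real"
  where "solution_deriv 0 = solution"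
  | "solution_deriv (Suc l) = (SOME g. has_dir_deriv data_flow (Dp l) (solution_deriv l) g \<and> (\<forall>k. Ck data_flow k g))"

lemma Ck_solution_deriv: "Ck data_flow k (solution_deriv l)"
  and has_dir_deriv_solution_deriv: "has_dir_deriv data_flow (Dp l) (solution_deriv l) (solution_deriv (Suc l))"
proof -
  have "(\<forall>k. Ck data_flow k (solution_deriv l)) \<and> has_dir_deriv data_flow (Dp l) (solution_deriv l) (solution_deriv (Suc l))" for l
  proof (induction l)
    case 0
    from someI_ex[OF data_flow.smooth_dir_deriv[OF Ck_solution, of "Dp 0"]] show ?case
      by (simp add: Ck_solution)
  next
    case (Suc l)
    from Suc have "\<exists>g. has_dir_deriv data_flow (Dp l) (solution_deriv l) g \<and> (\<forall>k. Ck data_flow k g)"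
      by (intro data_flow.smooth_dir_deriv) blast
    from someI_ex[OF this] have C: "Ck data_flow k (solution_deriv (Suc l))" for k by simp
    from someI_ex[OF data_flow.smooth_dir_deriv[OF C, of "Dp (Suc l)"]] C show ?case by simp
  qed
  then show "Ck data_flow k (solution_deriv l)" "has_dir_deriv data_flow (Dp l) (solution_deriv l) (solution_deriv (Suc l))" by blast+
qed

declare solution_deriv.simps(2) [simp del]

lemma solution_deriv_derivative:
  assumes "t \<ge> 0"
  shows "((\<lambda>h. solution_deriv l (data_flow l h p, t, x)) has_real_derivative solution_deriv (Suc l) (data_flow l h p, t, x)) (at h)"
  using data_flow.has_dir_deriv_boundary[OF has_dir_deriv_solution_deriv Ck_continuous[OF Ck_solution_deriv[of 0]]
      Ck_continuous[OF Ck_solution_deriv[of 0]] _ assms, of l p x h] by simp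

text \<open>The derivative of order l + 1 is that of a function of h which, by induction, depends
  only on the base point, slot \<open>l\<close> and the earlier slots.\<close>

lemma solution_deriv_cong:
  assumes "fst p = fst q" "\<And>i. i < l \<Longrightarrow> snd p i = snd q i" "t \<ge> 0"
  shows "solution_deriv l (p, t, x) = solution_deriv l (q, t, x)"
  using assms(1,2)
proof (induction l arbitrary: p q)
  case 0
  then show ?case unfolding solution_deriv.simps(1) by (intro solution_cong assms(3))
next
  case (Suc l)
  have eq: "(\<lambda>h. solution_deriv l (data_flow l h p, t, x)) = (\<lambda>h. solution_deriv l (data_flow l h q, t, x))"
    by (intro ext Suc.IH) (simp_all add: data_flow_def Suc.prems)
  show ?case
    using DERIV_unique[OF solution_deriv_derivative[OF assms(3), of l p x 0, unfolded eq] solution_deriv_derivative[OF assms(3), of l q x 0]]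
    by (simp only: data_flow.flow_0)
qed

lemma solution_deriv_periodic:
  assumes "t \<ge> 0"
  shows "solution_deriv l (p, t, x + 1) = solution_deriv l (p, t, x)"
proof (induction l arbitrary: p)
  case 0
  show ?case unfolding solution_deriv.simps(1) by (rule solution_periodic[OF assms])
next
  case (Suc l)
  show ?case
    using DERIV_unique[OF solution_deriv_derivative[OF assms, of l p "x + 1" 0, unfolded Suc] solution_deriv_derivative[OF assms, of l p x 0]]
    by (simp only: data_flow.flow_0)
qed

section \<open>Continuity and differentiability with values in F\<close>

lemma continuous_into_F:
  assumes "continuous_map euclidean (C_top \<infinity> half_plane) (slice g)"
    and "\<And>p t x. t \<ge> 0 \<Longrightarrow> g (p, t, x + 1) = g (p, t, x)"
  shows "continuous_map euclidean F_space (slice g)"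
  unfolding F_space_def C_half_S1_def continuous_map_in_subtopology
  using assms by (auto simp: slice_def)

lemma continuous_solution_deriv: "continuous_map euclidean F_space (slice (solution_deriv l))"
  by (intro continuous_into_F data_flow.continuous_slice Ck_solution_deriv solution_deriv_periodic)

lemma slice_solution_deriv_mem: "slice (solution_deriv l) p \<in> topspace F_space"
  using continuous_map_image_subset_topspace[OF continuous_solution_deriv] by auto

text \<open>Convergence in \<open>F_space\<close> concerns all derivatives in (t, x) at once. It
  becomes continuity at h = 0 of a map from the real line into \<open>F_space\<close> whose value at
  0 is the derivative.\<close>

lemma limitin_solution_deriv:
  "limitin F_space (\<lambda>h. inverse h *\<^sub>R (slice (solution_deriv l) (data_flow l h p) - slice (solution_deriv l) p))
    (slice (solution_deriv (Suc l)) p) (at 0)"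
proof -
  \<comment> \<open>With q = (h, r), the base point is moved by r h, the fraction r of the step
    h.\<close>
  let ?\<kappa> = "\<lambda>q. data_flow l (snd q * fst q) p"
  \<comment> \<open>The difference quotient for \<open>h \<noteq> 0\<close>. As \<open>Q\<close> is smooth in \<open>(t, x)\<close>, jointly continuously in \<open>h\<close>,
    no interchange of partial derivatives is needed.\<close>
  define Q where "Q = (\<lambda>(h, t, x). integral {0..1} (\<lambda>r. solution_deriv (Suc l) (?\<kappa> (h, r), t, x)))"
  have c\<kappa>: "continuous_on UNIV ?\<kappa>"
    by (intro data_flow.continuous_on_flow continuous_intros)
  have "Ck no_flow k Q" for k
    using Ck_param_integral[OF Ck_pullback[OF Ck_solution_deriv[of k "Suc l"] c\<kappa>]] by (simp add: Q_def)
  then have "continuous_map euclidean (C_top \<infinity> half_plane) (slice Q)"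
    by (rule flows.continuous_slice[OF flows_no_flow])
  then have cQ: "continuous_map euclidean F_space (slice Q)"
    by (rule continuous_into_F) (simp add: Q_def solution_deriv_periodic)
  have Q0: "slice Q 0 = slice (solution_deriv (Suc l)) p"
    by (auto simp: slice_def Q_def fun_eq_iff)
  have "limitin F_space (slice Q) (slice Q 0) (at 0)"
    unfolding limitin_def
  proof (intro conjI allI impI)
    show "slice Q 0 \<in> topspace F_space" unfolding Q0 by (rule slice_solution_deriv_mem)
    fix U assume U: "openin F_space U \<and> slice Q 0 \<in> U"
    then have "open {h. slice Q h \<in> U}"
      using openin_continuous_map_preimage[OF cQ] by fastforce
    then have "\<forall>\<^sub>F h in nhds 0. h \<in> {h. slice Q h \<in> U}"
      by (rule eventually_nhds_in_open) (use U in simp)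
    then show "\<forall>\<^sub>F h in at 0. slice Q h \<in> U"
      by (auto simp: eventually_at_filter elim: eventually_mono)
  qed
  moreover have "slice Q h = inverse h *\<^sub>R (slice (solution_deriv l) (data_flow l h p) - slice (solution_deriv l) p)" if h: "h \<noteq> 0" for h
  proof
    fix m :: "real \<times> real"
    obtain t x where m: "m = (t, x)" by (cases m)
    show "slice Q h m = (inverse h *\<^sub>R (slice (solution_deriv l) (data_flow l h p) - slice (solution_deriv l) p)) m"
    proof (cases "t \<ge> 0")
      case True
      have "solution_deriv l (data_flow l h p, t, x) - solution_deriv l (data_flow l 0 p, t, x) =
          (h - 0) * integral {0..1} (\<lambda>r. solution_deriv (Suc l) (data_flow l (0 + r * (h - 0)) p, t, x))"
        by (rule hadamard[OF solution_deriv_derivative[OF True]])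
      then show ?thesis using True h by (simp add: m slice_def Q_def)
    qed (simp add: m slice_def)
  qed
  then have "\<forall>\<^sub>F h in at 0. slice Q h = inverse h *\<^sub>R (slice (solution_deriv l) (data_flow l h p) - slice (solution_deriv l) p)"
    by (auto simp: eventually_at_filter)
  ultimately show ?thesis
    unfolding Q0 by (rule limitin_transform_eventually[rotated])
qed

section \<open>Identification with \<open>Sol\<close>\<close>

definition param_of :: "((real \<Rightarrow> real) \<times> (real \<times> real \<times> real \<Rightarrow> real)) \<Rightarrow> (nat \<Rightarrow> (real \<Rightarrow> real) \<times> (real \<times> real \<times> real \<Rightarrow> real)) \<Rightarrow> params"
  where "param_of x u = (data_abs x, \<lambda>i. data_abs (u i))"

lemma continuous_param_of:
  "continuous_map (prod_topology E_space (product_topology (\<lambda>_. E_space) UNIV)) euclidean (\<lambda>(x, u). param_of x u)"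
proof -
  let ?T = "prod_topology E_space (product_topology (\<lambda>_. E_space) (UNIV :: nat set))"
  have 1: "continuous_map ?T euclidean (\<lambda>z. data_abs (fst z))"
    using continuous_map_compose[OF continuous_map_fst continuous_data_abs] by (simp add: o_def)
  have "continuous_map ?T euclidean (\<lambda>z. data_abs (snd z i))" for i
    using continuous_map_compose[OF continuous_map_compose[OF continuous_map_snd
        continuous_map_product_projection[of i UNIV "\<lambda>_. E_space"]] continuous_data_abs]
    by (simp add: o_def)
  then have 2: "continuous_map ?T euclidean (\<lambda>z i. data_abs (snd z i))"
    unfolding euclidean_product_topology[symmetric] continuous_map_componentwise_UNIV by blast
  have "continuous_map ?T (prod_topology euclidean euclidean) (\<lambda>z. (data_abs (fst z), \<lambda>i. data_abs (snd z i)))"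
    using 1 2 by (rule continuous_map_pairedI)
  then show ?thesis by (simp add: param_of_def case_prod_unfold)
qed

lemma C_fun_infinity_subset: "C_fun \<infinity> S \<subseteq> C_fun i S"
  by (auto simp: C_fun_def)

text \<open>The tangent slots are filled with 0; by \<open>solution_cong\<close> the filler does not
  influence the values at t \<ge> 0. An element of \<open>Sol\<close> is a priori of class C^1 only,
  but uniqueness on characteristics identifies it with the smooth solution.\<close>

lemma Sol_eq: "Sol = (\<lambda>x. (x, slice (solution_deriv 0) (param_of x (\<lambda>_. 0)))) ` topspace E_space"
proof -
  have *: "((y0, \<phi>), y) \<in> Sol \<longleftrightarrow> y = slice (solution_deriv 0) (param_of (y0, \<phi>) (\<lambda>_. 0))"
    if E: "(y0, \<phi>) \<in> topspace E_space" for y0 \<phi> y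
  proof -
    define p where "p = param_of (y0, \<phi>) (\<lambda>_. 0)"
    have p: "init (fst p) = y0" "source (fst p) = \<phi>"
      using E by (simp_all add: p_def param_of_def init_def source_def data_abs_inverse)
    show ?thesis
      unfolding p_def[symmetric]
    proof
      assume "((y0, \<phi>), y) \<in> Sol"
      then have y: "y \<in> C_fun 1 half_plane" and eq: "\<And>t \<eta>. t \<ge> 0 \<Longrightarrow> y (t, \<eta>) = y0 (\<eta> - t) +
          integral {0..t} (\<lambda>\<tau>. \<phi> (\<tau>, \<eta> - t + \<tau>, y (\<tau>, \<eta> - t + \<tau>)))"
        by (auto simp: Sol_def C_half_S1_def)
      have c: "continuous_on half_plane y" and out: "\<And>m. m \<notin> half_plane \<Longrightarrow> y m = 0"
        using y by (auto simp: C_fun_def)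
      have "y (t, x) = solution (p, t, x)" if "t \<ge> 0" for t x
        by (rule solution_unique[OF refl c _ that]) (simp add: p eq)
      then show "y = slice (solution_deriv 0) p"
        using out by (auto simp: slice_def fun_eq_iff)
    next
      assume y: "y = slice (solution_deriv 0) p"
      then have "y \<in> topspace F_space" by (simp only: slice_solution_deriv_mem)
      then have yC: "y \<in> C_fun \<infinity> half_plane" and per: "\<forall>t\<ge>0. \<forall>\<eta>. y (t, \<eta> + 1) = y (t, \<eta>)"
        by (auto simp: F_space_def C_half_S1_def)
      from yC per have "y \<in> topspace (C_half_S1 1)" by (auto simp: C_half_S1_def intro: C_fun_infinity_subset[THEN subsetD])
      moreover have "y (t, \<eta>) = y0 (\<eta> - t) + integral {0..t} (\<lambda>\<tau>. \<phi> (\<tau>, \<eta> - t + \<tau>, y (\<tau>, \<eta> - t + \<tau>)))" if t: "t \<ge> 0" for t \<eta>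
      proof -
        have "integral {0..t} (\<lambda>\<tau>. \<phi> (\<tau>, \<eta> - t + \<tau>, y (\<tau>, \<eta> - t + \<tau>))) =
            integral {0..t} (\<lambda>\<tau>. \<phi> (\<tau>, \<eta> - t + \<tau>, solution (p, \<tau>, \<eta> - t + \<tau>)))"
          by (rule integral_cong) (simp add: y slice_def)
        then show ?thesis
          using solution_eq[OF t, of p \<eta>] t by (simp add: p) (simp add: y slice_def)
      qed
      ultimately show "((y0, \<phi>), y) \<in> Sol" using E by (simp add: Sol_def)
    qed
  qed
  have dom: "((y0, \<phi>), y) \<in> Sol \<Longrightarrow> (y0, \<phi>) \<in> topspace E_space" for y0 \<phi> y
    by (simp add: Sol_def)
  show ?thesis
  proof (rule set_eqI)
    fix z :: "((real \<Rightarrow> real) \<times> (real \<times> real \<times> real \<Rightarrow> real)) \<times> (real \<times> real \<Rightarrow> real)"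
    obtain y0 \<phi> y where z: "z = ((y0, \<phi>), y)" by (metis surj_pair)
    show "z \<in> Sol \<longleftrightarrow> z \<in> (\<lambda>x. (x, slice (solution_deriv 0) (param_of x (\<lambda>_. 0)))) ` topspace E_space"
      unfolding z using *[of y0 \<phi> y] dom[of y0 \<phi> y] by (cases "(y0, \<phi>) \<in> topspace E_space") (auto simp del: solution_deriv.simps)
  qed
qed

theorem theorem5p6:
  shows "single_valued Sol \<and> Domain Sol = topspace E_space \<and> Range Sol \<subseteq> topspace F_space \<and>
    (E_space, F_space, Sol) \<in> C_inf_pi"
proof (intro conjI)
  show "single_valued Sol" by (auto simp: Sol_eq single_valued_def)
  show "Domain Sol = topspace E_space" by (force simp: Sol_eq)
  show "Range Sol \<subseteq> topspace F_space" by (auto simp: Sol_eq slice_solution_deriv_mem[of 0, simplified])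
  show "(E_space, F_space, Sol) \<in> C_inf_pi"
    unfolding Sol_eq
  proof (rule C_inf_piI[where D = "\<lambda>l x u. slice (solution_deriv l) (param_of x u)", OF locally_convex_E functional_topology_F])
    fix l x u v
    show "slice (solution_deriv l) (param_of x u) = slice (solution_deriv l) (param_of x v)" if "\<And>i. i < l \<Longrightarrow> u i = v i"
    proof -
      have "solution_deriv l (param_of x u, t, z) = solution_deriv l (param_of x v, t, z)" if "t \<ge> 0" for t z
        by (rule solution_deriv_cong[OF _ _ that]) (simp_all add: param_of_def \<open>\<And>i. i < l \<Longrightarrow> u i = v i\<close>)
      then show ?thesis by (auto simp: slice_def fun_eq_iff)
    qed
    show "limitin F_space (\<lambda>h. inverse h *\<^sub>R (slice (solution_deriv l) (param_of (x + h *\<^sub>R u l) u) - slice (solution_deriv l) (param_of x u)))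
        (slice (solution_deriv (Suc l)) (param_of x u)) (at 0)"
      if x: "x \<in> topspace E_space" and u: "range u \<subseteq> topspace E_space"
    proof -
      \<comment> \<open>Moving the base point along \<open>u l\<close> with all tangent vectors kept
        is the flow number \<open>l\<close>.\<close>
      have "param_of (x + h *\<^sub>R u l) u = data_flow l h (param_of x u)" for h
        using x u by (simp add: param_of_def data_flow_def data_shift_def data_abs_inverse image_subset_iff)
      then show ?thesis using limitin_solution_deriv[of l "param_of x u"] by simp
    qed
    show "continuous_map (prod_topology E_space (product_topology (\<lambda>_. E_space) UNIV)) F_space (\<lambda>(x, u). slice (solution_deriv l) (param_of x u))"
      using continuous_map_compose[OF continuous_param_of continuous_solution_deriv[of l]]
      by (simp add: o_def case_prod_unfold)
  qed
qed

end
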